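(* Let $\alpha>0$ and $\nu>\alpha^2$. Let $v_0\in H^1_{\alpha}(\mathbb{R}^n)$ have decay character $r^{\ast}(v_0)=r^{\ast}$, and let $v(t)$ be the solution to $$\partial_t(v-\alpha^2\Delta v)-\nu\Delta v=0$$ on $\mathbb{R}^n$ with initial datum $v_0$. Then: (1) if $-\frac n2<r^{\ast}<\infty$, there exist constants $C_1,C_2,C_3>0$ such that, for all $t>0$, $$C_1(1+t)^{-\left(\frac n2+r^{\ast}\right)}\le\Vert v(t)\Vert_{H^1_{\alpha}(\mathbb{R}^n)}^2\le C_2(C_3+t)^{-\left(\frac n2+r^{\ast}\right)};$$ (2) if $r^{\ast}=-\frac n2$, then given any $\epsilon>0$ there exists $C=C(\epsilon)>0$ such that $$\Vert v(t)\Vert_{H^1_{\alpha}(\mathbb{R}^n)}^2\ge C(1+t)^{-\epsilon}\quad\text{for all } t>0,$$ i.e. the decay is slower than any algebraic rate; (3) if $r^{\ast}=\infty$, then given any $m>0$ there exists $C=C(m)>0$ such that $$\Vert v(t)\Vert_{H^1_{\alpha}(\mathbb{R}^n)}^2\le C(1+t)^{-m}\quad\text{for all } t>0,$$ i.e. the decay is faster than any algebraic rate.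
   Context: The solution of the linear equation is given in Fourier space by $\widehat{v}(\xi,t)=e^{-\frac{\nu|\xi|^2}{1+\alpha^2|\xi|^2}t}\,\widehat{v_0}(\xi)$. Norm: $\Vert v\Vert_{H^1_{\alpha}(\mathbb{R}^n)}^2=\Vert v\Vert_{L^2(\mathbb{R}^n)}^2+\alpha^2\Vert\nabla v\Vert_{L^2(\mathbb{R}^n)}^2$; $H^1_\alpha(\mathbb{R}^n)$ is $H^1(\mathbb{R}^n)$ with this norm. Decay character: for $v_0\in L^2(\mathbb{R}^n)$ and $r\in(-\frac n2,\infty)$, the decay indicator is $$P_r(v_0)=\lim_{\rho\to0}\rho^{-2r-n}\int_{B(\rho)}|\widehat{v}_0(\xi)|^2\,d\xi,$$ where $B(\rho)$ is the ball of radius $\rho$ centered at the origin and $\widehat{v}_0$ is the Fourier transform. The decay character $r^{\ast}=r^{\ast}(v_0)$ is the unique $r\in(-\frac n2,\infty)$ such that $0<P_r(v_0)<\infty$, provided this number exists. If no such $r$ exists, one sets $r^{\ast}=-\frac n2$ when $P_r(v_0)=\infty$ for all $r\in(-\frac n2,\infty)$, and $r^{\ast}=\infty$ when $P_r(v_0)=0$ for all $r\in(-\frac n2,\infty)$. *)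

theory Defs
  imports "HOL-Analysis.Analysis"
begin

definition square_integrable ::
  "('a::euclidean_space \<Rightarrow> 'b::{real_normed_vector, second_countable_topology}) \<Rightarrow> bool"
where
  "square_integrable f \<longleftrightarrow>
     f \<in> borel_measurable lborel \<and> integrable lborel (\<lambda>x. (norm (f x))\<^sup>2)"

definition fourier_truncated ::
  "real \<Rightarrow> (real^'n \<Rightarrow> complex) \<Rightarrow> real^'n \<Rightarrow> complex"
where
  "fourier_truncated R f \<xi> = (LINT x:ball 0 R|lborel. cis (- (x \<bullet> \<xi>)) * f x)"

text \<open>
  The Fourier transform on \<open>L\<^sup>2\<close>: the limit in \<open>L\<^sup>2\<close> of the transforms of the truncations of
  \<open>f\<close> to balls, each of which lies in \<open>L\<^sup>1\<close>. The kernel \<open>exp (- i x \<bullet> \<xi>)\<close> is the one for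
  which minus the Laplacian has symbol \<open>(norm \<xi>)\<^sup>2\<close>. The transform is determined up to
  null sets, and \<open>fourier_L2 f\<close> is some representative.
\<close>

definition has_fourier_L2 ::
  "(real^'n \<Rightarrow> complex) \<Rightarrow> (real^'n \<Rightarrow> complex) \<Rightarrow> bool"
where
  "has_fourier_L2 f g \<longleftrightarrow> square_integrable g \<and>
     ((\<lambda>R. \<integral>\<^sup>+ \<xi>. ennreal ((cmod (g \<xi> - fourier_truncated R f \<xi>))\<^sup>2) \<partial>lborel)
        \<longlongrightarrow> 0) at_top"

definition fourier_L2 :: "(real^'n \<Rightarrow> complex) \<Rightarrow> real^'n \<Rightarrow> complex"
where
  "fourier_L2 f = (SOME g. has_fourier_L2 f g)"

text \<open>
  \<open>has_decay_indicator f r P\<close> says that the limit defining the decay indicator exists in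
  \<open>[0, \<infinity>]\<close> and equals \<open>P\<close>.
\<close>

definition has_decay_indicator ::
  "(real^'n \<Rightarrow> complex) \<Rightarrow> real \<Rightarrow> ereal \<Rightarrow> bool"
where
  "has_decay_indicator f r P \<longleftrightarrow>
     ((\<lambda>\<rho>. ereal (\<rho> powr (- 2 * r - real CARD('n)) *
            (LINT \<xi>:ball 0 \<rho>|lborel. (cmod (fourier_L2 f \<xi>))\<^sup>2)))
        \<longlongrightarrow> P) (at_right 0)"

text \<open>
  The three alternatives exclude each other, and the exponent in the first one is unique:
  if the indicator is finite and positive at \<open>r\<close>, it is \<open>0\<close> below \<open>r\<close> and \<open>\<infinity>\<close> above.
  A function need not have a decay character, hence a relation.
\<close>

definition has_decay_character :: "(real^'n \<Rightarrow> complex) \<Rightarrow> ereal \<Rightarrow> bool"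
where
  "has_decay_character f rs \<longleftrightarrow>
     (\<exists>r. rs = ereal r \<and> r > - real CARD('n) / 2 \<and>
          (\<exists>P. 0 < P \<and> P < \<infinity> \<and> has_decay_indicator f r P)) \<or>
     (rs = ereal (- real CARD('n) / 2) \<and>
          (\<forall>r > - real CARD('n) / 2. has_decay_indicator f r \<infinity>)) \<or>
     (rs = \<infinity> \<and>
          (\<forall>r > - real CARD('n) / 2. has_decay_indicator f r 0))"

definition partial_deriv :: "'n \<Rightarrow> (real^'n \<Rightarrow> complex) \<Rightarrow> real^'n \<Rightarrow> complex"
where
  "partial_deriv i \<phi> x = frechet_derivative \<phi> (at x) (axis i 1)"

text \<open>
  Weak derivatives of first order are tested against continuously differentiable functions
  of compact support, as in Gilbarg and Trudinger. By mollification, smooth test functions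
  of compact support give the same weak derivatives.
\<close>

definition test_function :: "(real^'n \<Rightarrow> complex) \<Rightarrow> bool"
where
  "test_function \<phi> \<longleftrightarrow>
     (\<forall>x. \<phi> differentiable (at x)) \<and>
     (\<forall>i. continuous_on UNIV (partial_deriv i \<phi>)) \<and>
     compact (closure {x. \<phi> x \<noteq> 0})"

definition has_weak_gradient ::
  "(real^'n \<Rightarrow> complex) \<Rightarrow> (real^'n \<Rightarrow> complex^'n) \<Rightarrow> bool"
where
  "has_weak_gradient f g \<longleftrightarrow>
     (\<forall>\<phi> i. test_function \<phi> \<longrightarrow>
        (LINT x|lborel. f x * partial_deriv i \<phi> x) = - (LINT x|lborel. g x $ i * \<phi> x))"

definition H1 :: "(real^'n \<Rightarrow> complex) set"
where
  "H1 = {f. square_integrable f \<and> (\<exists>g. square_integrable g \<and> has_weak_gradient f g)}"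

definition weak_gradient :: "(real^'n \<Rightarrow> complex) \<Rightarrow> real^'n \<Rightarrow> complex^'n"
where
  "weak_gradient f = (SOME g. square_integrable g \<and> has_weak_gradient f g)"

definition H1_norm :: "real \<Rightarrow> (real^'n \<Rightarrow> complex) \<Rightarrow> real"
where
  "H1_norm \<alpha> f = sqrt ((LINT x|lborel. (cmod (f x))\<^sup>2) +
                       \<alpha>\<^sup>2 * (LINT x|lborel. (norm (weak_gradient f x))\<^sup>2))"

definition has_H1_time_derivative ::
  "real \<Rightarrow> (real \<Rightarrow> real^'n \<Rightarrow> complex) \<Rightarrow> (real^'n \<Rightarrow> complex) \<Rightarrow> real \<Rightarrow> bool"
where
  "has_H1_time_derivative \<alpha> v w t \<longleftrightarrow>
     w \<in> H1 \<and>
     ((\<lambda>s. H1_norm \<alpha> (\<lambda>x. (v s x - v t x) / complex_of_real (s - t) - w x)) \<longlongrightarrow> 0) (at t)"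

text \<open>
  A solution is a curve, continuous on \<open>[0, \<infinity>)\<close> and differentiable on \<open>(0, \<infinity>)\<close> with values
  in \<open>H1\<close>, that starts at \<open>v0\<close> and satisfies the equation in the weak sense in space. With
  \<open>w\<close> the time derivative of \<open>v\<close>, the equation is \<open>w - \<alpha>\<^sup>2 \<Delta> w - \<nu> \<Delta> v = 0\<close>; each Laplacian is
  moved by one integration by parts onto the test function.
\<close>

definition linear_solution ::
  "real \<Rightarrow> real \<Rightarrow> (real^'n \<Rightarrow> complex) \<Rightarrow> (real \<Rightarrow> real^'n \<Rightarrow> complex) \<Rightarrow> bool"
where
  "linear_solution \<alpha> \<nu> v0 v \<longleftrightarrow>
     (\<forall>t\<ge>0. v t \<in> H1) \<and>
     (AE x in lborel. v 0 x = v0 x) \<and>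
     (\<forall>t\<ge>0. ((\<lambda>s. H1_norm \<alpha> (\<lambda>x. v s x - v t x)) \<longlongrightarrow> 0) (at t within {0..})) \<and>
     (\<forall>t>0. \<exists>w. has_H1_time_derivative \<alpha> v w t \<and>
        (\<forall>\<phi>. test_function \<phi> \<longrightarrow>
           (LINT x|lborel. w x * \<phi> x)
           + complex_of_real (\<alpha>\<^sup>2) *
               (LINT x|lborel. (\<Sum>i\<in>UNIV. weak_gradient w x $ i * partial_deriv i \<phi> x))
           + complex_of_real \<nu> *
               (LINT x|lborel. (\<Sum>i\<in>UNIV. weak_gradient (v t) x $ i * partial_deriv i \<phi> x))
           = 0))"

end

theory Submission
  imports Defs "HOL-Probability.Characteristic_Functions"
begin

text \<open>
  By Plancherel's theorem, testing the weak equations against plane waves cut off at a radius that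
  tends to infinity turns them into pointwise relations between Fourier transforms: the components of
  the weak gradient of \<open>f\<close> have the transforms of \<open>f\<close> times \<open>\<i> \<xi>\<^sub>j\<close>, and a solution satisfies a linear
  ordinary differential equation in \<open>L\<^sup>2\<close> whose rate \<open>m \<xi> = \<nu> (norm \<xi>)\<^sup>2 / (1 + \<alpha>\<^sup>2 (norm \<xi>)\<^sup>2)\<close> is
  bounded. Hence the squared \<open>H\<^sup>1\<close> norm at time \<open>t\<close> is, up to a constant, the integral of
  \<open>(1 + \<alpha>\<^sup>2 (norm \<xi>)\<^sup>2) exp (- 2 t m \<xi>)\<close> against the spectral density of the initial datum.
  Restricting the integral to the ball of radius \<open>\<delta> (1 + t) powr (- 1/2)\<close> bounds it from below by the
  mass that the decay indicator measures. For the upper bound, the frequencies with \<open>\<alpha> norm \<xi> > 1\<close>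
  decay exponentially, and on the others \<open>2 m \<xi>\<close> is at least \<open>\<nu> (norm \<xi>)\<^sup>2\<close>, so that a sum over
  shells of width \<open>(1 + t) powr (- 1/2)\<close> applies.
\<close>

section \<open>Gaussians\<close>

text \<open>Both \<open>fourier_L2\<close> and \<open>weak_gradient\<close> are choices made by
  \<open>SOME\<close>, so nothing is known about them until the objects to choose from exist and
  agree up to null sets. For the transform this needs Plancherel's identity and completeness of L^2.
  The identity uses neither an inversion formula nor Schwartz functions: the autocorrelation of
  \<open>h\<close> has transform |fourier h|^2, and integrating that against ever wider Gaussians
  recovers the autocorrelation at 0, the squared norm of \<open>h\<close>. A solution is any curve
  satisfying the weak formulation, so the formula in Fourier space has to be derived. Because the
  rate is at most \<nu> / \<alpha>^2, the integrating factor exp (m t) is a bounded multiplier and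
  keeps the argument inside L^2. The price is that high frequencies decay no faster than at a fixed
  exponential rate: nothing is smoothed, and the weight 1 + \<alpha>^2 |\<xi>|^2 must be absorbed by
  the initial H^1 norm. The exponent comes from a balance: at time t the frequencies up to order
  t^(-1/2) are still undamped, and mass of order \<rho>^(n + 2 r) in the ball of radius \<rho>
  becomes t^(-(n/2 + r)).\<close>

lemma integral_lborel_affine:
  fixes f :: "'a::euclidean_space \<Rightarrow> 'b::{banach, second_countable_topology}"
  assumes [measurable]: "f \<in> borel_measurable borel" and c: "c \<noteq> 0"
  shows "(LINT x|lborel. f x) = \<bar>c\<bar> ^ DIM('a) *\<^sub>R (LINT x|lborel. f (t + c *\<^sub>R x))"
  by (subst lborel_affine[OF c, of t]) (simp add: integral_density integral_distr)

lemma integrable_lborel_affine: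
  fixes f :: "'a::euclidean_space \<Rightarrow> 'b::{banach, second_countable_topology}"
  assumes "integrable lborel f" and c: "c \<noteq> 0"
  shows "integrable lborel (\<lambda>x. f (t + c *\<^sub>R x))"
proof -
  have [measurable]: "f \<in> borel_measurable borel" using assms(1) by auto
  have "integrable (density (distr lborel borel (\<lambda>x. t + c *\<^sub>R x)) (\<lambda>_. \<bar>c\<bar> ^ DIM('a))) f"
    using assms(1) lborel_affine[OF c, of t] by simp
  then have "integrable lborel (\<lambda>x. \<bar>c\<bar> ^ DIM('a) *\<^sub>R f (t + c *\<^sub>R x))"
    by (simp add: integrable_density integrable_distr_eq)
  from integrable_scaleR_right[OF this, of "1 / \<bar>c\<bar> ^ DIM('a)"] show ?thesis
    using c by simp
qed

text \<open>Since \<open>lborel\<close> is the image of a product of one-dimensional Lebesgue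
  measures indexed by \<open>Basis\<close>, this is Fubini for a finite product measure.\<close>

lemma lborel_euclidean_prod:
  fixes f :: "'a::euclidean_space \<Rightarrow> real \<Rightarrow> complex"
  assumes f: "\<And>b. b \<in> Basis \<Longrightarrow> integrable lborel (f b)"
  shows "integrable lborel (\<lambda>x. \<Prod>b\<in>Basis. f b (x \<bullet> b))" (is ?A)
    and "(LINT x|lborel. (\<Prod>b\<in>Basis. f b (x \<bullet> b))) = (\<Prod>b\<in>Basis. (LINT x|lborel. f b x))" (is ?B)
proof -
  interpret product_sigma_finite "\<lambda>_::'a. lborel :: real measure" ..
  have [measurable]: "b \<in> Basis \<Longrightarrow> f b \<in> borel_measurable borel" for b using f by auto
  have [simp]: "(\<Sum>c\<in>Basis. x c *\<^sub>R c) \<bullet> b = x b" if "b \<in> Basis" for x :: "'a \<Rightarrow> real" and b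
    using that by simp
  have eq: "(\<Prod>b\<in>Basis. f b ((\<Sum>c\<in>Basis. x c *\<^sub>R c) \<bullet> b)) = (\<Prod>b\<in>Basis. f b (x b))" for x :: "'a \<Rightarrow> real"
    by (intro prod.cong) auto
  show ?A
    by (subst lborel_eq, subst integrable_distr_eq)
       (auto simp: eq intro!: product_integrable_prod f)
  show ?B
    by (subst lborel_eq, subst integral_distr)
       (auto simp: eq intro!: product_integral_prod f)
qed

definition gauss :: "'a::euclidean_space \<Rightarrow> real" where
  "gauss x = exp (- ((norm x)\<^sup>2 / 2))"

lemma gauss_measurable [measurable]: "gauss \<in> borel_measurable borel"
  unfolding gauss_def[abs_def] by measurable

lemma gauss_bounds: "0 < gauss x" "gauss x \<le> 1"
  by (auto simp: gauss_def)

lemma cis_measurable [measurable]: "cis \<in> borel_measurable borel"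
  by (intro borel_measurable_continuous_onI continuous_intros)

text \<open>This is the characteristic function of the standard normal distribution at
  \<open>- t\<close>, multiplied by sqrt (2 pi) to undo the normalisation of the density.\<close>

lemma std_gauss_fourier:
  "integrable lborel (\<lambda>x. cis (- (x * t)) * exp (- (x\<^sup>2 / 2)))"
  "(LINT x|lborel. cis (- (x * t)) * exp (- (x\<^sup>2 / 2))) = complex_of_real (sqrt (2 * pi) * exp (- (t\<^sup>2 / 2)))"
proof -
  have i: "integrable lborel (\<lambda>x::real. std_normal_density x)"
    by (rule integrable_normal_density) simp
  have i2: "integrable lborel (\<lambda>x::real. exp (- (x\<^sup>2 / 2)))"
    using integrable_mult_right[OF i, of "sqrt (2*pi)"] by (simp add: std_normal_density_def)
  show "integrable lborel (\<lambda>x. cis (- (x * t)) * exp (- (x\<^sup>2 / 2)))"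
    by (rule Bochner_Integration.integrable_bound[OF i2]) (auto simp: norm_mult simp flip: of_real_exp)
  have "(LINT x|std_normal_distribution. cis (- (x * t))) = exp (- (t\<^sup>2 / 2))"
    using fun_cong[OF char_std_normal_distribution, of "-t"]
    by (simp add: char_def cis_conv_exp mult.commute)
  moreover have "(LINT x|std_normal_distribution. cis (- (x * t))) = (LINT x|lborel. std_normal_density x *\<^sub>R cis (- (x * t)))"
    by (rule integral_density) auto
  moreover have "\<dots> = (LINT x|lborel. (1 / sqrt (2 * pi)) *\<^sub>R (cis (- (x * t)) * exp (- (x\<^sup>2 / 2))))"
    by (intro Bochner_Integration.integral_cong) (auto simp: std_normal_density_def scaleR_conv_of_real mult_ac simp flip: of_real_exp)
  ultimately have "(1 / sqrt (2 * pi)) *\<^sub>R (LINT x|lborel. (cis (- (x * t)) * exp (- (x\<^sup>2 / 2)))) = exp (- (t\<^sup>2 / 2))"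
    by simp
  then have "complex_of_real (sqrt (2*pi)) * ((1 / sqrt (2 * pi)) *\<^sub>R (LINT x|lborel. (cis (- (x * t)) * exp (- (x\<^sup>2 / 2))))) = complex_of_real (sqrt (2*pi)) * exp (- (t\<^sup>2 / 2))"
    by simp
  then show "(LINT x|lborel. cis (- (x * t)) * exp (- (x\<^sup>2 / 2))) = complex_of_real (sqrt (2 * pi) * exp (- (t\<^sup>2 / 2)))"
    by (simp add: scaleR_conv_of_real)
qed

lemma cis_sum: "finite A \<Longrightarrow> cis (\<Sum>a\<in>A. f a) = (\<Prod>a\<in>A. cis (f a))"
  by (induction A rule: finite_induct) (auto simp flip: cis_mult)

lemma gauss_prod: "gauss (x::'a::euclidean_space) = (\<Prod>b\<in>Basis. exp (- ((x \<bullet> b)\<^sup>2 / 2)))"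
proof -
  have "(norm x)\<^sup>2 = (\<Sum>b\<in>Basis. (x \<bullet> b)\<^sup>2)"
    unfolding power2_norm_eq_inner by (subst euclidean_inner) (simp add: power2_eq_square)
  then show ?thesis
    by (simp add: gauss_def sum_negf sum_divide_distrib flip: exp_sum)
qed

text \<open>Gaussian and plane wave both factor over an orthonormal basis, so the one-dimensional
  case suffices. The Gaussian is an eigenfunction of this unnormalised transform.\<close>

lemma gauss_fourier:
  fixes z :: "'a::euclidean_space"
  shows "integrable lborel (\<lambda>x. cis (- (x \<bullet> z)) * gauss x)" (is ?A)
    and "(LINT x|lborel. cis (- (x \<bullet> z)) * gauss x) = complex_of_real (sqrt (2 * pi) ^ DIM('a) * gauss z)" (is ?B)
proof -
  have eq: "cis (- (x \<bullet> z)) * gauss x = (\<Prod>b\<in>Basis. cis (- ((x \<bullet> b) * (z \<bullet> b))) * exp (- ((x \<bullet> b)\<^sup>2 / 2)))" for x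
  proof -
    have "- (x \<bullet> z) = (\<Sum>b\<in>Basis. - ((x \<bullet> b) * (z \<bullet> b)))"
      by (subst euclidean_inner) (simp add: sum_negf)
    then show ?thesis
      by (simp add: cis_sum gauss_prod prod.distrib del: of_real_exp)
  qed
  let ?f = "\<lambda>b x. cis (- (x * (z \<bullet> b))) * complex_of_real (exp (- (x\<^sup>2 / 2)))"
  have *: "integrable lborel (?f b)" for b by (rule std_gauss_fourier)
  have "integrable lborel (\<lambda>x::'a. (\<Prod>b\<in>Basis. ?f b (x \<bullet> b)))"
    by (rule lborel_euclidean_prod(1)[of ?f]) (rule *)
  then show ?A by (simp only: eq)
  have "(LINT x|lborel. (\<Prod>b\<in>Basis. ?f b (x \<bullet> b))) = (\<Prod>b\<in>Basis. (LINT x|lborel. ?f b x))"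
    by (rule lborel_euclidean_prod(2)[of ?f]) (rule *)
  also have "\<dots> = (\<Prod>b\<in>(Basis::'a set). complex_of_real (sqrt (2 * pi) * exp (- ((z \<bullet> b)\<^sup>2 / 2))))"
    by (simp only: std_gauss_fourier(2))
  also have "\<dots> = complex_of_real (sqrt (2 * pi) ^ DIM('a) * gauss z)"
    by (simp add: gauss_prod prod.distrib del: of_real_exp)
  finally show ?B by (simp only: eq)
qed

lemma gauss_integrable: "integrable lborel (gauss :: 'a::euclidean_space \<Rightarrow> real)"
proof -
  have "integrable lborel (\<lambda>x::'a. complex_of_real (gauss x))"
    using gauss_fourier(1)[of 0] by simp
  then show ?thesis by (simp only: complex_of_real_integrable_eq)
qed

lemma gauss_integral: "(LINT x|lborel. gauss (x::'a::euclidean_space)) = sqrt (2 * pi) ^ DIM('a)"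
proof -
  have "complex_of_real (LINT x|lborel. gauss (x::'a)) = complex_of_real (sqrt (2 * pi) ^ DIM('a))"
    using gauss_fourier(2)[of "0::'a"] by (simp add: gauss_def)
  then show ?thesis using of_real_eq_iff by blast
qed

section \<open>Square-integrable functions and their translates\<close>

text \<open>Off L^2 the Bochner integral takes its default value 0, so this is 0 there rather than
  infinite. A small \<open>l2norm\<close> is informative only together with
  \<open>square_integrable\<close>.\<close>

definition l2norm :: "('a::euclidean_space \<Rightarrow> 'b::real_normed_vector) \<Rightarrow> real" where
  "l2norm f = sqrt (LINT x|lborel. (norm (f x))\<^sup>2)"

lemma square_integrableD:
  assumes "square_integrable f"
  shows "f \<in> borel_measurable borel" "integrable lborel (\<lambda>x. (norm (f x))\<^sup>2)"
  using assms by (auto simp: square_integrable_def)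

lemma l2norm_nonneg [simp]: "0 \<le> l2norm f"
  by (simp add: l2norm_def)

lemma l2norm_power2: "(l2norm f)\<^sup>2 = (LINT x|lborel. (norm (f x))\<^sup>2)"
  by (simp add: l2norm_def)

lemma nn_integral_power2_norm:
  assumes "square_integrable f"
  shows "(\<integral>\<^sup>+ x. ennreal ((norm (f x))\<^sup>2) \<partial>lborel) = ennreal ((l2norm f)\<^sup>2)"
  unfolding l2norm_power2
  by (rule nn_integral_eq_integral) (use square_integrableD[OF assms] in auto)

lemma square_integrable_bound:
  fixes f :: "'a::euclidean_space \<Rightarrow> 'b::{real_normed_vector, second_countable_topology}"
    and g :: "'a \<Rightarrow> 'c::{real_normed_vector, second_countable_topology}"
  assumes "square_integrable f" "g \<in> borel_measurable borel" "\<And>x. norm (g x) \<le> C * norm (f x)"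
  shows "square_integrable g"
  unfolding square_integrable_def
proof
  show "integrable lborel (\<lambda>x. (norm (g x))\<^sup>2)"
  proof (rule Bochner_Integration.integrable_bound)
    show "integrable lborel (\<lambda>x. C\<^sup>2 * (norm (f x))\<^sup>2)"
      using assms(1) by (auto simp: square_integrable_def)
    show "AE x in lborel. norm ((norm (g x))\<^sup>2) \<le> norm (C\<^sup>2 * (norm (f x))\<^sup>2)"
      using assms(3) by (auto simp: abs_mult power_mono simp flip: power_mult_distrib)
  qed (use assms(2) in auto)
qed (use assms in auto)

lemma square_integrable_add:
  assumes "square_integrable f" "square_integrable g"
  shows "square_integrable (\<lambda>x. f x + g x)"
  unfolding square_integrable_def
proof
  show meas: "(\<lambda>x. f x + g x) \<in> borel_measurable lborel"
    using square_integrableD[OF assms(1)] square_integrableD[OF assms(2)] by simp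
  show "integrable lborel (\<lambda>x. (norm (f x + g x))\<^sup>2)"
  proof (rule Bochner_Integration.integrable_bound)
    show "integrable lborel (\<lambda>x. 2 * (norm (f x))\<^sup>2 + 2 * (norm (g x))\<^sup>2)"
      using assms by (auto simp: square_integrable_def)
    have "(norm (f x + g x))\<^sup>2 \<le> 2 * (norm (f x))\<^sup>2 + 2 * (norm (g x))\<^sup>2" for x
    proof -
      have "(norm (f x + g x))\<^sup>2 \<le> (norm (f x) + norm (g x))\<^sup>2"
        by (intro power_mono norm_triangle_ineq) auto
      also have "\<dots> \<le> 2 * (norm (f x))\<^sup>2 + 2 * (norm (g x))\<^sup>2"
        using zero_le_power2[of "norm (f x) - norm (g x)"] by (simp add: power2_eq_square algebra_simps)
      finally show ?thesis .
    qed
    then show "AE x in lborel. norm ((norm (f x + g x))\<^sup>2) \<le> norm (2 * (norm (f x))\<^sup>2 + 2 * (norm (g x))\<^sup>2)"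
      by auto
  qed (use meas in auto)
qed

lemma square_integrable_cmult:
  fixes f :: "'a::euclidean_space \<Rightarrow> complex"
  assumes "square_integrable f"
  shows "square_integrable (\<lambda>x. c * f x)"
  by (rule square_integrable_bound[OF assms, where C = "cmod c"])
     (use square_integrableD[OF assms] in \<open>auto simp: norm_mult\<close>)

lemma square_integrable_diff:
  fixes f :: "'a::euclidean_space \<Rightarrow> complex"
  assumes "square_integrable f" "square_integrable g"
  shows "square_integrable (\<lambda>x. f x - g x)"
  using square_integrable_add[OF assms(1) square_integrable_cmult[OF assms(2), of "-1"]] by simp

lemma l2norm_cmult:
  fixes f :: "'a::euclidean_space \<Rightarrow> complex"
  shows "l2norm (\<lambda>x. c * f x) = cmod c * l2norm f"
  by (simp add: l2norm_def norm_mult power_mult_distrib real_sqrt_mult)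

lemma l2norm_minus_commute:
  fixes f :: "'a::euclidean_space \<Rightarrow> complex"
  shows "l2norm (\<lambda>x. f x - g x) = l2norm (\<lambda>x. g x - f x)"
  by (simp add: l2norm_def norm_minus_commute)

text \<open>The product is dominated by the sum of the squares. The inequality is Cauchy-Schwarz for
  nonnegative integrals, brought back to the reals once all three are known to be finite.\<close>

lemma square_integrable_mult:
  fixes f g :: "'a::euclidean_space \<Rightarrow> complex"
  assumes "square_integrable f" "square_integrable g"
  shows "integrable lborel (\<lambda>x. f x * g x)"
    and "(LINT x|lborel. cmod (f x) * cmod (g x)) \<le> l2norm f * l2norm g"
proof -
  note [measurable] = square_integrableD(1)[OF assms(1)] square_integrableD(1)[OF assms(2)]
  show int: "integrable lborel (\<lambda>x. f x * g x)"
  proof (rule Bochner_Integration.integrable_bound)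
    show "integrable lborel (\<lambda>x. (cmod (f x))\<^sup>2 + (cmod (g x))\<^sup>2)"
      using assms by (auto simp: square_integrable_def)
    have "a * b \<le> a\<^sup>2 + b\<^sup>2" if "a \<ge> 0" "b \<ge> 0" for a b :: real
    proof -
      have "2 * (a * b) \<le> a\<^sup>2 + b\<^sup>2" using sum_squares_bound[of a b] by (simp add: mult.assoc)
      moreover have "0 \<le> a * b" using that by simp
      ultimately show ?thesis by linarith
    qed
    then show "AE x in lborel. cmod (f x * g x) \<le> norm ((cmod (f x))\<^sup>2 + (cmod (g x))\<^sup>2)"
      by (auto simp: norm_mult)
  qed auto
  have *: "(\<integral>\<^sup>+ x. ennreal (cmod (f x)) * ennreal (cmod (g x)) \<partial>lborel) = ennreal (LINT x|lborel. cmod (f x) * cmod (g x))"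
  proof -
    have "integrable lborel (\<lambda>x. cmod (f x) * cmod (g x))"
      using integrable_norm[OF int] by (simp add: norm_mult)
    from nn_integral_eq_integral[OF this] show ?thesis by (simp add: ennreal_mult)
  qed
  have "(\<integral>\<^sup>+ x. ennreal (cmod (f x)) * ennreal (cmod (g x)) \<partial>lborel)\<^sup>2 \<le>
        (\<integral>\<^sup>+ x. (ennreal (cmod (f x)))\<^sup>2 \<partial>lborel) * (\<integral>\<^sup>+ x. (ennreal (cmod (g x)))\<^sup>2 \<partial>lborel)"
    by (rule Cauchy_Schwarz_nn_integral) auto
  also have "\<dots> = ennreal ((l2norm f)\<^sup>2) * ennreal ((l2norm g)\<^sup>2)"
    using nn_integral_power2_norm[OF assms(1)] nn_integral_power2_norm[OF assms(2)]
    by (simp add: ennreal_power)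
  finally have "ennreal ((LINT x|lborel. cmod (f x) * cmod (g x))\<^sup>2) \<le> ennreal ((l2norm f * l2norm g)\<^sup>2)"
    unfolding * by (simp add: ennreal_power power_mult_distrib ennreal_mult)
  then have "(LINT x|lborel. cmod (f x) * cmod (g x))\<^sup>2 \<le> (l2norm f * l2norm g)\<^sup>2"
    by (subst (asm) ennreal_le_iff) auto
  then show "(LINT x|lborel. cmod (f x) * cmod (g x)) \<le> l2norm f * l2norm g"
    by (rule power2_le_imp_le) simp
qed

lemma l2norm_triangle:
  fixes f g :: "'a::euclidean_space \<Rightarrow> complex"
  assumes "square_integrable f" "square_integrable g"
  shows "l2norm (\<lambda>x. f x + g x) \<le> l2norm f + l2norm g"
proof (rule power2_le_imp_le)
  note i = square_integrableD(2)[OF assms(1)] square_integrableD(2)[OF assms(2)]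
    square_integrable_mult[OF assms] square_integrableD(2)[OF square_integrable_add[OF assms]]
  have fg: "integrable lborel (\<lambda>x. cmod (f x) * cmod (g x))"
    using integrable_norm[OF i(3)] by (simp add: norm_mult)
  have "(l2norm (\<lambda>x. f x + g x))\<^sup>2 \<le> (LINT x|lborel. (cmod (f x))\<^sup>2 + 2 * (cmod (f x) * cmod (g x)) + (cmod (g x))\<^sup>2)"
    unfolding l2norm_power2
  proof (rule integral_mono)
    fix x
    have "(cmod (f x + g x))\<^sup>2 \<le> (cmod (f x) + cmod (g x))\<^sup>2"
      by (intro power_mono norm_triangle_ineq) auto
    then show "(cmod (f x + g x))\<^sup>2 \<le> (cmod (f x))\<^sup>2 + 2 * (cmod (f x) * cmod (g x)) + (cmod (g x))\<^sup>2"
      by (simp add: power2_sum)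
  qed (use i fg in auto)
  also have "\<dots> = (l2norm f)\<^sup>2 + 2 * (LINT x|lborel. cmod (f x) * cmod (g x)) + (l2norm g)\<^sup>2"
    using i fg by (simp add: l2norm_power2)
  also have "\<dots> \<le> (l2norm f + l2norm g)\<^sup>2"
    using i(4) by (simp add: power2_sum)
  finally show "(l2norm (\<lambda>x. f x + g x))\<^sup>2 \<le> (l2norm f + l2norm g)\<^sup>2" .
qed simp

lemma l2norm_triangle_diff:
  fixes f g h :: "'a::euclidean_space \<Rightarrow> complex"
  assumes "square_integrable f" "square_integrable g" "square_integrable h"
  shows "l2norm (\<lambda>x. f x - h x) \<le> l2norm (\<lambda>x. f x - g x) + l2norm (\<lambda>x. g x - h x)"
  using l2norm_triangle[OF square_integrable_diff[OF assms(1,2)] square_integrable_diff[OF assms(2,3)]]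
  by simp

lemma l2norm_eq_0_iff:
  assumes "square_integrable f"
  shows "l2norm f = 0 \<longleftrightarrow> (AE x in lborel. f x = 0)"
  using square_integrableD[OF assms]
  by (simp add: l2norm_def integral_nonneg_eq_0_iff_AE)

text \<open>The shape of a density argument: \<open>e\<close> is the cost of replacing an object by
  a nicer one, and \<open>b\<close>, which may depend on \<open>e\<close>, is the error for the
  nicer one.\<close>

lemma tendsto_zero_approx:
  fixes a :: "nat \<Rightarrow> real"
  assumes "\<And>e. e > 0 \<Longrightarrow> \<exists>b. b \<longlonglongrightarrow> 0 \<and> (\<forall>k. norm (a k) \<le> e + b k)"
  shows "a \<longlonglongrightarrow> 0"
proof (rule LIMSEQ_I)
  fix r :: real assume "r > 0"
  then obtain b where b: "b \<longlonglongrightarrow> 0" "\<And>k. norm (a k) \<le> r / 2 + b k"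
    using assms[of "r/2"] by auto
  from LIMSEQ_D[OF b(1), of "r/2"] \<open>r > 0\<close> obtain N where "\<And>k. k \<ge> N \<Longrightarrow> norm (b k - 0) < r / 2"
    by auto
  then show "\<exists>N. \<forall>k\<ge>N. norm (a k - 0) < r"
    using b(2) by (intro exI[of _ N]) (smt (verit, best) real_norm_def diff_zero field_sum_of_halves)
qed

section \<open>Continuity of translations in L^1 and L^2\<close>

lemma integral_translate:
  fixes f :: "'a::euclidean_space \<Rightarrow> 'b::{banach, second_countable_topology}"
  assumes "f \<in> borel_measurable borel"
  shows "(LINT x|lborel. f (x - z)) = (LINT x|lborel. f x)"
  using integral_lborel_affine[OF assms, of 1 "- z"] by simp

lemma integrable_translate:
  fixes f :: "'a::euclidean_space \<Rightarrow> 'b::{banach, second_countable_topology}"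
  assumes "integrable lborel f"
  shows "integrable lborel (\<lambda>x. f (x - z))"
  using integrable_lborel_affine[OF assms, of 1 "- z"] by simp

text \<open>A set and its translate have equal measure, so the symmetric difference has twice the
  measure of the part of \<open>U\<close> that the translate misses. A point of the open set
  \<open>U\<close> is eventually not missed, and dominated convergence applies.\<close>

lemma translation_open:
  fixes U :: "'a::euclidean_space set"
  assumes U: "open U" "emeasure lborel U < \<infinity>" and z: "z \<longlonglongrightarrow> 0"
  shows "(\<lambda>k. LINT x|lborel. \<bar>indicat_real U (x - z k) - indicator U x\<bar>) \<longlonglongrightarrow> 0"
proof -
  have [measurable]: "U \<in> sets borel" using U by auto
  have iU: "integrable lborel (indicat_real U)" using U by (simp add: integrable_indicator_iff)
  have iU': "integrable lborel (\<lambda>x. indicat_real U (x - c))" for c by (rule integrable_translate[OF iU])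
  have iUU: "integrable lborel (\<lambda>x. indicat_real U x * (1 - indicator U (x - c)))" for c
    by (rule Bochner_Integration.integrable_bound[OF iU]) (auto simp: indicator_def)
  have eq: "\<bar>indicat_real U (x - c) - indicator U x\<bar> = indicat_real U (x - c) - indicat_real U x + 2 * (indicator U x * (1 - indicator U (x - c)))" for x c
    by (auto simp: indicator_def)
  have "(LINT x|lborel. \<bar>indicat_real U (x - c) - indicator U x\<bar>) = 2 * (LINT x|lborel. indicator U x * (1 - indicator U (x - c)))" for c
    unfolding eq using iU iU' iUU integral_translate[of "indicat_real U" c] by simp
  moreover have "(\<lambda>k. LINT x|lborel. indicat_real U x * (1 - indicator U (x - z k))) \<longlonglongrightarrow> (LINT x|(lborel::'a measure). (0::real))"
  proof (rule integral_dominated_convergence[where w = "indicat_real U"])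
    show "AE x in lborel. (\<lambda>k. indicat_real U x * (1 - indicator U (x - z k))) \<longlonglongrightarrow> 0"
    proof (intro AE_I2)
      fix x
      show "(\<lambda>k. indicat_real U x * (1 - indicator U (x - z k))) \<longlonglongrightarrow> 0"
      proof (cases "x \<in> U")
        case True
        have "(\<lambda>k. x - z k) \<longlonglongrightarrow> x" using tendsto_diff[OF tendsto_const z, of x] by simp
        then have "eventually (\<lambda>k. x - z k \<in> U) sequentially" by (rule topological_tendstoD[OF _ U(1) True])
        then show ?thesis by (intro tendsto_eventually) (auto elim!: eventually_mono simp: indicator_def)
      qed auto
    qed
    show "AE x in lborel. norm (indicat_real U x * (1 - indicator U (x - z k))) \<le> indicator U x" for k
      by (auto simp: indicator_def)
  qed (use iU in auto)
  ultimately show ?thesis using tendsto_mult_left[of _ 0 sequentially 2] by simp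
qed

text \<open>Induction over integrable functions: outer regularity reduces indicators of Borel sets
  to open sets, and translation invariance of the measure carries the property through sums and
  limits.\<close>

lemma translation_continuous_L1:
  fixes f :: "'a::euclidean_space \<Rightarrow> 'b::{banach, second_countable_topology}"
  assumes f: "integrable lborel f" and z: "z \<longlonglongrightarrow> 0"
  shows "(\<lambda>k. LINT x|lborel. norm (f (x - z k) - f x)) \<longlonglongrightarrow> 0"
  using f
proof (induction f)
  case (base A c)
  then have [measurable]: "A \<in> sets borel" by simp
  have "(\<lambda>k. LINT x|lborel. \<bar>indicat_real A (x - z k) - indicator A x\<bar>) \<longlonglongrightarrow> 0"
  proof (rule tendsto_zero_approx)
    fix e :: real assume e: "e > 0"
    \<comment> \<open>The set \<open>U - A\<close> is charged twice, once in place and once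
      translated, hence the half.\<close>
    then obtain U where U: "open U" "A \<subseteq> U" "emeasure lborel (U - A) < ennreal (e / 2)"
      using outer_regular_lborel[of A "e/2"] by auto
    have [measurable]: "U \<in> sets borel" using U by auto
    have fU: "emeasure lborel U < \<infinity>"
    proof -
      have "emeasure lborel U = emeasure lborel (A \<union> (U - A))" using U by (simp add: Un_absorb1)
      also have "\<dots> \<le> emeasure lborel A + emeasure lborel (U - A)" by (rule emeasure_subadditive) auto
      also have "\<dots> < \<infinity>" using base(2) U(3) by (auto simp: ennreal_add_less_top intro: less_trans)
      finally show ?thesis .
    qed
    let ?D = "U - A"
    have iD: "integrable lborel (indicat_real ?D)" and mD: "measure lborel ?D \<le> e / 2"
    proof -
      have "emeasure lborel ?D < \<infinity>" using U(3) less_trans[OF _ ennreal_less_top] by fastforce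
      then show "integrable lborel (indicat_real ?D)" by (simp add: integrable_indicator_iff)
      show "measure lborel ?D \<le> e / 2" unfolding measure_def
        using U(3) e by (intro enn2real_leI) auto
    qed
    have iU: "integrable lborel (indicat_real U)" using fU by (simp add: integrable_indicator_iff)
    have iA: "integrable lborel (indicat_real A)" using base by (simp add: integrable_indicator_iff)
    let ?b = "\<lambda>k. LINT x|lborel. \<bar>indicat_real U (x - z k) - indicator U x\<bar>"
    have "(LINT x|lborel. \<bar>indicat_real A (x - c) - indicator A x\<bar>) \<le> e + (LINT x|lborel. \<bar>indicat_real U (x - c) - indicator U x\<bar>)" for c
    proof -
      have "(LINT x|lborel. \<bar>indicat_real A (x - c) - indicator A x\<bar>) \<le> (LINT x|lborel. indicat_real ?D (x - c) + indicator ?D x + \<bar>indicat_real U (x - c) - indicator U x\<bar>)"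
      proof (rule integral_mono)
        show "\<bar>indicat_real A (x - c) - indicator A x\<bar> \<le> indicat_real ?D (x - c) + indicator ?D x + \<bar>indicat_real U (x - c) - indicator U x\<bar>" for x
          using U(2) by (auto simp: indicator_def)
      qed (intro Bochner_Integration.integrable_add integrable_abs Bochner_Integration.integrable_diff
             iA integrable_translate[OF iA] iD integrable_translate[OF iD] iU integrable_translate[OF iU])+
      also have "\<dots> = (LINT x|lborel. indicat_real ?D (x - c)) + (LINT x|lborel. indicat_real ?D x) + (LINT x|lborel. \<bar>indicat_real U (x - c) - indicator U x\<bar>)"
        by (simp add: iD integrable_translate[OF iD] iU integrable_translate[OF iU])
      also have "\<dots> \<le> e + (LINT x|lborel. \<bar>indicat_real U (x - c) - indicator U x\<bar>)"
        using mD integral_translate[of "indicat_real ?D" c] by simp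
      finally show ?thesis .
    qed
    then show "\<exists>b. b \<longlonglongrightarrow> 0 \<and> (\<forall>k. norm (LINT x|lborel. \<bar>indicat_real A (x - z k) - indicator A x\<bar>) \<le> e + b k)"
      by (intro exI[of _ ?b]) (simp add: translation_open[OF U(1) fU z])
  qed
  from tendsto_mult_left[OF this, of "norm c"] show ?case
    by (simp add: mult.commute flip: scaleR_left_diff_distrib)
next
  case (add f g)
  show ?case
  proof (rule tendsto_sandwich[OF _ _ tendsto_const])
    show "(\<lambda>k. (LINT x|lborel. norm (f (x - z k) - f x)) + (LINT x|lborel. norm (g (x - z k) - g x))) \<longlonglongrightarrow> 0"
      using tendsto_add[OF add(3,4)] by simp
    have "(LINT x|lborel. norm (f (x - z k) + g (x - z k) - (f x + g x))) \<le> (LINT x|lborel. norm (f (x - z k) - f x)) + (LINT x|lborel. norm (g (x - z k) - g x))" for k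
    proof -
      have "(LINT x|lborel. norm (f (x - z k) + g (x - z k) - (f x + g x))) \<le> (LINT x|lborel. norm (f (x - z k) - f x) + norm (g (x - z k) - g x))"
        by (intro integral_mono norm_diff_triangle_ineq integrable_norm Bochner_Integration.integrable_add
              Bochner_Integration.integrable_diff add(1,2) integrable_translate[OF add(1)] integrable_translate[OF add(2)])
      also have "\<dots> = (LINT x|lborel. norm (f (x - z k) - f x)) + (LINT x|lborel. norm (g (x - z k) - g x))"
        by (intro Bochner_Integration.integral_add integrable_norm
              Bochner_Integration.integrable_diff add(1,2) integrable_translate[OF add(1)] integrable_translate[OF add(2)])
      finally show ?thesis .
    qed
    then show "\<forall>\<^sub>F k in sequentially. (LINT x|lborel. norm (f (x - z k) + g (x - z k) - (f x + g x))) \<le> (LINT x|lborel. norm (f (x - z k) - f x)) + (LINT x|lborel. norm (g (x - z k) - g x))"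
      by simp
  qed auto
next
  case (lim f s)
  note [measurable] = borel_measurable_integrable[OF lim.hyps(1)] borel_measurable_integrable[OF lim.hyps(4)]
  have "(\<lambda>i. LINT x|lborel. norm (s i x - f x)) \<longlonglongrightarrow> (LINT x|(lborel::'a measure). 0)"
  proof (rule integral_dominated_convergence)
    show "integrable lborel (\<lambda>x. 3 * norm (f x))" using lim.hyps(4) by auto
    show "AE x in lborel. (\<lambda>i. norm (s i x - f x)) \<longlonglongrightarrow> 0"
      using lim.hyps(2) by (auto intro!: tendsto_norm_zero LIM_zero)
    have "norm (s i x - f x) \<le> 3 * norm (f x)" for i x
      using lim.hyps(3)[of x i] norm_triangle_ineq4[of "s i x" "f x"] by simp
    then show "AE x in lborel. norm (norm (s i x - f x)) \<le> 3 * norm (f x)" for i by simp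
  qed auto
  then have conv: "(\<lambda>i. LINT x|lborel. norm (s i x - f x)) \<longlonglongrightarrow> 0" by simp
  show ?case
  proof (rule tendsto_zero_approx)
    fix e :: real assume "e > 0"
    with LIMSEQ_D[OF conv, of "e/2"] obtain i where i: "(LINT x|lborel. norm (s i x - f x)) \<le> e / 2"
      by (auto dest!: spec[of _ "_::nat"] simp: less_imp_le) (smt (verit, best) le_refl)
    have id: "integrable lborel (\<lambda>x. s i x - f x)" using lim.hyps(1,4) by auto
    have "(LINT x|lborel. norm (f (x - c) - f x)) \<le> e + (LINT x|lborel. norm (s i (x - c) - s i x))" for c
    proof -
      have int: "integrable lborel (\<lambda>x. norm (s i (x - c) - s i x))"
         "integrable lborel (\<lambda>x. norm (s i (x - c) - f (x - c)))" "integrable lborel (\<lambda>x. norm (f (x - c) - f x))"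
         "integrable lborel (\<lambda>x. norm (s i x - f x))"
        using lim.hyps(1)[of i] lim.hyps(4) integrable_translate[OF lim.hyps(1)[of i]] integrable_translate[OF lim.hyps(4)] by auto
      have "(LINT x|lborel. norm (f (x - c) - f x)) \<le>
        (LINT x|lborel. norm (s i (x - c) - f (x - c)) + norm (s i x - f x) + norm (s i (x - c) - s i x))"
        using int
      proof (intro integral_mono)
        show "norm (f (x - c) - f x) \<le> norm (s i (x - c) - f (x - c)) + norm (s i x - f x) + norm (s i (x - c) - s i x)" for x
          using norm_triangle_ineq4[of "s i x - f x" "s i (x - c) - f (x - c)"]
            norm_triangle_ineq[of "(s i x - f x) - (s i (x - c) - f (x - c))" "s i (x - c) - s i x"] by simp
      qed auto
      also have "\<dots> = (LINT x|lborel. norm (s i (x - c) - f (x - c))) + (LINT x|lborel. norm (s i x - f x)) + (LINT x|lborel. norm (s i (x - c) - s i x))"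
        using int by simp
      also have "(LINT x|lborel. norm (s i (x - c) - f (x - c))) = (LINT x|lborel. norm (s i x - f x))"
        by (rule integral_translate) simp
      finally show ?thesis using i by simp
    qed
    then show "\<exists>b. b \<longlonglongrightarrow> 0 \<and> (\<forall>k. norm (LINT x|lborel. norm (f (x - z k) - f x)) \<le> e + b k)"
      by (intro exI[of _ "\<lambda>k. LINT x|lborel. norm (s i (x - z k) - s i x)"]) (simp add: lim.IH)
  qed
qed

text \<open>
  Applied to real and imaginary parts, this deduces continuity of translations in \<open>L\<^sup>2\<close> from
  continuity in \<open>L\<^sup>1\<close>.
\<close>

lemma square_diff_le_signed_squares:
  fixes x y :: real
  shows "(x - y)\<^sup>2 \<le> 2 * \<bar>x * \<bar>x\<bar> - y * \<bar>y\<bar>\<bar>"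
proof -
  have main: "(a - b)\<^sup>2 \<le> 2 * \<bar>a * \<bar>a\<bar> - b * \<bar>b\<bar>\<bar>" if "b \<le> a" for a b :: real
  \<comment> \<open>On one side of 0 the difference of the signed squares is (a - b) (|a| + |b|),
    which dominates (a - b)^2. Across 0 it is a^2 + b^2, and only there is the factor 2
    spent.\<close>
  proof (cases "0 \<le> b \<or> a \<le> 0")
    case True
    have "(a - b) * (a - b) \<le> (a - b) * (\<bar>a\<bar> + \<bar>b\<bar>)"
      using that by (intro mult_left_mono) auto
    also have "\<dots> = \<bar>a * \<bar>a\<bar> - b * \<bar>b\<bar>\<bar>"
    proof -
      have "(a - b) * (\<bar>a\<bar> + \<bar>b\<bar>) = a * \<bar>a\<bar> - b * \<bar>b\<bar>"
        using True that by (auto simp: abs_if algebra_simps)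
      moreover have "0 \<le> (a - b) * (\<bar>a\<bar> + \<bar>b\<bar>)" using that by simp
      ultimately show ?thesis by simp
    qed
    finally show ?thesis unfolding power2_eq_square by (rule order_trans) simp
  next
    case False
    then have "\<bar>a * \<bar>a\<bar> - b * \<bar>b\<bar>\<bar> = a\<^sup>2 + b\<^sup>2"
      by (simp add: abs_if power2_eq_square) (smt (verit) mult_nonneg_nonneg zero_le_square)
    moreover have "(a - b)\<^sup>2 \<le> 2 * (a\<^sup>2 + b\<^sup>2)"
      using zero_le_power2[of "a + b"] by (simp add: power2_eq_square algebra_simps)
    ultimately show ?thesis by simp
  qed
  show ?thesis
    using main[of x y] main[of y x] by (cases "x \<le> y") (auto simp: power2_commute abs_minus_commute)
qed

lemma translation_continuous_L2:
  fixes h :: "'a::euclidean_space \<Rightarrow> complex"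
  assumes h: "square_integrable h" and z: "z \<longlonglongrightarrow> 0"
  shows "(\<lambda>k. l2norm (\<lambda>x. h (x - z k) - h x)) \<longlonglongrightarrow> 0"
proof -
  note [measurable] = square_integrableD(1)[OF h]
  \<comment> \<open>Signed squares are integrable because \<open>h\<close> is in L^2, and unlike
    plain squares they separate values of opposite sign.\<close>
  let ?r = "\<lambda>x. Re (h x) * \<bar>Re (h x)\<bar>" and ?i = "\<lambda>x. Im (h x) * \<bar>Im (h x)\<bar>"
  have sq: "\<bar>Re c\<bar> * \<bar>Re c\<bar> \<le> (cmod c)\<^sup>2" "\<bar>Im c\<bar> * \<bar>Im c\<bar> \<le> (cmod c)\<^sup>2" for c
    using mult_mono[OF abs_Re_le_cmod abs_Re_le_cmod, of c c] mult_mono[OF abs_Im_le_cmod abs_Im_le_cmod, of c c]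
    by (simp_all add: power2_eq_square)
  have r: "integrable lborel ?r"
    by (rule Bochner_Integration.integrable_bound[OF square_integrableD(2)[OF h]])
       (use sq in \<open>auto simp: abs_mult\<close>)
  have i: "integrable lborel ?i"
    by (rule Bochner_Integration.integrable_bound[OF square_integrableD(2)[OF h]])
       (use sq in \<open>auto simp: abs_mult\<close>)
  have le: "(l2norm (\<lambda>x. h (x - c) - h x))\<^sup>2 \<le> 2 * (LINT x|lborel. norm (?r (x - c) - ?r x)) + 2 * (LINT x|lborel. norm (?i (x - c) - ?i x))" for c
  proof -
    have int: "integrable lborel (\<lambda>x. norm (?r (x - c) - ?r x))" "integrable lborel (\<lambda>x. norm (?i (x - c) - ?i x))"
      using r i integrable_translate[OF r] integrable_translate[OF i] by auto
    have "(l2norm (\<lambda>x. h (x - c) - h x))\<^sup>2 \<le> (LINT x|lborel. 2 * norm (?r (x - c) - ?r x) + 2 * norm (?i (x - c) - ?i x))"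
      unfolding l2norm_power2
    proof (rule integral_mono')
      show "(norm (h (x - c) - h x))\<^sup>2 \<le> 2 * norm (?r (x - c) - ?r x) + 2 * norm (?i (x - c) - ?i x)" for x
        using square_diff_le_signed_squares[of "Re (h (x - c))" "Re (h x)"] square_diff_le_signed_squares[of "Im (h (x - c))" "Im (h x)"]
        by (simp add: cmod_power2)
    qed (use int in auto)
    also have "\<dots> = 2 * (LINT x|lborel. norm (?r (x - c) - ?r x)) + 2 * (LINT x|lborel. norm (?i (x - c) - ?i x))"
      using int by simp
    finally show ?thesis .
  qed
  have "(\<lambda>k. (l2norm (\<lambda>x. h (x - z k) - h x))\<^sup>2) \<longlonglongrightarrow> 0"
  proof (rule tendsto_sandwich[OF _ _ tendsto_const])
    show "(\<lambda>k. 2 * (LINT x|lborel. norm (?r (x - z k) - ?r x)) + 2 * (LINT x|lborel. norm (?i (x - z k) - ?i x))) \<longlonglongrightarrow> 0"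
      using tendsto_add[OF tendsto_mult_left[OF translation_continuous_L1[OF r z], of 2] tendsto_mult_left[OF translation_continuous_L1[OF i z], of 2]]
      by simp
  qed (use le in auto)
  then show ?thesis using tendsto_real_sqrt[of _ 0] by fastforce
qed

section \<open>Plancherel's theorem\<close>

lemma cnj_measurable [measurable]: "cnj \<in> borel_measurable borel"
  by (intro borel_measurable_continuous_onI continuous_intros)

text \<open>The kernel is that of \<open>fourier_truncated\<close>, without a normalising factor;
  this is the source of every power of 2 pi below.\<close>

definition fourier :: "('a::euclidean_space \<Rightarrow> complex) \<Rightarrow> 'a \<Rightarrow> complex" where
  "fourier h \<xi> = (LINT x|lborel. cis (- (x \<bullet> \<xi>)) * h x)"

lemma fourier_measurable [measurable]:
  assumes [measurable]: "h \<in> borel_measurable borel"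
  shows "fourier h \<in> borel_measurable borel"
  unfolding fourier_def[abs_def] by measurable

lemma fourier_integrable:
  assumes "integrable lborel h"
  shows "integrable lborel (\<lambda>x. cis (- (x \<bullet> \<xi>)) * h x)"
  by (rule Bochner_Integration.integrable_bound[OF assms])
     (use borel_measurable_integrable[OF assms] in \<open>auto simp: norm_mult\<close>)

text \<open>The convolution of \<open>h\<close> with its reflected conjugate, x |-> cnj (h (-
  x)).\<close>

definition autocorrelation :: "('a::euclidean_space \<Rightarrow> complex) \<Rightarrow> 'a \<Rightarrow> complex" where
  "autocorrelation h z = (LINT x|lborel. h x * cnj (h (x - z)))"

lemma autocorrelation_measurable [measurable]:
  assumes [measurable]: "h \<in> borel_measurable borel"
  shows "autocorrelation h \<in> borel_measurable borel"
  unfolding autocorrelation_def[abs_def] by measurable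

lemma square_integrable_translate_cnj:
  fixes h :: "'a::euclidean_space \<Rightarrow> complex"
  assumes "square_integrable h"
  shows "square_integrable (\<lambda>x. cnj (h (x - z)))" "l2norm (\<lambda>x. cnj (h (x - z))) = l2norm h"
proof -
  note h = square_integrableD[OF assms]
  note [measurable] = h(1)
  show "square_integrable (\<lambda>x. cnj (h (x - z)))"
    using integrable_translate[OF h(2)] by (simp add: square_integrable_def)
  show "l2norm (\<lambda>x. cnj (h (x - z))) = l2norm h"
    using integral_translate[of "\<lambda>x. (cmod (h x))\<^sup>2" z] by (simp add: l2norm_def)
qed

lemma autocorrelation_bounded:
  assumes "square_integrable h"
  shows "cmod (autocorrelation h z) \<le> (l2norm h)\<^sup>2"
proof -
  note i = square_integrable_mult[OF assms square_integrable_translate_cnj(1)[OF assms, of z]]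
  have "cmod (autocorrelation h z) \<le> (LINT x|lborel. cmod (h x * cnj (h (x - z))))"
    unfolding autocorrelation_def by (rule integral_norm_bound)
  also have "\<dots> = (LINT x|lborel. cmod (h x) * cmod (cnj (h (x - z))))" by (simp add: norm_mult)
  also have "\<dots> \<le> (l2norm h)\<^sup>2"
    using i(2) square_integrable_translate_cnj(2)[OF assms] by (simp add: power2_eq_square)
  finally show ?thesis .
qed

lemma autocorrelation_0: "autocorrelation h 0 = complex_of_real ((l2norm h)\<^sup>2)"
proof -
  have "h x * cnj (h x) = complex_of_real ((cmod (h x))\<^sup>2)" for x
    by (rule complex_norm_square[symmetric])
  then show ?thesis
    unfolding autocorrelation_def l2norm_power2 by (simp add: integral_complex_of_real del: of_real_power)
qed

text \<open>By Cauchy-Schwarz the increment is at most the norm of \<open>h\<close> times the L^2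
  distance between \<open>h\<close> and its translate.\<close>

lemma autocorrelation_continuous_0:
  assumes h: "square_integrable h" and z: "z \<longlonglongrightarrow> 0"
  shows "(\<lambda>k. autocorrelation h (z k)) \<longlonglongrightarrow> complex_of_real ((l2norm h)\<^sup>2)"
proof (rule LIM_zero_cancel, rule Lim_null_comparison)
  have "cmod (autocorrelation h c - autocorrelation h 0) \<le> l2norm h * l2norm (\<lambda>x. h (x - c) - h x)" for c
  proof -
    note hc = square_integrable_translate_cnj[OF h, of c]
    note h0 = square_integrable_translate_cnj[OF h, of 0]
    note d = square_integrable_diff[OF hc(1) h0(1)]
    have "autocorrelation h c - autocorrelation h 0 = (LINT x|lborel. h x * (cnj (h (x - c)) - cnj (h (x - 0))))"
      unfolding autocorrelation_def using square_integrable_mult(1)[OF h hc(1)] square_integrable_mult(1)[OF h h0(1)]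
      by (simp add: right_diff_distrib)
    also have "cmod \<dots> \<le> (LINT x|lborel. cmod (h x * (cnj (h (x - c)) - cnj (h (x - 0)))))"
      by (rule integral_norm_bound)
    also have "\<dots> \<le> l2norm h * l2norm (\<lambda>x. cnj (h (x - c)) - cnj (h (x - 0)))"
      using square_integrable_mult(2)[OF h d] by (simp add: norm_mult)
    also have "l2norm (\<lambda>x. cnj (h (x - c)) - cnj (h (x - 0))) = l2norm (\<lambda>x. h (x - c) - h x)"
      by (simp add: l2norm_def flip: complex_cnj_diff)
    finally show ?thesis .
  qed
  then show "\<forall>\<^sub>F k in sequentially. cmod (autocorrelation h (z k) - complex_of_real ((l2norm h)\<^sup>2)) \<le> l2norm h * l2norm (\<lambda>x. h (x - z k) - h x)"
    by (simp add: autocorrelation_0)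
  show "(\<lambda>k. l2norm h * l2norm (\<lambda>x. h (x - z k) - h x)) \<longlonglongrightarrow> 0"
    using tendsto_mult_left[OF translation_continuous_L2[OF h z], of "l2norm h"] by simp
qed

text \<open>The substitution z = x - y under Fubini splits the double integral into the transform of
  \<open>h\<close> times its conjugate. Integrability of \<open>h\<close> makes the double integral
  absolutely convergent.\<close>

lemma autocorrelation_fourier:
  assumes h: "integrable lborel h"
  shows "integrable lborel (autocorrelation h)"
    and "fourier (autocorrelation h) \<xi> = complex_of_real ((cmod (fourier h \<xi>))\<^sup>2)"
proof -
  note [measurable] = borel_measurable_integrable[OF h]
  let ?F = "\<lambda>z x. cis (- (z \<bullet> \<xi>)) * (h x * cnj (h (x - z)))"
  have sub: "(LINT z|lborel. f (x - z)) = (LINT z|lborel. f z)"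
    if "f \<in> borel_measurable borel" for f :: "'a \<Rightarrow> 'b::{banach, second_countable_topology}" and x
    using integral_lborel_affine[OF that, of "-1" x] by simp
  have sub_int: "integrable lborel (\<lambda>z. h (x - z))" for x
    using integrable_lborel_affine[OF h, of "-1" x] by simp
  have int: "integrable (lborel \<Otimes>\<^sub>M lborel) (\<lambda>(x, z). h x * cnj (h (x - z)))"
  proof (rule lborel_pair.Fubini_integrable)
    have "(LINT z|lborel. cmod (h x * cnj (h (x - z)))) = cmod (h x) * (LINT z|lborel. cmod (h z))" for x
      using sub[of "\<lambda>z. cmod (h z)" x] by (simp add: norm_mult)
    then show "integrable lborel (\<lambda>x. LINT y|lborel. norm (case (x, y) of (x, z) \<Rightarrow> h x * cnj (h (x - z))))"
      using h by simp
    show "AE x in lborel. integrable lborel (\<lambda>y. case (x, y) of (x, z) \<Rightarrow> h x * cnj (h (x - z)))"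
      using sub_int by auto
  qed measurable
  from lborel_pair.integrable_snd[OF int] show "integrable lborel (autocorrelation h)"
    by (simp add: autocorrelation_def[abs_def])
  have int2: "integrable (lborel \<Otimes>\<^sub>M lborel) (\<lambda>(x, z). ?F z x)"
    by (rule Bochner_Integration.integrable_bound[OF int]) (auto simp: norm_mult)
  have "fourier (autocorrelation h) \<xi> = (LINT z|lborel. (LINT x|lborel. ?F z x))"
    unfolding fourier_def autocorrelation_def by simp
  also have "\<dots> = (LINT x|lborel. (LINT z|lborel. ?F z x))"
    by (rule lborel_pair.Fubini_integral[OF int2])
  also have "\<dots> = (LINT x|lborel. cis (- (x \<bullet> \<xi>)) * h x * cnj (fourier h \<xi>))"
  proof (rule Bochner_Integration.integral_cong[OF refl])
    fix x
    let ?g = "\<lambda>y. cis (- (x \<bullet> \<xi>)) * h x * cnj (cis (- (y \<bullet> \<xi>)) * h y)"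
    have F_eq: "?F z x = ?g (x - z)" for z
    proof -
      have "cis (- (z \<bullet> \<xi>)) = cis (- (x \<bullet> \<xi>)) * cnj (cis (- ((x - z) \<bullet> \<xi>)))"
        by (simp add: cis_cnj cis_mult inner_diff_left)
      then show ?thesis by simp
    qed
    have "(LINT z|lborel. ?F z x) = (LINT z|lborel. ?g (x - z))"
      by (rule Bochner_Integration.integral_cong[OF refl F_eq])
    also have "\<dots> = (LINT z|lborel. ?g z)" by (rule sub) measurable
    also have "\<dots> = cis (- (x \<bullet> \<xi>)) * h x * cnj (fourier h \<xi>)"
      by (simp add: fourier_def flip: complex_cnj_mult integral_cnj)
    finally show "(LINT z|lborel. ?F z x) = cis (- (x \<bullet> \<xi>)) * h x * cnj (fourier h \<xi>)" .
  qed
  also have "\<dots> = fourier h \<xi> * cnj (fourier h \<xi>)"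
    by (simp add: fourier_def)
  finally show "fourier (autocorrelation h) \<xi> = complex_of_real ((cmod (fourier h \<xi>))\<^sup>2)"
    by (simp only: complex_norm_square)
qed

text \<open>
  The right-hand side tends to a multiple of \<open>A 0\<close> as \<open>d\<close> tends to \<open>0\<close>; with \<open>A\<close> the autocorrelation of \<open>h\<close>
  this is Plancherel's identity for \<open>h\<close>.
\<close>

lemma fourier_gauss_scaled:
  fixes A :: "'a::euclidean_space \<Rightarrow> complex"
  assumes A: "integrable lborel A" and d: "d > 0"
  shows "(LINT \<xi>|lborel. gauss (d *\<^sub>R \<xi>) * fourier A \<xi>) = sqrt (2 * pi) ^ DIM('a) * (LINT y|lborel. gauss y * A (d *\<^sub>R y))"
proof -
  note [measurable] = borel_measurable_integrable[OF A]
  have Ad: "integrable lborel (\<lambda>y. A (d *\<^sub>R y))" 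
    using integrable_lborel_affine[OF A, of d 0] d by simp
  \<comment> \<open>The Gaussian supplies the integrability in the frequency variable that the
    transform of \<open>A\<close> may lack; Fubini rests on it.\<close>
  have int: "integrable (lborel \<Otimes>\<^sub>M lborel) (\<lambda>(y, \<eta>). (complex_of_real (gauss \<eta>) * cis (- (y \<bullet> \<eta>))) * A (d *\<^sub>R y))"
  proof -
    have "integrable (lborel \<Otimes>\<^sub>M lborel) (\<lambda>(y, \<eta>::'a). complex_of_real (gauss \<eta>) * A (d *\<^sub>R y))"
    proof (rule lborel_pair.Fubini_integrable)
      have "(LINT \<eta>|lborel. cmod (complex_of_real (gauss (\<eta>::'a)) * A (d *\<^sub>R y))) = (LINT \<eta>|lborel. gauss (\<eta>::'a)) * cmod (A (d *\<^sub>R y))" for y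
        by (simp add: norm_mult abs_of_pos gauss_bounds(1))
      then show "integrable lborel (\<lambda>x. LINT y|lborel. norm (case (x, y) of (y, \<eta>::'a) \<Rightarrow> complex_of_real (gauss \<eta>) * A (d *\<^sub>R y)))"
        using Ad by simp
      show "AE x in lborel. integrable lborel (\<lambda>y. case (x, y) of (y, \<eta>::'a) \<Rightarrow> complex_of_real (gauss \<eta>) * A (d *\<^sub>R y))"
        using gauss_integrable[where 'a='a, THEN complex_of_real_integrable_eq[THEN iffD2]]
        by (auto intro: integrable_mult_left)
    qed measurable
    then show ?thesis
      by (rule Bochner_Integration.integrable_bound) (auto simp: norm_mult)
  qed
  \<comment> \<open>Dividing the frequency by \<open>d\<close> is undone by scaling space by
    \<open>d\<close>. The two Jacobians cancel, so that \<open>d\<close> survives only inside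
    \<open>A\<close>.\<close>
  have fA: "fourier A ((1 / d) *\<^sub>R \<eta>) = d ^ DIM('a) *\<^sub>R (LINT y|lborel. cis (- (y \<bullet> \<eta>)) * A (d *\<^sub>R y))" for \<eta>
    unfolding fourier_def by (subst integral_lborel_affine[of _ d 0]) (use d in auto)
  have "(LINT \<xi>|lborel. gauss (d *\<^sub>R \<xi>) * fourier A \<xi>) = (1 / d) ^ DIM('a) *\<^sub>R (LINT \<eta>|lborel. gauss \<eta> * fourier A ((1 / d) *\<^sub>R \<eta>))"
    by (subst integral_lborel_affine[of _ "1 / d" 0]) (use d in auto)
  also have "\<dots> = (1 / d) ^ DIM('a) *\<^sub>R (LINT \<eta>|lborel. gauss \<eta> * d ^ DIM('a) *\<^sub>R (LINT y|lborel. cis (- (y \<bullet> \<eta>)) * A (d *\<^sub>R y)))"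
    by (simp only: fA)
  also have "\<dots> =
      (LINT \<eta>|lborel. (LINT y|lborel. (gauss \<eta> * cis (- (y \<bullet> \<eta>))) * A (d *\<^sub>R y)))"
    using d by (simp add: power_divide mult.assoc)
  also have "\<dots> = (LINT y|lborel. (LINT \<eta>|lborel. (gauss \<eta> * cis (- (y \<bullet> \<eta>))) * A (d *\<^sub>R y)))"
    by (rule lborel_pair.Fubini_integral[OF int])
  also have "\<dots> = (LINT y|lborel. (sqrt (2 * pi) ^ DIM('a) * gauss y) * A (d *\<^sub>R y))"
  proof (rule Bochner_Integration.integral_cong[OF refl])
    fix y
    show "(LINT \<eta>|lborel. (gauss \<eta> * cis (- (y \<bullet> \<eta>))) * A (d *\<^sub>R y)) = (sqrt (2 * pi) ^ DIM('a) * gauss y) * A (d *\<^sub>R y)"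
      using gauss_fourier[of y] by (simp add: mult.commute inner_commute)
  qed
  finally show ?thesis by (simp add: mult.assoc)
qed

text \<open>As the damping \<open>d k\<close> decreases to 0, the Gaussian means of |fourier h|^2
  increase to its integral, while on the other side dominated convergence gives the value of the
  autocorrelation at 0. Monotone convergence yields integrability of |fourier h|^2 along with the
  identity.\<close>

theorem plancherel:
  fixes h :: "'a::euclidean_space \<Rightarrow> complex"
  assumes h: "integrable lborel h" and h2: "square_integrable h"
  shows "square_integrable (fourier h)"
    and "(l2norm (fourier h))\<^sup>2 = (2 * pi) ^ DIM('a) * (l2norm h)\<^sup>2"
proof -
  note [measurable] = borel_measurable_integrable[OF h]
  define d where "d k = 1 / real (Suc k)" for k
  have d: "d k > 0" for k by (simp add: d_def)
  have d0: "d \<longlonglongrightarrow> 0" unfolding d_def by (rule LIMSEQ_Suc[OF lim_1_over_n])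
  have dm: "d (Suc k) \<le> d k" for k by (simp add: d_def field_simps)
  let ?C = "sqrt (2 * pi) ^ DIM('a)"
  let ?f = "\<lambda>k \<xi>. gauss (d k *\<^sub>R \<xi>) * (cmod (fourier h \<xi>))\<^sup>2"
  have bnd: "cmod (fourier h \<xi>) \<le> (LINT x|lborel. cmod (h x))" for \<xi>
    unfolding fourier_def using integral_norm_bound[of lborel "\<lambda>x. cis (- (x \<bullet> \<xi>)) * h x"]
    by (simp add: norm_mult)
  have int: "integrable lborel (?f k)" for k
  proof (rule Bochner_Integration.integrable_bound)
    have "integrable lborel (\<lambda>\<xi>::'a. gauss (d k *\<^sub>R \<xi>))"
      using integrable_lborel_affine[OF gauss_integrable, of "d k" 0] d[of k] by simp
    then show "integrable lborel (\<lambda>\<xi>::'a. (LINT x|lborel. cmod (h x))\<^sup>2 * gauss (d k *\<^sub>R \<xi>))" by simp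
    show "AE \<xi> in lborel. norm (?f k \<xi>) \<le> norm ((LINT x|lborel. cmod (h x))\<^sup>2 * gauss (d k *\<^sub>R \<xi>))"
      using bnd gauss_bounds(1) by (auto simp: abs_mult mult.commute less_imp_le intro!: mult_mono power_mono)
  qed measurable
  have "complex_of_real (LINT \<xi>|lborel. ?f k \<xi>) = ?C * (LINT y|lborel. gauss y * autocorrelation h (d k *\<^sub>R y))" for k
    using fourier_gauss_scaled[OF autocorrelation_fourier(1)[OF h] d[of k]]
    by (simp add: autocorrelation_fourier(2)[OF h] flip: of_real_mult of_real_power integral_complex_of_real)
  moreover have "(\<lambda>k. LINT y|lborel. gauss y * autocorrelation h (d k *\<^sub>R y)) \<longlonglongrightarrow> (LINT y|lborel. gauss (y::'a) * complex_of_real ((l2norm h)\<^sup>2))"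
  proof (rule integral_dominated_convergence[where w = "\<lambda>y. gauss y * (l2norm h)\<^sup>2"])
    show "integrable lborel (\<lambda>y::'a. gauss y * (l2norm h)\<^sup>2)" using gauss_integrable by auto
    show "AE y in lborel. (\<lambda>k. gauss y * autocorrelation h (d k *\<^sub>R y)) \<longlonglongrightarrow> gauss y * complex_of_real ((l2norm h)\<^sup>2)"
    proof (intro AE_I2 tendsto_mult_left autocorrelation_continuous_0 h2)
      fix y :: 'a show "(\<lambda>k. d k *\<^sub>R y) \<longlonglongrightarrow> 0" using tendsto_scaleR[OF d0 tendsto_const, of y] by simp
    qed
    show "AE y in lborel. cmod (gauss y * autocorrelation h (d k *\<^sub>R y)) \<le> gauss y * (l2norm h)\<^sup>2" for k
      by (simp add: norm_mult abs_of_pos gauss_bounds(1) autocorrelation_bounded[OF h2])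
  qed measurable
  then have "(\<lambda>k. ?C * (LINT y|lborel. gauss y * autocorrelation h (d k *\<^sub>R y))) \<longlonglongrightarrow> ?C * (LINT y|lborel. gauss (y::'a) * complex_of_real ((l2norm h)\<^sup>2))"
    by (rule tendsto_mult_left)
  moreover have "(LINT y|lborel. gauss (y::'a) * complex_of_real ((l2norm h)\<^sup>2)) = complex_of_real (?C * (l2norm h)\<^sup>2)"
    by (simp add: gauss_integral integral_complex_of_real flip: of_real_mult of_real_power)
  ultimately have "(\<lambda>k. complex_of_real (LINT \<xi>|lborel. ?f k \<xi>)) \<longlonglongrightarrow> complex_of_real (?C * (?C * (l2norm h)\<^sup>2))"
    by (simp add: gauss_integral)
  then have lim: "(\<lambda>k. LINT \<xi>|lborel. ?f k \<xi>) \<longlonglongrightarrow> ?C * (?C * (l2norm h)\<^sup>2)"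
    by (simp only: tendsto_of_real_iff)
  \<comment> \<open>One factor comes from the transform of the Gaussian, the other from its total
    mass.\<close>
  have C: "?C * ?C = (2 * pi) ^ DIM('a)"
    by (subst power_mult_distrib[symmetric]) simp
  have mono: "mono (\<lambda>k. ?f k \<xi>)" for \<xi>
  proof (unfold mono_iff_le_Suc, intro allI)
    fix k
    have "d (Suc k) * norm \<xi> \<le> d k * norm \<xi>" by (rule mult_right_mono[OF dm]) simp
    then have "gauss (d k *\<^sub>R \<xi>) \<le> gauss (d (Suc k) *\<^sub>R \<xi>)"
      using d[of k] d[of "Suc k"] by (simp add: gauss_def power_mono)
    then show "?f k \<xi> \<le> ?f (Suc k) \<xi>" by (rule mult_right_mono) simp
  qed
  have "(\<lambda>k. ?f k \<xi>) \<longlonglongrightarrow> (cmod (fourier h \<xi>))\<^sup>2" for \<xi>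
  proof -
    have "(\<lambda>k. gauss (d k *\<^sub>R \<xi>)) \<longlonglongrightarrow> gauss (0 *\<^sub>R \<xi>)"
      unfolding gauss_def by (intro tendsto_intros d0)  simp
    then show ?thesis using tendsto_mult_right[of _ 1] by (fastforce simp: gauss_def)
  qed
  then have "integrable lborel (\<lambda>\<xi>. (cmod (fourier h \<xi>))\<^sup>2)" "(LINT \<xi>|lborel. (cmod (fourier h \<xi>))\<^sup>2) = ?C * (?C * (l2norm h)\<^sup>2)"
    using integral_monotone_convergence_nonneg[OF int _ _ _ lim, of "\<lambda>\<xi>. (cmod (fourier h \<xi>))\<^sup>2"] mono
    by (auto simp: less_imp_le[OF gauss_bounds(1)])
  then show "square_integrable (fourier h)" "(l2norm (fourier h))\<^sup>2 = (2 * pi) ^ DIM('a) * (l2norm h)\<^sup>2"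
    by (auto simp: square_integrable_def l2norm_power2 C simp flip: mult.assoc)
qed

section \<open>The Fourier transform on square-integrable functions\<close>

lemma l2norm_cong_AE:
  fixes f g :: "'a::euclidean_space \<Rightarrow> complex"
  assumes "f \<in> borel_measurable borel" "g \<in> borel_measurable borel" "AE x in lborel. f x = g x"
  shows "l2norm f = l2norm g"
  unfolding l2norm_def using assms by (intro arg_cong[where f = sqrt] integral_cong_AE) auto

lemma l2norm_diff_le:
  fixes f g :: "'a::euclidean_space \<Rightarrow> complex"
  assumes "square_integrable f" "square_integrable g"
  shows "\<bar>l2norm f - l2norm g\<bar> \<le> l2norm (\<lambda>x. f x - g x)"
  using l2norm_triangle[OF square_integrable_diff[OF assms] assms(2)]
    l2norm_triangle[OF square_integrable_diff[OF assms(2,1)] assms(1)] l2norm_minus_commute[of f g]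
  by simp

text \<open>The Riesz-Fischer argument: a rapidly converging subsequence converges almost
  everywhere, and Fatou's lemma shows that its pointwise limit is also the limit in norm of the
  whole sequence.\<close>

lemma L2_complete:
  fixes g :: "nat \<Rightarrow> 'a::euclidean_space \<Rightarrow> complex"
  assumes g: "\<And>k. square_integrable (g k)"
    and Cauchy: "\<And>e. e > 0 \<Longrightarrow> \<exists>N. \<forall>m\<ge>N. \<forall>n\<ge>N. l2norm (\<lambda>x. g m x - g n x) \<le> e"
  shows "\<exists>G. square_integrable G \<and> (\<lambda>k. l2norm (\<lambda>x. G x - g k x)) \<longlonglongrightarrow> 0"
proof -
  note [measurable] = square_integrableD(1)[OF g]
  have "\<forall>k. \<exists>N. \<forall>m\<ge>N. \<forall>n\<ge>N. l2norm (\<lambda>x. g m x - g n x) \<le> (1/2) ^ k"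
    using Cauchy by simp
  then obtain N where N: "\<And>k m n. m \<ge> N k \<Longrightarrow> n \<ge> N k \<Longrightarrow> l2norm (\<lambda>x. g m x - g n x) \<le> (1/2) ^ k"
    by metis
  \<comment> \<open>The sum of all earlier thresholds makes \<open>r\<close> monotone while keeping
    it above \<open>N k\<close>; the summand \<open>k\<close> makes it unbounded.\<close>
  define r where "r k = k + (\<Sum>j\<le>k. N j)" for k
  have r: "N k \<le> r k" "k \<le> r k" "r k \<le> r (Suc k)" for k
    using member_le_sum[of k "{..k}" N] by (auto simp: r_def)
  define d where "d k x = g (r (Suc k)) x - g (r k) x" for k x
  have d: "square_integrable (d k)" "l2norm (d k) \<le> (1/2) ^ k" for k
    unfolding d_def using N[of k "r (Suc k)" "r k"] r[of k] square_integrable_diff[OF g g] by auto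
  note [measurable] = square_integrableD(1)[OF d(1)]
  \<comment> \<open>The squared norms are at most 4^(-k), so the weight 2^k still leaves a
    convergent series. Where the weighted sum is finite, the increments decay like 2^(-k/2) and are
    summable; the unweighted squares would not give this.\<close>
  have "(\<integral>\<^sup>+ x. (\<Sum>k. ennreal (2 ^ k * (cmod (d k x))\<^sup>2)) \<partial>lborel) = (\<Sum>k. \<integral>\<^sup>+ x. ennreal (2 ^ k * (cmod (d k x))\<^sup>2) \<partial>lborel)"
    by (rule nn_integral_suminf) measurable
  also have "\<dots> \<le> (\<Sum>k. ennreal ((1/2) ^ k))"
  proof (intro suminf_le summableI)
    fix k
    have "(\<integral>\<^sup>+ x. ennreal (2 ^ k * (cmod (d k x))\<^sup>2) \<partial>lborel) = ennreal (2 ^ k) * ennreal ((l2norm (d k))\<^sup>2)"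
      by (subst nn_integral_power2_norm[OF d(1), symmetric], subst nn_integral_cmult[symmetric])
         (auto simp: ennreal_mult)
    also have "\<dots> \<le> ennreal ((1/2) ^ k)"
    proof -
      have "2 ^ k * (l2norm (d k))\<^sup>2 \<le> 2 ^ k * ((1/2) ^ k)\<^sup>2"
        using d(2) by (intro mult_left_mono power_mono) auto
      also have "\<dots> = (1/2 :: real) ^ k"
        by (simp add: power2_eq_square power_divide)
      finally show ?thesis by (simp flip: ennreal_mult)
    qed
    finally show "(\<integral>\<^sup>+ x. ennreal (2 ^ k * (cmod (d k x))\<^sup>2) \<partial>lborel) \<le> ennreal ((1/2) ^ k)" .
  qed
  also have "\<dots> < \<infinity>"
    by (subst suminf_ennreal2) (auto intro!: summable_geometric)
  finally have fin: "AE x in lborel. (\<Sum>k. ennreal (2 ^ k * (cmod (d k x))\<^sup>2)) \<noteq> \<infinity>"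
    by (intro nn_integral_noteq_infinite) auto
  have conv: "AE x in lborel. convergent (\<lambda>k. g (r k) x)"
    using fin
  proof eventually_elim
    case (elim x)
    define S where "S = enn2real (\<Sum>k. ennreal (2 ^ k * (cmod (d k x))\<^sup>2))"
    have S0: "S \<ge> 0" by (simp add: S_def)
    have "cmod (d k x) \<le> sqrt S * (1 / sqrt 2) ^ k" for k
    proof -
      have "ennreal (2 ^ k * (cmod (d k x))\<^sup>2) \<le> (\<Sum>k. ennreal (2 ^ k * (cmod (d k x))\<^sup>2))"
        using sum_le_suminf[OF summableI, of "{k}" "\<lambda>k. ennreal (2 ^ k * (cmod (d k x))\<^sup>2)"]
        by (simp only: sum.insert finite.intros sum.empty empty_iff not_False_eq_True add_0_right zero_le)
      also have "\<dots> = ennreal S" using elim by (simp only: S_def ennreal_enn2real_if infinity_ennreal_def if_False)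
      finally have "2 ^ k * (cmod (d k x))\<^sup>2 \<le> S"
        using S0 by (simp only: ennreal_le_iff)
      then have "sqrt (2 ^ k * (cmod (d k x))\<^sup>2) \<le> sqrt S" by simp
      then show ?thesis
        by (simp add: real_sqrt_mult real_sqrt_power field_simps)
    qed
    moreover have "summable (\<lambda>k. sqrt S * (1 / sqrt 2) ^ k)"
      by (intro summable_mult summable_geometric) auto
    ultimately have "summable (\<lambda>k. d k x)"
      by (intro summable_comparison_test'[of "\<lambda>k. sqrt S * (1 / sqrt 2) ^ k" 0 "\<lambda>k. d k x"]) auto
    then have "(\<lambda>n. g (r 0) x + (\<Sum>k<n. d k x)) \<longlonglongrightarrow> g (r 0) x + suminf (\<lambda>k. d k x)"
      by (intro tendsto_add tendsto_const summable_LIMSEQ)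
    moreover have "g (r 0) x + (\<Sum>k<n. d k x) = g (r n) x" for n
      unfolding d_def by (subst sum_lessThan_telescope) simp
    ultimately show ?case by (auto simp: convergent_def)
  qed
  define G where "G x = lim (\<lambda>k. g (r k) x)" for x
  have G_meas [measurable]: "G \<in> borel_measurable borel"
    unfolding G_def[abs_def] by (rule borel_measurable_lim_metric) measurable
  \<comment> \<open>Fatou's lemma along the subsequence: a bound on the distances from
    \<open>g m\<close> to all later terms passes to the limit \<open>G\<close>.\<close>
  have G_le: "(\<integral>\<^sup>+ x. ennreal ((cmod (G x - g m x))\<^sup>2) \<partial>lborel) \<le> ennreal (e\<^sup>2)"
    if "\<And>k. k \<ge> m \<Longrightarrow> l2norm (\<lambda>x. g k x - g m x) \<le> e" for m e
  proof -
    have "(\<integral>\<^sup>+ x. ennreal ((cmod (G x - g m x))\<^sup>2) \<partial>lborel) = (\<integral>\<^sup>+ x. liminf (\<lambda>k. ennreal ((cmod (g (r k) x - g m x))\<^sup>2)) \<partial>lborel)"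
    proof (rule nn_integral_cong_AE, use conv in eventually_elim)
      case (elim x)
      then have "(\<lambda>k. g (r k) x) \<longlonglongrightarrow> G x" by (simp add: G_def convergent_LIMSEQ_iff)
      then have "(\<lambda>k. ennreal ((cmod (g (r k) x - g m x))\<^sup>2)) \<longlonglongrightarrow> ennreal ((cmod (G x - g m x))\<^sup>2)"
        by (intro tendsto_ennrealI tendsto_intros)
      from lim_imp_Liminf[OF _ this] show ?case by simp
    qed
    also have "\<dots> \<le> liminf (\<lambda>k. \<integral>\<^sup>+ x. ennreal ((cmod (g (r k) x - g m x))\<^sup>2) \<partial>lborel)"
      by (rule nn_integral_liminf) measurable
    also have "\<dots> \<le> liminf (\<lambda>k::nat. ennreal (e\<^sup>2))"
    proof (rule Liminf_mono, unfold eventually_sequentially, intro exI allI impI)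
      fix k assume "m \<le> k"
      then have "l2norm (\<lambda>x. g (r k) x - g m x) \<le> e" using that[of "r k"] r(2)[of k] by simp
      then show "(\<integral>\<^sup>+ x. ennreal ((cmod (g (r k) x - g m x))\<^sup>2) \<partial>lborel) \<le> ennreal (e\<^sup>2)"
        using nn_integral_power2_norm[OF square_integrable_diff[OF g g], of "r k" m]
        by (auto intro!: ennreal_leI power_mono)
    qed
    also have "\<dots> = ennreal (e\<^sup>2)" by (simp add: Liminf_const)
    finally show ?thesis .
  qed
  have sqd: "square_integrable (\<lambda>x. G x - g m x)" if "m \<ge> N 0" for m
  proof -
    have "(\<integral>\<^sup>+ x. ennreal ((cmod (G x - g m x))\<^sup>2) \<partial>lborel) \<le> ennreal (1\<^sup>2)"
      using N[of 0 _ m] that by (intro G_le) auto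
    also have "\<dots> < \<infinity>" by simp
    finally show ?thesis
      by (auto simp: square_integrable_def intro!: integrableI_bounded)
  qed
  have "square_integrable G"
    using square_integrable_add[OF sqd[of "N 0"] g[of "N 0"]] by simp
  moreover have "(\<lambda>k. l2norm (\<lambda>x. G x - g k x)) \<longlonglongrightarrow> 0"
  proof (rule LIMSEQ_I)
    fix e :: real assume "e > 0"
    then obtain M where M: "\<And>m n. m \<ge> M \<Longrightarrow> n \<ge> M \<Longrightarrow> l2norm (\<lambda>x. g m x - g n x) \<le> e / 2"
      using Cauchy[of "e/2"] by auto
    have "l2norm (\<lambda>x. G x - g m x) < e" if "m \<ge> M" for m
    proof -
      have "square_integrable (\<lambda>x. G x - g m x)" 
        using square_integrable_diff[OF \<open>square_integrable G\<close> g] by simp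
      from nn_integral_power2_norm[OF this] have "ennreal ((l2norm (\<lambda>x. G x - g m x))\<^sup>2) \<le> ennreal ((e/2)\<^sup>2)"
        using G_le[of m "e/2"] M[of _ m] that by simp
      then have "(l2norm (\<lambda>x. G x - g m x))\<^sup>2 \<le> (e/2)\<^sup>2"
        by (subst (asm) ennreal_le_iff) auto
      then have "l2norm (\<lambda>x. G x - g m x) \<le> e/2"
        by (rule power2_le_imp_le) (use \<open>e > 0\<close> in auto)
      then show ?thesis using \<open>e > 0\<close> by simp
    qed
    then show "\<exists>M. \<forall>m\<ge>M. norm (l2norm (\<lambda>x. G x - g m x) - 0) < e" by auto
  qed
  ultimately show ?thesis by blast
qed

lemma L2_limit_unique:
  fixes f :: "'c \<Rightarrow> 'a::euclidean_space \<Rightarrow> complex"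
  assumes "\<And>k. square_integrable (f k)" "square_integrable a" "square_integrable b"
    and "((\<lambda>k. l2norm (\<lambda>x. a x - f k x)) \<longlongrightarrow> 0) F" "((\<lambda>k. l2norm (\<lambda>x. b x - f k x)) \<longlongrightarrow> 0) F" "F \<noteq> bot"
  shows "AE x in lborel. a x = b x"
proof -
  have "l2norm (\<lambda>x. a x - b x) \<le> 0"
  proof (rule tendsto_lowerbound)
    show "((\<lambda>k. l2norm (\<lambda>x. a x - f k x) + l2norm (\<lambda>x. b x - f k x)) \<longlongrightarrow> 0) F"
      using tendsto_add[OF assms(4,5)] by simp
    show "\<forall>\<^sub>F k in F. l2norm (\<lambda>x. a x - b x) \<le> l2norm (\<lambda>x. a x - f k x) + l2norm (\<lambda>x. b x - f k x)"
      using l2norm_triangle_diff[OF assms(2) assms(1) assms(3)] l2norm_minus_commute[of b]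
      by (intro always_eventually allI) metis
  qed fact
  then have "l2norm (\<lambda>x. a x - b x) = 0" using l2norm_nonneg[of "\<lambda>x. a x - b x"] by linarith
  then show ?thesis using l2norm_eq_0_iff[OF square_integrable_diff[OF assms(2,3)]] by simp
qed

section \<open>Extension of the transform from truncations to L^2\<close>

definition ball_cutoff :: "real \<Rightarrow> ('a::euclidean_space \<Rightarrow> complex) \<Rightarrow> 'a \<Rightarrow> complex" where
  "ball_cutoff R f x = of_real (indicator (ball 0 R) x) * f x"

lemma fourier_truncated_eq: "fourier_truncated R f = fourier (ball_cutoff R f)"
  by (auto simp: fourier_truncated_def fourier_def ball_cutoff_def set_lebesgue_integral_def
      scaleR_conv_of_real mult_ac)

text \<open>A bounded function that vanishes off a ball is itself in L^2, so Cauchy-Schwarz puts its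
  product with \<open>f\<close> into L^1. This serves both sharp truncations and differentiable
  cutoffs.\<close>

lemma L1_L2_bounded_support:
  fixes f \<psi> :: "'a::euclidean_space \<Rightarrow> complex"
  assumes f: "square_integrable f" and [measurable]: "\<psi> \<in> borel_measurable borel"
    and bound: "\<And>x. cmod (\<psi> x) \<le> C" and supp: "\<And>x. norm x \<ge> R \<Longrightarrow> \<psi> x = 0"
  shows "integrable lborel (\<lambda>x. \<psi> x * f x)" "square_integrable (\<lambda>x. \<psi> x * f x)"
proof -
  note [measurable] = square_integrableD(1)[OF f]
  have "integrable lborel (indicat_real (ball (0::'a) R))"
    using emeasure_lborel_ball_finite[of "0::'a" R] by (simp add: integrable_indicator_iff)
  moreover have "(cmod (complex_of_real (indicator (ball 0 R) x)))\<^sup>2 = indicat_real (ball 0 R) x" for x :: 'a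
    by (simp add: indicator_def)
  ultimately have ball: "square_integrable (\<lambda>x::'a. complex_of_real (indicator (ball 0 R) x))"
    by (simp add: square_integrable_def)
  have "0 \<le> C" using bound[of 0] norm_ge_zero order_trans by blast
  then have "square_integrable \<psi>"
    by (intro square_integrable_bound[OF ball, where C = C]) (use bound supp in \<open>auto simp: indicator_def\<close>)
  then show "integrable lborel (\<lambda>x. \<psi> x * f x)" by (rule square_integrable_mult[OF _ f])
  show "square_integrable (\<lambda>x. \<psi> x * f x)"
    by (rule square_integrable_bound[OF f, where C = C]) (use bound in \<open>auto simp: norm_mult intro!: mult_right_mono\<close>)
qed

lemma ball_cutoff_L1_L2:
  assumes "square_integrable f"
  shows "integrable lborel (ball_cutoff R f)" "square_integrable (ball_cutoff R f)"
  unfolding ball_cutoff_def[abs_def]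
  by (rule L1_L2_bounded_support[OF assms, where C = 1 and R = R]; auto simp: indicator_def)+

lemma ball_cutoff_measurable [measurable]:
  fixes f :: "'a::euclidean_space \<Rightarrow> complex"
  shows "f \<in> borel_measurable borel \<Longrightarrow> ball_cutoff R f \<in> borel_measurable borel"
  unfolding ball_cutoff_def[abs_def] using borel_open[OF open_ball, of "0::'a" R] by measurable

lemma ball_cutoff_tendsto:
  assumes f: "square_integrable f"
  shows "((\<lambda>R. l2norm (\<lambda>x. f x - ball_cutoff R f x)) \<longlongrightarrow> 0) at_top"
proof -
  note [measurable] = square_integrableD(1)[OF f]
  have "((\<lambda>R. LINT x|lborel. (cmod (f x - ball_cutoff R f x))\<^sup>2) \<longlongrightarrow> (LINT x|(lborel :: 'a measure). 0)) at_top"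
  proof (rule integral_dominated_convergence_at_top)
    show "integrable lborel (\<lambda>x. (cmod (f x))\<^sup>2)" by (rule square_integrableD(2)[OF f])
    show "\<forall>\<^sub>F R in at_top. AE x in lborel. norm ((cmod (f x - ball_cutoff R f x))\<^sup>2) \<le> (cmod (f x))\<^sup>2"
      by (intro always_eventually allI AE_I2) (auto simp: ball_cutoff_def indicator_def)
    show "AE x in lborel. ((\<lambda>R. (cmod (f x - ball_cutoff R f x))\<^sup>2) \<longlongrightarrow> 0) at_top"
    proof (intro AE_I2 tendsto_eventually)
      fix x :: 'a
      show "\<forall>\<^sub>F R in at_top. (cmod (f x - ball_cutoff R f x))\<^sup>2 = 0"
        using eventually_gt_at_top[of "norm x"] by eventually_elim (simp add: ball_cutoff_def)
    qed
  qed measurable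
  then have "((\<lambda>R. (l2norm (\<lambda>x. f x - ball_cutoff R f x))\<^sup>2) \<longlongrightarrow> 0) at_top"
    by (simp add: l2norm_power2)
  then show ?thesis using tendsto_real_sqrt[of _ 0] by fastforce
qed

lemma fourier_add:
  assumes "integrable lborel f" "integrable lborel g"
  shows "fourier (\<lambda>x. f x + g x) \<xi> = fourier f \<xi> + fourier g \<xi>"
  using fourier_integrable[OF assms(1)] fourier_integrable[OF assms(2)]
  by (simp add: fourier_def distrib_left)

lemma fourier_cmult: "fourier (\<lambda>x. c * f x) \<xi> = c * fourier f \<xi>"
  by (simp add: fourier_def mult.left_commute)

lemma fourier_diff:
  assumes "integrable lborel f" "integrable lborel g"
  shows "fourier (\<lambda>x. f x - g x) \<xi> = fourier f \<xi> - fourier g \<xi>"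
  using fourier_integrable[OF assms(1)] fourier_integrable[OF assms(2)]
  by (simp add: fourier_def right_diff_distrib)

lemma l2norm_fourier:
  fixes h :: "'a::euclidean_space \<Rightarrow> complex"
  assumes "integrable lborel h" "square_integrable h"
  shows "l2norm (fourier h) = sqrt ((2 * pi) ^ DIM('a)) * l2norm h"
  using plancherel(2)[OF assms] by (metis l2norm_nonneg real_sqrt_mult real_sqrt_unique)

lemma l2norm_fourier_diff:
  fixes f g :: "'a::euclidean_space \<Rightarrow> complex"
  assumes "integrable lborel f" "square_integrable f" "integrable lborel g" "square_integrable g"
  shows "l2norm (\<lambda>\<xi>. fourier f \<xi> - fourier g \<xi>) = sqrt ((2 * pi) ^ DIM('a)) * l2norm (\<lambda>x. f x - g x)"
proof -
  have "fourier (\<lambda>x. f x - g x) = (\<lambda>\<xi>. fourier f \<xi> - fourier g \<xi>)"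
    by (intro ext fourier_diff assms)
  then show ?thesis
    using l2norm_fourier[of "\<lambda>x. f x - g x"] assms square_integrable_diff[OF assms(2,4)] by auto
qed

text \<open>Plancherel makes the transforms of truncations Cauchy because the truncations are.
  Completeness is applied along integer radii.\<close>

lemma fourier_L2_limit_exists:
  fixes f :: "'a::euclidean_space \<Rightarrow> complex"
  assumes f: "square_integrable f"
  shows "\<exists>G. square_integrable G \<and> ((\<lambda>R. l2norm (\<lambda>\<xi>. G \<xi> - fourier (ball_cutoff R f) \<xi>)) \<longlongrightarrow> 0) at_top"
proof -
  define C where "C = sqrt ((2 * pi) ^ DIM('a))"
  have C: "C > 0" by (simp add: C_def)
  note T = ball_cutoff_L1_L2[OF f]
  note P = plancherel(1)[OF T]
  let ?t = "\<lambda>R. l2norm (\<lambda>x. f x - ball_cutoff R f x)"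
  have le: "l2norm (\<lambda>\<xi>. fourier (ball_cutoff R f) \<xi> - fourier (ball_cutoff S f) \<xi>) \<le> C * (?t R + ?t S)" for R S
    unfolding l2norm_fourier_diff[OF T T] C_def[symmetric]
    using l2norm_triangle_diff[OF T(2)[of R] f T(2)[of S]] C
    by (intro mult_left_mono) (simp_all add: l2norm_minus_commute[of _ f])
  have lim: "(\<lambda>k. ?t (real k)) \<longlonglongrightarrow> 0"
    using filterlim_compose[OF ball_cutoff_tendsto[OF f] filterlim_real_sequentially] by simp
  have "\<exists>G. square_integrable G \<and> (\<lambda>k. l2norm (\<lambda>\<xi>. G \<xi> - fourier (ball_cutoff (real k) f) \<xi>)) \<longlonglongrightarrow> 0"
  proof (rule L2_complete)
    fix e :: real assume "e > 0"
    then have "e / (2 * C) > 0" using C by simp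
    from LIMSEQ_D[OF lim this] obtain N where N: "\<And>n. n \<ge> N \<Longrightarrow> ?t (real n) < e / (2 * C)"
      by auto
    have "l2norm (\<lambda>\<xi>. fourier (ball_cutoff (real m) f) \<xi> - fourier (ball_cutoff (real n) f) \<xi>) \<le> e" if "m \<ge> N" "n \<ge> N" for m n
    proof -
      have "C * (?t (real m) + ?t (real n)) \<le> C * (e / (2 * C) + e / (2 * C))"
        using N[OF that(1)] N[OF that(2)] C by (intro mult_left_mono) auto
      also have "\<dots> = e" using C by (simp add: field_simps)
      finally show ?thesis using le[of m n] by linarith
    qed
    then show "\<exists>N. \<forall>m\<ge>N. \<forall>n\<ge>N. l2norm (\<lambda>\<xi>. fourier (ball_cutoff (real m) f) \<xi> - fourier (ball_cutoff (real n) f) \<xi>) \<le> e"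
      by blast
  qed (rule P)
  then obtain G where G: "square_integrable G" "(\<lambda>k. l2norm (\<lambda>\<xi>. G \<xi> - fourier (ball_cutoff (real k) f) \<xi>)) \<longlonglongrightarrow> 0"
    by blast
  \<comment> \<open>Passing from integer to real radii: compare radius \<open>R\<close> with radius
    \<open>k\<close> and let \<open>k\<close> tend to infinity with \<open>R\<close> fixed.\<close>
  have "l2norm (\<lambda>\<xi>. G \<xi> - fourier (ball_cutoff R f) \<xi>) \<le> C * ?t R" for R
  proof (rule tendsto_lowerbound)
    show "(\<lambda>k. l2norm (\<lambda>\<xi>. G \<xi> - fourier (ball_cutoff (real k) f) \<xi>) + C * (?t (real k) + ?t R)) \<longlonglongrightarrow> C * ?t R"
      using tendsto_add[OF G(2) tendsto_mult_left[OF tendsto_add[OF lim tendsto_const]]] by simp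
    show "\<forall>\<^sub>F k in sequentially. l2norm (\<lambda>\<xi>. G \<xi> - fourier (ball_cutoff R f) \<xi>) \<le> l2norm (\<lambda>\<xi>. G \<xi> - fourier (ball_cutoff (real k) f) \<xi>) + C * (?t (real k) + ?t R)"
    proof (intro always_eventually allI)
      fix k
      show "l2norm (\<lambda>\<xi>. G \<xi> - fourier (ball_cutoff R f) \<xi>) \<le> l2norm (\<lambda>\<xi>. G \<xi> - fourier (ball_cutoff (real k) f) \<xi>) + C * (?t (real k) + ?t R)"
        using l2norm_triangle_diff[OF G(1) P[of "real k"] P[of R]] le[of "real k" R] by linarith
    qed
  qed simp
  then have "((\<lambda>R. l2norm (\<lambda>\<xi>. G \<xi> - fourier (ball_cutoff R f) \<xi>)) \<longlongrightarrow> 0) at_top"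
    by (intro tendsto_sandwich[OF _ _ tendsto_const tendsto_mult_right_zero[OF ball_cutoff_tendsto[OF f], of C]]) auto
  with G(1) show ?thesis by blast
qed

text \<open>Existence of the limit is what makes the choice in \<open>fourier_L2\<close> meaningful.
  From here on the convergence is expressed by \<open>l2norm\<close> instead of a nonnegative
  integral.\<close>

lemma fourier_L2_spec:
  fixes f :: "real^'n \<Rightarrow> complex"
  assumes f: "square_integrable f"
  shows "square_integrable (fourier_L2 f)"
    and "((\<lambda>R. l2norm (\<lambda>\<xi>. fourier_L2 f \<xi> - fourier (ball_cutoff R f) \<xi>)) \<longlongrightarrow> 0) at_top"
proof -
  note T = ball_cutoff_L1_L2[OF f]
  note P = plancherel(1)[OF T]
  have eq: "(\<lambda>R. \<integral>\<^sup>+ \<xi>. ennreal ((cmod (g \<xi> - fourier_truncated R f \<xi>))\<^sup>2) \<partial>lborel) =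
            (\<lambda>R. ennreal ((l2norm (\<lambda>\<xi>. g \<xi> - fourier (ball_cutoff R f) \<xi>))\<^sup>2))" if "square_integrable g" for g
    unfolding fourier_truncated_eq by (intro ext nn_integral_power2_norm square_integrable_diff that P)
  obtain G where G: "square_integrable G" "((\<lambda>R. l2norm (\<lambda>\<xi>. G \<xi> - fourier (ball_cutoff R f) \<xi>)) \<longlongrightarrow> 0) at_top"
    using fourier_L2_limit_exists[OF f] by blast
  have "((\<lambda>R. ennreal ((l2norm (\<lambda>\<xi>. G \<xi> - fourier (ball_cutoff R f) \<xi>))\<^sup>2)) \<longlongrightarrow> ennreal (0\<^sup>2)) at_top"
    by (intro tendsto_ennrealI tendsto_power G(2))
  then have "has_fourier_L2 f G"
    unfolding has_fourier_L2_def eq[OF G(1)] using G(1) by simp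
  then have has: "has_fourier_L2 f (fourier_L2 f)"
    unfolding fourier_L2_def by (rule someI[where P = "has_fourier_L2 f"])
  then show sq: "square_integrable (fourier_L2 f)" by (simp add: has_fourier_L2_def)
  from has have "((\<lambda>R. ennreal ((l2norm (\<lambda>\<xi>. fourier_L2 f \<xi> - fourier (ball_cutoff R f) \<xi>))\<^sup>2)) \<longlongrightarrow> ennreal 0) at_top"
    unfolding has_fourier_L2_def eq[OF sq] by simp
  then have "((\<lambda>R. (l2norm (\<lambda>\<xi>. fourier_L2 f \<xi> - fourier (ball_cutoff R f) \<xi>))\<^sup>2) \<longlongrightarrow> 0) at_top"
    by (subst (asm) tendsto_ennreal_iff) auto
  then show "((\<lambda>R. l2norm (\<lambda>\<xi>. fourier_L2 f \<xi> - fourier (ball_cutoff R f) \<xi>)) \<longlongrightarrow> 0) at_top"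
    using tendsto_real_sqrt[of _ 0] by fastforce
qed

text \<open>The transform can be computed along any approximation by functions in L^1 and L^2. This
  matters because sharp truncation of a plane wave does not give a test function.\<close>

lemma fourier_L2_approx:
  fixes f :: "real^'n \<Rightarrow> complex"
  assumes f: "square_integrable f"
    and h: "\<And>k::nat. integrable lborel (h k)" "\<And>k. square_integrable (h k)"
    and lim: "(\<lambda>k. l2norm (\<lambda>x. f x - h k x)) \<longlonglongrightarrow> 0"
  shows "(\<lambda>k. l2norm (\<lambda>\<xi>. fourier_L2 f \<xi> - fourier (h k) \<xi>)) \<longlonglongrightarrow> 0"
proof -
  define C where "C = sqrt ((2 * pi) ^ CARD('n))"
  note T = ball_cutoff_L1_L2[OF f]
  let ?a = "\<lambda>k. l2norm (\<lambda>\<xi>. fourier_L2 f \<xi> - fourier (ball_cutoff (real k) f) \<xi>)"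
  let ?b = "\<lambda>k. l2norm (\<lambda>x. f x - ball_cutoff (real k) f x)"
  have a: "?a \<longlonglongrightarrow> 0" and b: "?b \<longlonglongrightarrow> 0"
    using filterlim_compose[OF fourier_L2_spec(2)[OF f] filterlim_real_sequentially]
      filterlim_compose[OF ball_cutoff_tendsto[OF f] filterlim_real_sequentially] by simp_all
  show ?thesis
  proof (rule tendsto_sandwich[OF _ _ tendsto_const])
    show "(\<lambda>k. ?a k + C * (?b k + l2norm (\<lambda>x. f x - h k x))) \<longlonglongrightarrow> 0"
      using tendsto_add[OF a tendsto_mult_right_zero[OF tendsto_add_zero[OF b lim], of C]] by simp
    show "\<forall>\<^sub>F k in sequentially. l2norm (\<lambda>\<xi>. fourier_L2 f \<xi> - fourier (h k) \<xi>) \<le> ?a k + C * (?b k + l2norm (\<lambda>x. f x - h k x))"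
    proof (intro always_eventually allI)
      fix k
      have "l2norm (\<lambda>\<xi>. fourier (ball_cutoff (real k) f) \<xi> - fourier (h k) \<xi>) = C * l2norm (\<lambda>x. ball_cutoff (real k) f x - h k x)"
        using l2norm_fourier_diff[OF T h] by (simp add: C_def)
      also have "\<dots> \<le> C * (?b k + l2norm (\<lambda>x. f x - h k x))"
        using l2norm_triangle_diff[OF T(2)[of "real k"] f h(2)[of k]]
        by (intro mult_left_mono) (auto simp: C_def l2norm_minus_commute[of _ f])
      finally show "l2norm (\<lambda>\<xi>. fourier_L2 f \<xi> - fourier (h k) \<xi>) \<le> ?a k + C * (?b k + l2norm (\<lambda>x. f x - h k x))"
        using l2norm_triangle_diff[OF fourier_L2_spec(1)[OF f] plancherel(1)[OF T(1)[of "real k"] T(2)] plancherel(1)[OF h(1)[of k] h(2)]]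
        by linarith
    qed
  qed auto
qed

lemma l2norm_fourier_L2:
  fixes f :: "real^'n \<Rightarrow> complex"
  assumes f: "square_integrable f"
  shows "l2norm (fourier_L2 f) = sqrt ((2 * pi) ^ CARD('n)) * l2norm f"
proof (rule tendsto_unique)
  note T = ball_cutoff_L1_L2[OF f]
  let ?a = "\<lambda>R. l2norm (\<lambda>\<xi>. fourier_L2 f \<xi> - fourier (ball_cutoff R f) \<xi>)"
  let ?b = "\<lambda>R. l2norm (\<lambda>x. f x - ball_cutoff R f x)"
  have conv: "((\<lambda>R. l2norm (u R)) \<longlongrightarrow> l2norm g) at_top"
    if "square_integrable g" "\<And>R. square_integrable (u R)" "((\<lambda>R. l2norm (\<lambda>x. g x - u R x)) \<longlongrightarrow> 0) at_top"
    for g :: "real^'n \<Rightarrow> complex" and u :: "real \<Rightarrow> real^'n \<Rightarrow> complex"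
  proof (rule LIM_zero_cancel, rule Lim_null_comparison[OF _ that(3)])
    show "\<forall>\<^sub>F R in at_top. norm (l2norm (u R) - l2norm g) \<le> l2norm (\<lambda>x. g x - u R x)"
      using l2norm_diff_le[OF that(1,2)] by (simp add: abs_minus_commute)
  qed
  show "((\<lambda>R. l2norm (fourier (ball_cutoff R f))) \<longlongrightarrow> l2norm (fourier_L2 f)) at_top"
    by (rule conv[OF fourier_L2_spec(1)[OF f] plancherel(1)[OF T] fourier_L2_spec(2)[OF f]])
  have "((\<lambda>R. sqrt ((2 * pi) ^ CARD('n)) * l2norm (ball_cutoff R f)) \<longlongrightarrow> sqrt ((2 * pi) ^ CARD('n)) * l2norm f) at_top"
    by (intro tendsto_mult_left conv[OF f T(2) ball_cutoff_tendsto[OF f]])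
  then show "((\<lambda>R. l2norm (fourier (ball_cutoff R f))) \<longlongrightarrow> sqrt ((2 * pi) ^ CARD('n)) * l2norm f) at_top"
    by (simp add: l2norm_fourier[OF T])
qed simp

text \<open>Linearity can hold only almost everywhere, since \<open>fourier_L2\<close> chooses a
  representative separately for each function.\<close>

lemma fourier_L2_lincomb:
  fixes f g :: "real^'n \<Rightarrow> complex"
  assumes f: "square_integrable f" and g: "square_integrable g"
  shows "AE \<xi> in lborel. fourier_L2 (\<lambda>x. a * f x + b * g x) \<xi> = a * fourier_L2 f \<xi> + b * fourier_L2 g \<xi>"
proof -
  note F = fourier_L2_spec[OF f] and G = fourier_L2_spec[OF g]
  have fg: "square_integrable (\<lambda>x. a * f x + b * g x)"
    by (intro square_integrable_add square_integrable_cmult f g)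
  note H = fourier_L2_spec[OF fg]
  note T = ball_cutoff_L1_L2[OF f] ball_cutoff_L1_L2[OF g]
  have cut: "ball_cutoff R (\<lambda>x. a * f x + b * g x) = (\<lambda>x. a * ball_cutoff R f x + b * ball_cutoff R g x)" for R
    by (auto simp: ball_cutoff_def algebra_simps)
  have eq: "fourier (ball_cutoff R (\<lambda>x. a * f x + b * g x)) = (\<lambda>\<xi>. a * fourier (ball_cutoff R f) \<xi> + b * fourier (ball_cutoff R g) \<xi>)" for R
    unfolding cut using T by (auto simp: fourier_add fourier_cmult)
  show ?thesis
  proof (rule L2_limit_unique[where F = at_top and f = "\<lambda>R. fourier (ball_cutoff R (\<lambda>x. a * f x + b * g x))"])
    show "square_integrable (fourier (ball_cutoff R (\<lambda>x. a * f x + b * g x)))" for R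
      by (rule plancherel(1)[OF ball_cutoff_L1_L2[OF fg]])
    show "square_integrable (fourier_L2 (\<lambda>x. a * f x + b * g x))" by (rule H)
    show "square_integrable (\<lambda>\<xi>. a * fourier_L2 f \<xi> + b * fourier_L2 g \<xi>)"
      by (intro square_integrable_add square_integrable_cmult F G)
    show "((\<lambda>R. l2norm (\<lambda>\<xi>. fourier_L2 (\<lambda>x. a * f x + b * g x) \<xi> - fourier (ball_cutoff R (\<lambda>x. a * f x + b * g x)) \<xi>)) \<longlongrightarrow> 0) at_top"
      by (rule H)
    let ?a = "\<lambda>R \<xi>. fourier_L2 f \<xi> - fourier (ball_cutoff R f) \<xi>"
    let ?b = "\<lambda>R \<xi>. fourier_L2 g \<xi> - fourier (ball_cutoff R g) \<xi>"
    have comb: "(a * fourier_L2 f \<xi> + b * fourier_L2 g \<xi>) - (a * fourier (ball_cutoff R f) \<xi> + b * fourier (ball_cutoff R g) \<xi>) = a * ?a R \<xi> + b * ?b R \<xi>" for R \<xi>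
      by (simp add: algebra_simps)
    have sq: "square_integrable (?a R)" "square_integrable (?b R)" for R
      by (intro square_integrable_diff F G plancherel(1) T)+
    show "((\<lambda>R. l2norm (\<lambda>\<xi>. (a * fourier_L2 f \<xi> + b * fourier_L2 g \<xi>) - fourier (ball_cutoff R (\<lambda>x. a * f x + b * g x)) \<xi>)) \<longlongrightarrow> 0) at_top"
    proof (rule tendsto_sandwich[OF _ _ tendsto_const])
      show "((\<lambda>R. cmod a * l2norm (?a R) + cmod b * l2norm (?b R)) \<longlongrightarrow> 0) at_top"
        by (intro tendsto_add_zero tendsto_mult_right_zero F G)
      have "l2norm (\<lambda>\<xi>. (a * fourier_L2 f \<xi> + b * fourier_L2 g \<xi>) - fourier (ball_cutoff R (\<lambda>x. a * f x + b * g x)) \<xi>) \<le> cmod a * l2norm (?a R) + cmod b * l2norm (?b R)" for R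
        unfolding eq using l2norm_triangle[OF square_integrable_cmult[OF sq(1)[of R], of a] square_integrable_cmult[OF sq(2)[of R], of b]]
        by (simp only: l2norm_cmult comb)
      then show "\<forall>\<^sub>F R in at_top. l2norm (\<lambda>\<xi>. (a * fourier_L2 f \<xi> + b * fourier_L2 g \<xi>) - fourier (ball_cutoff R (\<lambda>x. a * f x + b * g x)) \<xi>) \<le> cmod a * l2norm (?a R) + cmod b * l2norm (?b R)"
        by simp
    qed auto
  qed simp
qed

section \<open>Fourier transforms of weak derivatives\<close>

lemma bounded_multiplier:
  fixes u m :: "'a::euclidean_space \<Rightarrow> complex"
  assumes u: "square_integrable u" and [measurable]: "m \<in> borel_measurable borel" and M: "\<And>x. cmod (m x) \<le> M"
  shows "square_integrable (\<lambda>x. m x * u x)" "l2norm (\<lambda>x. m x * u x) \<le> M * l2norm u"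
proof -
  note [measurable] = square_integrableD(1)[OF u]
  have M0: "0 \<le> M" using M[of 0] norm_ge_zero order_trans by blast
  show sq: "square_integrable (\<lambda>x. m x * u x)"
    by (rule square_integrable_bound[OF u, where C = M]) (use M in \<open>auto simp: norm_mult intro!: mult_right_mono\<close>)
  have "(l2norm (\<lambda>x. m x * u x))\<^sup>2 \<le> (LINT x|lborel. M\<^sup>2 * (cmod (u x))\<^sup>2)"
    unfolding l2norm_power2
    using square_integrableD(2)[OF sq] square_integrableD(2)[OF u]
    by (intro integral_mono) (auto simp: norm_mult power_mult_distrib intro!: mult_right_mono power_mono M)
  also have "\<dots> = (M * l2norm u)\<^sup>2"
    by (simp add: l2norm_power2 power_mult_distrib)
  finally show "l2norm (\<lambda>x. m x * u x) \<le> M * l2norm u"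
    by (rule power2_le_imp_le) (simp add: M0)
qed

lemma l2norm_sum:
  fixes f :: "'i \<Rightarrow> 'a::euclidean_space \<Rightarrow> complex"
  assumes "finite I" "\<And>i. i \<in> I \<Longrightarrow> square_integrable (f i)"
  shows "square_integrable (\<lambda>x. \<Sum>i\<in>I. f i x) \<and> l2norm (\<lambda>x. \<Sum>i\<in>I. f i x) \<le> (\<Sum>i\<in>I. l2norm (f i))"
  using assms
proof (induction I rule: finite_induct)
  case empty
  show ?case by (simp add: square_integrable_def l2norm_def)
next
  case (insert i I)
  then have "square_integrable (f i)" "square_integrable (\<lambda>x. \<Sum>i\<in>I. f i x)" "l2norm (\<lambda>x. \<Sum>i\<in>I. f i x) \<le> (\<Sum>i\<in>I. l2norm (f i))"
    by auto
  with insert(1,2) l2norm_triangle[of "f i" "\<lambda>x. \<Sum>i\<in>I. f i x"] show ?case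
    by (auto intro: square_integrable_add)
qed

text \<open>
  The square of the positive part is the simplest \<open>C\<^sup>1\<close> profile; it makes \<open>wave_cutoff\<close>, a plane wave
  cut off at radius \<open>R\<close>, an admissible test function.
\<close>

definition pos_sq :: "real \<Rightarrow> real" where
  "pos_sq s = (max 0 s)\<^sup>2"

lemma pos_sq_deriv: "(pos_sq has_real_derivative 2 * max 0 s) (at s)"
proof -
  consider "s > 0" | "s < 0" | "s = 0" by linarith
  then show ?thesis
  proof cases
    case 1
    have "((\<lambda>s. s\<^sup>2) has_real_derivative 2 * max 0 s) (at s)"
      using 1 by (auto intro!: derivative_eq_intros)
    then show ?thesis
      by (rule has_field_derivative_transform_within_open[of _ _ _ "{0<..}"]) (use 1 in \<open>auto simp: pos_sq_def\<close>)
  next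
    case 2
    have "((\<lambda>s. 0) has_real_derivative 2 * max 0 s) (at s)"
      using 2 by (auto intro!: derivative_eq_intros)
    then show ?thesis
      by (rule has_field_derivative_transform_within_open[of _ _ _ "{..<0}"]) (use 2 in \<open>auto simp: pos_sq_def\<close>)
  next
    case 3
    have "((\<lambda>h. (pos_sq (0 + h) - pos_sq 0) / h) \<longlongrightarrow> 0) (at 0)"
    proof (rule Lim_null_comparison)
      have "norm ((pos_sq (0 + h) - pos_sq 0) / h) \<le> \<bar>h\<bar>" for h
        by (auto simp: pos_sq_def max_def power2_eq_square)
      then show "\<forall>\<^sub>F h in at 0. norm ((pos_sq (0 + h) - pos_sq 0) / h) \<le> \<bar>h\<bar>" by simp
      show "((\<lambda>h::real. \<bar>h\<bar>) \<longlongrightarrow> 0) (at 0)"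
        using tendsto_rabs[OF tendsto_ident_at, of 0 UNIV] by simp
    qed
    then show ?thesis using 3 by (simp add: DERIV_def)
  qed
qed

text \<open>The squared norm, instead of the norm, keeps the cutoff differentiable at the
  origin.\<close>

definition cutoff :: "real \<Rightarrow> real^'n \<Rightarrow> real" where
  "cutoff R x = pos_sq (1 - (norm x)\<^sup>2 / R\<^sup>2)"

definition cutoff_deriv :: "real \<Rightarrow> 'n \<Rightarrow> real^'n \<Rightarrow> real" where
  "cutoff_deriv R i x = 2 * max 0 (1 - (norm x)\<^sup>2 / R\<^sup>2) * (- (2 * (x $ i) / R\<^sup>2))"

definition wave_cutoff :: "real \<Rightarrow> real^'n \<Rightarrow> real^'n \<Rightarrow> complex" where
  "wave_cutoff R \<xi> x = complex_of_real (cutoff R x) * cis (- (x \<bullet> \<xi>))"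

text \<open>On the support a coordinate is at most \<open>R\<close>, and the derivative divides it
  by R^2. The resulting bound of order 1 / R is what makes the terms with a derivative on the cutoff
  vanish in the limit.\<close>

lemma cutoff_bounds:
  assumes "R > 0"
  shows "0 \<le> cutoff R x" "cutoff R x \<le> 1" "norm x \<ge> R \<Longrightarrow> cutoff R x = 0"
    and "\<bar>cutoff_deriv R i x\<bar> \<le> 4 / R" "norm x \<ge> R \<Longrightarrow> cutoff_deriv R i x = 0"
proof -
  show "0 \<le> cutoff R x" by (simp add: cutoff_def pos_sq_def)
  have m1: "max 0 (1 - (norm x)\<^sup>2 / R\<^sup>2) \<le> 1" by simp
  then show "cutoff R x \<le> 1" by (simp add: cutoff_def pos_sq_def power_le_one)
  have z: "max 0 (1 - (norm x)\<^sup>2 / R\<^sup>2) = 0" if "norm x \<ge> R"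
    using power_mono[OF that, of 2] assms by (simp add: max_def field_simps)
  then show "norm x \<ge> R \<Longrightarrow> cutoff R x = 0" "norm x \<ge> R \<Longrightarrow> cutoff_deriv R i x = 0"
    by (simp_all add: cutoff_def pos_sq_def cutoff_deriv_def)
  show "\<bar>cutoff_deriv R i x\<bar> \<le> 4 / R"
  proof (cases "norm x \<ge> R")
    case True
    then show ?thesis using z assms by (simp add: cutoff_deriv_def)
  next
    case False
    then have x: "\<bar>x $ i\<bar> \<le> R" using component_le_norm_cart[of x i] by simp
    have "\<bar>cutoff_deriv R i x\<bar> = 2 * max 0 (1 - (norm x)\<^sup>2 / R\<^sup>2) * (2 * \<bar>x $ i\<bar> / R\<^sup>2)"
      by (simp add: cutoff_deriv_def abs_mult)
    also have "\<dots> \<le> 2 * 1 * (2 * R / R\<^sup>2)"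
      using m1 x by (intro mult_mono divide_right_mono) auto
    also have "\<dots> = 4 / R" using assms by (simp add: power2_eq_square)
    finally show ?thesis .
  qed
qed

lemma cutoff_measurable [measurable]: "cutoff R \<in> borel_measurable borel" "cutoff_deriv R i \<in> borel_measurable borel"
  unfolding cutoff_def[abs_def] cutoff_deriv_def[abs_def] pos_sq_def by measurable

lemma cutoff_has_derivative:
  fixes x :: "real^'n"
  shows "(cutoff R has_derivative (\<lambda>v. 2 * max 0 (1 - (norm x)\<^sup>2 / R\<^sup>2) * (- (2 * (x \<bullet> v) / R\<^sup>2)))) (at x)"
proof -
  have q: "((\<lambda>x::real^'n. 1 - (x \<bullet> x) / R\<^sup>2) has_derivative (\<lambda>v. - (2 * (x \<bullet> v) / R\<^sup>2))) (at x)"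
    by (auto intro!: derivative_eq_intros simp: inner_commute add_divide_distrib divide_inverse algebra_simps)
  show ?thesis
    using has_derivative_compose[OF q, of pos_sq "\<lambda>h. 2 * max 0 (1 - (norm x)\<^sup>2 / R\<^sup>2) * h"]
      pos_sq_deriv[of "1 - (norm x)\<^sup>2 / R\<^sup>2", THEN has_field_derivative_imp_has_derivative]
    by (simp add: cutoff_def[abs_def] power2_norm_eq_inner)
qed

lemma cis_has_derivative:
  fixes \<xi> x :: "'a::euclidean_space"
  shows "((\<lambda>x. cis (- (x \<bullet> \<xi>))) has_derivative (\<lambda>v. - \<i> * of_real (v \<bullet> \<xi>) * cis (- (x \<bullet> \<xi>)))) (at x)"
proof -
  have "(cis has_derivative (\<lambda>h. h *\<^sub>R (\<i> * cis t))) (at t)" for t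
  proof -
    have "((\<lambda>t. \<i> * complex_of_real t) has_derivative (\<lambda>h. \<i> * complex_of_real h)) (at t)"
      by (intro has_derivative_mult_right has_derivative_of_real has_derivative_ident)
    from has_derivative_compose[OF this DERIV_exp[THEN has_field_derivative_imp_has_derivative]]
    show ?thesis unfolding cis_conv_exp[abs_def] by (simp add: scaleR_conv_of_real mult_ac)
  qed
  from has_derivative_compose[OF _ this, of "\<lambda>x. - (x \<bullet> \<xi>)" "\<lambda>v. - (v \<bullet> \<xi>)" x UNIV] show ?thesis
    by (auto intro!: derivative_eq_intros simp: scaleR_conv_of_real mult_ac)
qed

lemma wave_cutoff_has_derivative:
  "(wave_cutoff R \<xi> has_derivative
     (\<lambda>v. complex_of_real (cutoff R x) * (- \<i> * of_real (v \<bullet> \<xi>) * cis (- (x \<bullet> \<xi>)))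
       + complex_of_real (2 * max 0 (1 - (norm x)\<^sup>2 / R\<^sup>2) * (- (2 * (x \<bullet> v) / R\<^sup>2))) * cis (- (x \<bullet> \<xi>)))) (at x)"
  unfolding wave_cutoff_def[abs_def]
  by (intro has_derivative_mult has_derivative_of_real cutoff_has_derivative cis_has_derivative)

lemma wave_cutoff_partial_deriv:
  "partial_deriv i (wave_cutoff R \<xi>) x =
     cis (- (x \<bullet> \<xi>)) * (of_real (cutoff_deriv R i x) - \<i> * of_real (\<xi> $ i) * of_real (cutoff R x))"
  unfolding partial_deriv_def frechet_derivative_at[OF wave_cutoff_has_derivative, symmetric]
  by (simp add: cutoff_deriv_def inner_axis inner_axis' algebra_simps)

lemma wave_cutoff_test_function:
  assumes "R > 0"
  shows "test_function (wave_cutoff R \<xi>)"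
  unfolding test_function_def
proof (intro conjI allI)
  show "wave_cutoff R \<xi> differentiable at x" for x
    using wave_cutoff_has_derivative by (auto simp: differentiable_def)
  show "continuous_on UNIV (partial_deriv i (wave_cutoff R \<xi>))" for i
    unfolding wave_cutoff_partial_deriv[abs_def] cutoff_def cutoff_deriv_def pos_sq_def
    using assms by (intro continuous_intros) auto
  have "{x. wave_cutoff R \<xi> x \<noteq> 0} \<subseteq> ball 0 R"
    using cutoff_bounds(3)[OF assms] by (force simp: wave_cutoff_def)
  then show "compact (closure {x. wave_cutoff R \<xi> x \<noteq> 0})"
    by (simp add: bounded_subset[OF bounded_ball])
qed

lemma cutoff_mult_L1_L2:
  fixes f :: "real^'n \<Rightarrow> complex"
  assumes "square_integrable f" "R > 0"
  shows "integrable lborel (\<lambda>x. of_real (cutoff R x) * f x)" "square_integrable (\<lambda>x. of_real (cutoff R x) * f x)"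
    and "integrable lborel (\<lambda>x. of_real (cutoff_deriv R i x) * f x)" "square_integrable (\<lambda>x. of_real (cutoff_deriv R i x) * f x)"
  using cutoff_bounds[OF assms(2), where 'a = 'n]
  by (auto simp: abs_of_nonneg intro!: L1_L2_bounded_support[OF assms(1), where C = 1 and R = R and \<psi> = "\<lambda>x. of_real (cutoff R x)"]
     L1_L2_bounded_support[OF assms(1), where C = "4 / R" and R = R and \<psi> = "\<lambda>x. of_real (cutoff_deriv R i x)"])

lemma integrable_mult_partial_wave_cutoff:
  assumes "square_integrable f" "R > 0"
  shows "integrable lborel (\<lambda>x. f x * partial_deriv i (wave_cutoff R \<xi>) x)"
proof -
  note c = cutoff_mult_L1_L2[OF assms]
  have "integrable lborel (\<lambda>x. cis (- (x \<bullet> \<xi>)) * (of_real (cutoff_deriv R i x) * f x - (\<i> * of_real (\<xi> $ i)) * (of_real (cutoff R x) * f x)))"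
    by (intro fourier_integrable Bochner_Integration.integrable_diff integrable_mult_right c)
  then show ?thesis by (simp add: wave_cutoff_partial_deriv algebra_simps)
qed

lemma cutoff_mult_tendsto:
  fixes f :: "real^'n \<Rightarrow> complex"
  assumes f: "square_integrable f"
  shows "(\<lambda>k. l2norm (\<lambda>x. f x - of_real (cutoff (real (Suc k)) x) * f x)) \<longlonglongrightarrow> 0"
proof -
  note [measurable] = square_integrableD(1)[OF f]
  have "(\<lambda>k. LINT x|lborel. (cmod (f x - of_real (cutoff (real (Suc k)) x) * f x))\<^sup>2) \<longlonglongrightarrow> (LINT x|(lborel :: (real^'n) measure). 0)"
  proof (rule integral_dominated_convergence)
    show "integrable lborel (\<lambda>x. (cmod (f x))\<^sup>2)" by (rule square_integrableD(2)[OF f])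
    have eq: "cmod (f x - of_real (cutoff (real (Suc k)) x) * f x) = (1 - cutoff (real (Suc k)) x) * cmod (f x)" for k x
    proof -
      have "f x - of_real (cutoff (real (Suc k)) x) * f x = of_real (1 - cutoff (real (Suc k)) x) * f x"
        by (simp add: algebra_simps)
      then show ?thesis using cutoff_bounds(2)[of "real (Suc k)" x] by (simp only: norm_mult norm_of_real) simp
    qed
    show "AE x in lborel. norm ((cmod (f x - of_real (cutoff (real (Suc k)) x) * f x))\<^sup>2) \<le> (cmod (f x))\<^sup>2" for k
    proof (intro AE_I2)
      fix x
      have "(1 - cutoff (real (Suc k)) x) * cmod (f x) \<le> cmod (f x)" "0 \<le> (1 - cutoff (real (Suc k)) x) * cmod (f x)"
        using cutoff_bounds(1,2)[of "real (Suc k)" x] by (auto intro!: mult_left_le_one_le)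
      then show "norm ((cmod (f x - of_real (cutoff (real (Suc k)) x) * f x))\<^sup>2) \<le> (cmod (f x))\<^sup>2"
        unfolding eq by (simp only: real_norm_def abs_power2) (rule power_mono)
    qed
    show "AE x in lborel. (\<lambda>k. (cmod (f x - of_real (cutoff (real (Suc k)) x) * f x))\<^sup>2) \<longlonglongrightarrow> 0"
    proof (intro AE_I2)
      fix x :: "real^'n"
      have "(\<lambda>k. (max 0 (1 - (norm x * (1 / real (Suc k)))\<^sup>2))\<^sup>2) \<longlonglongrightarrow> (max 0 (1 - (norm x * 0)\<^sup>2))\<^sup>2"
        by (intro tendsto_intros LIMSEQ_Suc[OF lim_1_over_n])
      then have "(\<lambda>k. cutoff (real (Suc k)) x) \<longlonglongrightarrow> 1"
        by (simp add: cutoff_def pos_sq_def power_divide)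
      from tendsto_power[OF tendsto_mult_right[OF tendsto_diff[OF tendsto_const[of 1] this], of "cmod (f x)"], of 2]
      show "(\<lambda>k. (cmod (f x - of_real (cutoff (real (Suc k)) x) * f x))\<^sup>2) \<longlonglongrightarrow> 0"
        unfolding eq by simp
    qed
  qed measurable
  then have "(\<lambda>k. (l2norm (\<lambda>x. f x - of_real (cutoff (real (Suc k)) x) * f x))\<^sup>2) \<longlonglongrightarrow> 0"
    by (simp add: l2norm_power2)
  then show ?thesis using tendsto_real_sqrt[of _ 0] by fastforce
qed

text \<open>The hypothesis \<open>weak\<close> says that \<open>w\<close> is the divergence of
  \<open>q\<close>, tested against cut-off waves only. A weak derivative is the case of a single
  index; the evolution equation is the case of all indices, with \<open>q\<close> the flux.\<close>

lemma fourier_L2_weak_divergence: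
  fixes w :: "real^'n \<Rightarrow> complex" and q :: "'n \<Rightarrow> real^'n \<Rightarrow> complex"
  assumes w: "square_integrable w" and q: "\<And>i. i \<in> I \<Longrightarrow> square_integrable (q i)"
    and weak: "\<And>R \<xi>. R > 0 \<Longrightarrow> (LINT x|lborel. w x * wave_cutoff R \<xi> x) +
       (\<Sum>i\<in>I. (LINT x|lborel. q i x * partial_deriv i (wave_cutoff R \<xi>) x)) = 0"
  shows "AE \<xi> in lborel. fourier_L2 w \<xi> = (\<Sum>i\<in>I. \<i> * of_real (\<xi> $ i) * fourier_L2 (q i) \<xi>)"
proof -
  define R where "R k = real (Suc k)" for k
  have R: "R k > 0" for k by (simp add: R_def)
  have fin: "finite I" by simp
  let ?c = "\<lambda>k f x. complex_of_real (cutoff (R k) x) * f x"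
  let ?d = "\<lambda>k i f x. complex_of_real (cutoff_deriv (R k) i x) * f x"
  note cw = cutoff_mult_L1_L2[OF w R]
  note cq = cutoff_mult_L1_L2[OF q R]
  \<comment> \<open>Testing against a cut-off plane wave produces ordinary transforms of functions
    of bounded support. The product rule leaves one error term, with the derivative on the
    cutoff.\<close>
  have eq: "fourier (?c k w) \<xi> = (\<Sum>i\<in>I. \<i> * of_real (\<xi> $ i) * fourier (?c k (q i)) \<xi> - fourier (?d k i (q i)) \<xi>)" for k \<xi>
  proof -
    have "(LINT x|lborel. w x * wave_cutoff (R k) \<xi> x) = fourier (?c k w) \<xi>"
      by (simp add: fourier_def wave_cutoff_def mult_ac)
    moreover have "(LINT x|lborel. q i x * partial_deriv i (wave_cutoff (R k) \<xi>) x) = fourier (?d k i (q i)) \<xi> - \<i> * of_real (\<xi> $ i) * fourier (?c k (q i)) \<xi>"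
      if "i \<in> I" for i
    proof -
      have "(LINT x|lborel. q i x * partial_deriv i (wave_cutoff (R k) \<xi>) x) = fourier (\<lambda>x. ?d k i (q i) x - (\<i> * of_real (\<xi> $ i)) * ?c k (q i) x) \<xi>"
        unfolding fourier_def wave_cutoff_partial_deriv by (intro Bochner_Integration.integral_cong) (auto simp: algebra_simps)
      also have "\<dots> = fourier (?d k i (q i)) \<xi> - fourier (\<lambda>x. (\<i> * of_real (\<xi> $ i)) * ?c k (q i) x) \<xi>"
        by (rule fourier_diff) (use cq[OF that] in auto)
      finally show ?thesis by (simp only: fourier_cmult)
    qed
    ultimately have "fourier (?c k w) \<xi> + (\<Sum>i\<in>I. fourier (?d k i (q i)) \<xi> - \<i> * of_real (\<xi> $ i) * fourier (?c k (q i)) \<xi>) = 0"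
      using weak[OF R[of k], of \<xi>] by simp
    then show ?thesis by (simp add: sum_subtractf algebra_simps add_eq_0_iff)
  qed
  \<comment> \<open>The weight \<open>\<omega>\<close> makes multiplication by a coordinate a bounded operator, so that limits in \<open>L\<^sup>2\<close> pass through.\<close>
  define \<omega> :: "real^'n \<Rightarrow> complex" where "\<omega> \<xi> = of_real (1 / (1 + (norm \<xi>)\<^sup>2))" for \<xi>
  define m :: "'n \<Rightarrow> real^'n \<Rightarrow> complex" where "m i \<xi> = \<omega> \<xi> * (\<i> * of_real (\<xi> $ i))" for i \<xi>
  have den: "1 + (norm \<xi>)\<^sup>2 > 0" for \<xi> :: "real^'n" by (simp add: add_pos_nonneg)
  have \<omega>: "cmod (\<omega> \<xi>) \<le> 1" "\<omega> \<xi> \<noteq> 0" for \<xi>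
    using den[of \<xi>] by (auto simp: \<omega>_def norm_divide simp del: of_real_add of_real_divide)
  have m: "cmod (m i \<xi>) \<le> 1" for i \<xi>
  proof -
    have "\<bar>\<xi> $ i\<bar> \<le> norm \<xi>" by (rule component_le_norm_cart)
    also have "norm \<xi> \<le> 1 + (norm \<xi>)\<^sup>2"
    proof -
      have "2 * norm \<xi> \<le> 1 + (norm \<xi>)\<^sup>2"
        using zero_le_power2[of "norm \<xi> - 1"] by (simp add: power2_eq_square algebra_simps)
      then show ?thesis using norm_ge_zero[of \<xi>] by linarith
    qed
    finally show ?thesis using den[of \<xi>]
      by (simp add: m_def \<omega>_def norm_mult norm_divide abs_of_pos del: of_real_add of_real_divide)
  qed
  have [measurable]: "\<omega> \<in> borel_measurable borel" "m i \<in> borel_measurable borel" for i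
    unfolding m_def[abs_def] \<omega>_def[abs_def] by measurable
  note W = bounded_multiplier[OF _ \<open>\<omega> \<in> borel_measurable borel\<close> \<omega>(1)]
  note M = bounded_multiplier[OF _ \<open>m _ \<in> borel_measurable borel\<close> m]
  note Fw = fourier_L2_spec(1)[OF w]
  note Fq = fourier_L2_spec(1)[OF q]
  have "AE \<xi> in lborel. \<omega> \<xi> * fourier_L2 w \<xi> = (\<Sum>i\<in>I. m i \<xi> * fourier_L2 (q i) \<xi>)"
  proof (rule L2_limit_unique[where F = sequentially and f = "\<lambda>k \<xi>. \<omega> \<xi> * fourier (?c k w) \<xi>"])
    show "square_integrable (\<lambda>\<xi>. \<omega> \<xi> * fourier (?c k w) \<xi>)" for k
      by (intro W plancherel(1) cw)
    show "square_integrable (\<lambda>\<xi>. \<omega> \<xi> * fourier_L2 w \<xi>)" by (intro W Fw)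
    show "square_integrable (\<lambda>\<xi>. \<Sum>i\<in>I. m i \<xi> * fourier_L2 (q i) \<xi>)"
      using l2norm_sum[OF fin, of "\<lambda>i \<xi>. m i \<xi> * fourier_L2 (q i) \<xi>"] M(1)[OF Fq] by blast
    have lw: "(\<lambda>k. l2norm (\<lambda>\<xi>. fourier_L2 w \<xi> - fourier (?c k w) \<xi>)) \<longlonglongrightarrow> 0"
      by (rule fourier_L2_approx[OF w cw(1,2)]) (use cutoff_mult_tendsto[OF w] in \<open>simp add: R_def\<close>)
    have lq: "(\<lambda>k. l2norm (\<lambda>\<xi>. fourier_L2 (q i) \<xi> - fourier (?c k (q i)) \<xi>)) \<longlonglongrightarrow> 0" if "i \<in> I" for i
      by (rule fourier_L2_approx[OF q[OF that] cq(1,2)[OF that]]) (use cutoff_mult_tendsto[OF q[OF that]] in \<open>simp add: R_def\<close>)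
    show "(\<lambda>k. l2norm (\<lambda>\<xi>. \<omega> \<xi> * fourier_L2 w \<xi> - \<omega> \<xi> * fourier (?c k w) \<xi>)) \<longlonglongrightarrow> 0"
    proof (rule tendsto_sandwich[OF _ _ tendsto_const lw])
      have "l2norm (\<lambda>\<xi>. \<omega> \<xi> * fourier_L2 w \<xi> - \<omega> \<xi> * fourier (?c k w) \<xi>) \<le> l2norm (\<lambda>\<xi>. fourier_L2 w \<xi> - fourier (?c k w) \<xi>)" for k
        using W(2)[OF square_integrable_diff[OF Fw plancherel(1)[OF cw(1)[of k] cw(2)]]] by (simp add: right_diff_distrib)
      then show "\<forall>\<^sub>F k in sequentially. l2norm (\<lambda>\<xi>. \<omega> \<xi> * fourier_L2 w \<xi> - \<omega> \<xi> * fourier (?c k w) \<xi>) \<le> l2norm (\<lambda>\<xi>. fourier_L2 w \<xi> - fourier (?c k w) \<xi>)"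
        by simp
    qed simp
    let ?e = "\<lambda>k i. l2norm (\<lambda>\<xi>. fourier_L2 (q i) \<xi> - fourier (?c k (q i)) \<xi>)"
    let ?K = "sqrt ((2 * pi) ^ CARD('n))"
    show "(\<lambda>k. l2norm (\<lambda>\<xi>. (\<Sum>i\<in>I. m i \<xi> * fourier_L2 (q i) \<xi>) - \<omega> \<xi> * fourier (?c k w) \<xi>)) \<longlonglongrightarrow> 0"
    proof (rule tendsto_sandwich[OF _ _ tendsto_const])
      have "(\<lambda>k. \<Sum>i\<in>I. ?e k i + ?K * ((4 / R k) * l2norm (q i))) \<longlonglongrightarrow> (\<Sum>i\<in>I. 0 + ?K * (0 * l2norm (q i)))"
      proof (intro tendsto_sum tendsto_add tendsto_mult_left tendsto_mult_right lq)
        show "(\<lambda>k. 4 / R k) \<longlonglongrightarrow> 0"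
          using tendsto_mult_right_zero[OF LIMSEQ_Suc[OF lim_1_over_n], of "4::real"] by (simp add: R_def)
      qed
      then show "(\<lambda>k. \<Sum>i\<in>I. ?e k i + ?K * ((4 / R k) * l2norm (q i))) \<longlonglongrightarrow> 0" by simp
      have "l2norm (\<lambda>\<xi>. (\<Sum>i\<in>I. m i \<xi> * fourier_L2 (q i) \<xi>) - \<omega> \<xi> * fourier (?c k w) \<xi>) \<le> (\<Sum>i\<in>I. ?e k i + ?K * ((4 / R k) * l2norm (q i)))" for k
      proof -
        \<comment> \<open>The error splits into \<open>?u\<close>, which is small because the
          cutoffs approximate \<open>q i\<close>, and \<open>?v\<close>, which by Plancherel is at
          most a constant times 4 / R.\<close>
        let ?u = "\<lambda>i \<xi>. m i \<xi> * (fourier_L2 (q i) \<xi> - fourier (?c k (q i)) \<xi>)"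
        let ?v = "\<lambda>i \<xi>. \<omega> \<xi> * fourier (?d k i (q i)) \<xi>"
        have "(\<Sum>i\<in>I. m i \<xi> * fourier_L2 (q i) \<xi>) - \<omega> \<xi> * fourier (?c k w) \<xi> = (\<Sum>i\<in>I. ?u i \<xi> + ?v i \<xi>)" for \<xi>
          unfolding eq sum_distrib_left sum_subtractf[symmetric] m_def by (intro sum.cong) (auto simp: algebra_simps)
        moreover have uv: "square_integrable (?u i)" "l2norm (?u i) \<le> ?e k i"
          "square_integrable (?v i)" "l2norm (?v i) \<le> ?K * ((4 / R k) * l2norm (q i))" if "i \<in> I" for i
        proof -
          have d: "square_integrable (\<lambda>\<xi>. fourier_L2 (q i) \<xi> - fourier (?c k (q i)) \<xi>)"
            by (intro square_integrable_diff Fq plancherel(1) cq that)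
          show "square_integrable (?u i)" "l2norm (?u i) \<le> ?e k i" using M[OF d] by auto
          have d: "square_integrable (fourier (?d k i (q i)))" by (intro plancherel(1) cq that)
          have "l2norm (?v i) \<le> l2norm (fourier (?d k i (q i)))" using W[OF d] by auto
          also have "\<dots> = ?K * l2norm (?d k i (q i))"
            by (subst l2norm_fourier) (use cq that in auto)
          also have "\<dots> \<le> ?K * ((4 / R k) * l2norm (q i))"
            using cutoff_bounds(4)[OF R[of k]]
            by (intro mult_left_mono bounded_multiplier(2) q that) auto
          finally show "l2norm (?v i) \<le> ?K * ((4 / R k) * l2norm (q i))" .
          show "square_integrable (?v i)" using W[OF d] by auto
        qed
        moreover have "l2norm (\<lambda>\<xi>. \<Sum>i\<in>I. ?u i \<xi> + ?v i \<xi>) \<le> (\<Sum>i\<in>I. l2norm (\<lambda>\<xi>. ?u i \<xi> + ?v i \<xi>))"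
          using l2norm_sum[OF fin, of "\<lambda>i \<xi>. ?u i \<xi> + ?v i \<xi>"] square_integrable_add[OF uv(1,3)] by blast
        moreover have "(\<Sum>i\<in>I. l2norm (\<lambda>\<xi>. ?u i \<xi> + ?v i \<xi>)) \<le> (\<Sum>i\<in>I. ?e k i + ?K * ((4 / R k) * l2norm (q i)))"
        proof (rule sum_mono)
          fix i assume i: "i \<in> I"
          show "l2norm (\<lambda>\<xi>. ?u i \<xi> + ?v i \<xi>) \<le> ?e k i + ?K * ((4 / R k) * l2norm (q i))"
            using l2norm_triangle[OF uv(1)[OF i] uv(3)[OF i]] uv(2)[OF i] uv(4)[OF i] by linarith
        qed
        ultimately show ?thesis by simp
      qed
      then show "\<forall>\<^sub>F k in sequentially. l2norm (\<lambda>\<xi>. (\<Sum>i\<in>I. m i \<xi> * fourier_L2 (q i) \<xi>) - \<omega> \<xi> * fourier (?c k w) \<xi>) \<le> (\<Sum>i\<in>I. ?e k i + ?K * ((4 / R k) * l2norm (q i)))"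
        by simp
    qed simp
  qed simp
  then show ?thesis
  proof eventually_elim
    case (elim \<xi>)
    then have "\<omega> \<xi> * fourier_L2 w \<xi> = \<omega> \<xi> * (\<Sum>i\<in>I. \<i> * of_real (\<xi> $ i) * fourier_L2 (q i) \<xi>)"
      by (simp add: m_def sum_distrib_left mult_ac)
    then show ?case using \<omega>(2)[of \<xi>] by simp
  qed
qed

section \<open>Weak gradients and the H^1 norm in Fourier space\<close>

lemma norm_vec_power2: "(norm (x :: complex^'n))\<^sup>2 = (\<Sum>i\<in>UNIV. (cmod (x $ i))\<^sup>2)"
  by (simp add: norm_vec_def L2_set_def sum_nonneg)

lemma norm_vec_real_power2: "(norm (x :: real^'n))\<^sup>2 = (\<Sum>i\<in>UNIV. (x $ i)\<^sup>2)"
  by (simp add: norm_vec_def L2_set_def sum_nonneg)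

lemma square_integrable_component:
  fixes g :: "real^'n \<Rightarrow> complex^'n"
  assumes g: "square_integrable g"
  shows "square_integrable (\<lambda>x. g x $ i)"
proof (rule square_integrable_bound[OF g, where C = 1])
  have "(\<lambda>y. y $ i) \<in> borel_measurable (borel :: (complex^'n) measure)"
    by (intro borel_measurable_continuous_onI continuous_intros)
  from measurable_compose[OF square_integrableD(1)[OF g] this]
  show "(\<lambda>x. g x $ i) \<in> borel_measurable borel" .
  show "norm (g x $ i) \<le> 1 * norm (g x)" for x
    using Finite_Cartesian_Product.norm_nth_le[of "g x" i] by simp
qed

lemma fourier_L2_weak_gradient:
  fixes f :: "real^'n \<Rightarrow> complex"
  assumes f: "square_integrable f" and g: "square_integrable g" and fg: "has_weak_gradient f g"
  shows "AE \<xi> in lborel. fourier_L2 (\<lambda>x. g x $ i) \<xi> = \<i> * of_real (\<xi> $ i) * fourier_L2 f \<xi>"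
proof -
  have "AE \<xi> in lborel. fourier_L2 (\<lambda>x. g x $ i) \<xi> = (\<Sum>j\<in>{i}. \<i> * of_real (\<xi> $ j) * fourier_L2 f \<xi>)"
  proof (rule fourier_L2_weak_divergence[OF square_integrable_component[OF g] f])
    fix R :: real and \<xi> :: "real^'n"
    assume "R > 0"
    from fg[unfolded has_weak_gradient_def, rule_format, OF wave_cutoff_test_function[OF this]]
    show "(LINT x|lborel. g x $ i * wave_cutoff R \<xi> x) + (\<Sum>j\<in>{i}. (LINT x|lborel. f x * partial_deriv j (wave_cutoff R \<xi>) x)) = 0"
      by simp
  qed
  then show ?thesis by simp
qed

lemma H1_weak_gradient:
  assumes "f \<in> H1"
  shows "square_integrable f" "square_integrable (weak_gradient f)" "has_weak_gradient f (weak_gradient f)"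
proof -
  from assms have "\<exists>g. square_integrable g \<and> has_weak_gradient f g" by (simp add: H1_def)
  from someI_ex[OF this] show "square_integrable (weak_gradient f)" "has_weak_gradient f (weak_gradient f)"
    by (simp_all add: weak_gradient_def)
  show "square_integrable f" using assms by (simp add: H1_def)
qed

text \<open>Plancherel applied to \<open>f\<close> and to each component of its gradient. The
  right-hand side no longer mentions a gradient, so the value does not depend on the choice in
  \<open>weak_gradient\<close>.\<close>

lemma H1_norm_fourier:
  fixes f :: "real^'n \<Rightarrow> complex"
  assumes f: "f \<in> H1"
  shows "integrable lborel (\<lambda>\<xi>. (1 + \<alpha>\<^sup>2 * (norm \<xi>)\<^sup>2) * (cmod (fourier_L2 f \<xi>))\<^sup>2)"
    and "(H1_norm \<alpha> f)\<^sup>2 = (1 / (2 * pi) ^ CARD('n)) * (LINT \<xi>|lborel. (1 + \<alpha>\<^sup>2 * (norm \<xi>)\<^sup>2) * (cmod (fourier_L2 f \<xi>))\<^sup>2)"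
proof -
  note H = H1_weak_gradient[OF f]
  define g where "g = weak_gradient f"
  have g: "square_integrable g" "has_weak_gradient f g" using H by (auto simp: g_def)
  note gi = square_integrable_component[OF g(1)]
  define c where "c = 1 / (2 * pi) ^ CARD('n)"
  have pl: "(l2norm u)\<^sup>2 = c * (l2norm (fourier_L2 u))\<^sup>2" if "square_integrable u" for u :: "real^'n \<Rightarrow> complex"
    unfolding l2norm_fourier_L2[OF that] by (simp add: c_def power_mult_distrib)
  note F = fourier_L2_spec(1)[OF H(1)]
  note [measurable] = square_integrableD(1)[OF F] square_integrableD(1)[OF fourier_L2_spec(1)[OF gi]]
  have AEi: "AE \<xi> in lborel. (cmod (fourier_L2 (\<lambda>x. g x $ i) \<xi>))\<^sup>2 = (\<xi> $ i)\<^sup>2 * (cmod (fourier_L2 f \<xi>))\<^sup>2" for i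
    using fourier_L2_weak_gradient[OF H(1) g, of i]
    by eventually_elim (simp add: norm_mult power_mult_distrib)
  have inti: "integrable lborel (\<lambda>\<xi>. (\<xi> $ i)\<^sup>2 * (cmod (fourier_L2 f \<xi>))\<^sup>2)" for i
    by (rule integrable_cong_AE_imp[OF square_integrableD(2)[OF fourier_L2_spec(1)[OF gi, of i]]])
       (use AEi[of i] in auto)
  have eqi: "(l2norm (\<lambda>x. g x $ i))\<^sup>2 = c * (LINT \<xi>|lborel. (\<xi> $ i)\<^sup>2 * (cmod (fourier_L2 f \<xi>))\<^sup>2)" for i
    unfolding pl[OF gi] unfolding l2norm_power2 by (intro arg_cong2[where f = "(*)"] refl integral_cong_AE AEi) auto
  have int2: "integrable lborel (\<lambda>\<xi>. (norm \<xi>)\<^sup>2 * (cmod (fourier_L2 f \<xi>))\<^sup>2)"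
    unfolding norm_vec_real_power2 sum_distrib_right by (intro Bochner_Integration.integrable_sum inti)
  note int1 = square_integrableD(2)[OF F]
  show "integrable lborel (\<lambda>\<xi>. (1 + \<alpha>\<^sup>2 * (norm \<xi>)\<^sup>2) * (cmod (fourier_L2 f \<xi>))\<^sup>2)"
    using int1 int2 by (simp add: distrib_right mult.assoc)
  have "(LINT x|lborel. (norm (g x))\<^sup>2) = (\<Sum>i\<in>UNIV. (l2norm (\<lambda>x. g x $ i))\<^sup>2)"
    unfolding norm_vec_power2 l2norm_power2
    by (rule Bochner_Integration.integral_sum) (rule square_integrableD(2)[OF gi])
  also have "\<dots> = c * (LINT \<xi>|lborel. (norm \<xi>)\<^sup>2 * (cmod (fourier_L2 f \<xi>))\<^sup>2)"
    unfolding eqi norm_vec_real_power2 sum_distrib_right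
    by (subst Bochner_Integration.integral_sum) (auto simp: inti sum_distrib_left)
  finally have grad: "(LINT x|lborel. (norm (g x))\<^sup>2) = c * (LINT \<xi>|lborel. (norm \<xi>)\<^sup>2 * (cmod (fourier_L2 f \<xi>))\<^sup>2)" .
  have "(H1_norm \<alpha> f)\<^sup>2 = (l2norm f)\<^sup>2 + \<alpha>\<^sup>2 * (LINT x|lborel. (norm (g x))\<^sup>2)"
    by (simp add: H1_norm_def l2norm_power2 g_def)
  also have "\<dots> = c * (LINT \<xi>|lborel. (1 + \<alpha>\<^sup>2 * (norm \<xi>)\<^sup>2) * (cmod (fourier_L2 f \<xi>))\<^sup>2)"
    unfolding grad pl[OF H(1)] unfolding l2norm_power2 using int1 int2 by (simp add: distrib_right distrib_left mult.assoc mult.left_commute)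
  finally show "(H1_norm \<alpha> f)\<^sup>2 = (1 / (2 * pi) ^ CARD('n)) * (LINT \<xi>|lborel. (1 + \<alpha>\<^sup>2 * (norm \<xi>)\<^sup>2) * (cmod (fourier_L2 f \<xi>))\<^sup>2)"
    by (simp add: c_def)
qed

text \<open>Stated for every \<open>f\<close>, since the gradient term is nonnegative whatever is
  chosen. It can thus be applied to difference quotients of a solution without first showing that
  they lie in \<open>H1\<close>.\<close>

lemma l2norm_le_H1_norm: "l2norm f \<le> H1_norm \<alpha> f"
  by (simp add: l2norm_def H1_norm_def)

section \<open>The equation in Fourier space\<close>

text \<open>A second-order remainder bound that is monotone in |x|. With x = m \<xi> (r - s) and m
  \<le> M it becomes uniform in the frequency.\<close>

lemma exp_minus_one_minus_self_bound:
  fixes x :: real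
  shows "\<bar>exp x - 1 - x\<bar> \<le> \<bar>x\<bar> * (exp \<bar>x\<bar> - 1)"
proof -
  have "0 \<le> exp x - 1 - x" using exp_ge_add_one_self[of x] by linarith
  moreover have "exp x - 1 - x \<le> x * (exp x - 1)"
  proof -
    have "(1 - x) * exp x \<le> exp (- x) * exp x"
      using exp_ge_add_one_self[of "- x"] by (intro mult_right_mono) auto
    also have "\<dots> = 1" by (simp flip: exp_add)
    finally show ?thesis by (simp add: algebra_simps)
  qed
  moreover have "x * (exp x - 1) \<le> \<bar>x\<bar> * (exp \<bar>x\<bar> - 1)"
  proof (cases "x \<ge> 0")
    case False
    have "1 - exp x \<le> exp (- x) - 1"
      using exp_ge_add_one_self[of x] exp_ge_add_one_self[of "- x"] by linarith
    then have "(- x) * (1 - exp x) \<le> (- x) * (exp (- x) - 1)"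
      using False by (intro mult_left_mono) auto
    then show ?thesis using False by (simp add: algebra_simps)
  qed simp
  ultimately show ?thesis by linarith
qed

text \<open>The derivative exists only in norm: at a fixed frequency the values of \<open>U\<close>
  need not be differentiable in time. The argument therefore runs through a scalar function of time.
  The bound on \<open>m\<close> makes exp (m s) a bounded multiplier for each s, which keeps
  \<open>W\<close> in L^2.\<close>

lemma L2_linear_ode:
  fixes U :: "real \<Rightarrow> 'a::euclidean_space \<Rightarrow> complex" and m :: "'a \<Rightarrow> real"
  assumes U: "\<And>t. t \<ge> 0 \<Longrightarrow> square_integrable (U t)"
    and m_meas [measurable]: "m \<in> borel_measurable borel" and m: "\<And>\<xi>. 0 \<le> m \<xi>" "\<And>\<xi>. m \<xi> \<le> M"
    and cont: "((\<lambda>s. l2norm (\<lambda>\<xi>. U s \<xi> - U 0 \<xi>)) \<longlongrightarrow> 0) (at 0 within {0..})"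
    and deriv: "\<And>t. t > 0 \<Longrightarrow> ((\<lambda>s. l2norm (\<lambda>\<xi>. (U s \<xi> - U t \<xi>) / of_real (s - t) + of_real (m \<xi>) * U t \<xi>)) \<longlongrightarrow> 0) (at t)"
    and t: "t \<ge> 0"
  shows "AE \<xi> in lborel. U t \<xi> = of_real (exp (- (m \<xi> * t))) * U 0 \<xi>"
proof -
  have M0: "0 \<le> M" using m[of undefined] by linarith
  \<comment> \<open>The integrating factor turns the equation into \<open>W' = 0\<close>, so \<open>norm (W t - W 0)\<close> has derivative \<open>0\<close>.\<close>
  define W where "W t \<xi> = complex_of_real (exp (m \<xi> * t)) * U t \<xi>" for t \<xi>
  have expm: "exp (m \<xi> * s) \<le> exp (M * s)" if "s \<ge> 0" for \<xi> s
    using m that by (simp add: mult_right_mono)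
  have expm': "cmod (complex_of_real (exp (m \<xi> * s))) \<le> exp (M * s)" if "s \<ge> 0" for \<xi> s
    using expm[OF that] by (simp del: of_real_exp)
  have mult: "square_integrable (\<lambda>\<xi>. of_real (exp (m \<xi> * s)) * u \<xi>)" "l2norm (\<lambda>\<xi>. of_real (exp (m \<xi> * s)) * u \<xi>) \<le> exp (M * s) * l2norm u"
    if "s \<ge> 0" "square_integrable u" for s and u :: "'a \<Rightarrow> complex"
    by (rule bounded_multiplier[OF that(2) _ expm'[OF that(1)]]; measurable)+
  have W: "square_integrable (W s)" if "s \<ge> 0" for s
    unfolding W_def[abs_def] by (intro mult U that)
  define \<phi> where "\<phi> s = l2norm (\<lambda>\<xi>. W s \<xi> - W 0 \<xi>)" for s
  have \<phi>_diff: "\<bar>\<phi> s - \<phi> r\<bar> \<le> l2norm (\<lambda>\<xi>. W s \<xi> - W r \<xi>)" if "s \<ge> 0" "r \<ge> 0" for s r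
    using l2norm_diff_le[OF square_integrable_diff[OF W W] square_integrable_diff[OF W W], OF that(1) order_refl that(2) order_refl]
    by (simp add: \<phi>_def)
  have d\<phi>: "(\<phi> has_real_derivative 0) (at r)" if r: "r > 0" for r
    unfolding has_field_derivative_iff
  proof (rule Lim_null_comparison)
    let ?\<delta> = "\<lambda>s \<xi>. (U s \<xi> - U r \<xi>) / of_real (s - r) + of_real (m \<xi>) * U r \<xi>"
    \<comment> \<open>The first term is the error in the difference quotient of \<open>U\<close>,
      the second that of the integrating factor.\<close>
    let ?B = "\<lambda>s. exp (M * s) * l2norm (?\<delta> s) + (exp (M * s) * M * (exp (M * \<bar>s - r\<bar>) - 1)) * l2norm (U r)"
    have "(?B \<longlongrightarrow> exp (M * r) * 0 + (exp (M * r) * M * (exp (M * \<bar>r - r\<bar>) - 1)) * l2norm (U r)) (at r)"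
      by (intro tendsto_intros deriv r)
    then show "(?B \<longlongrightarrow> 0) (at r)" by simp
    have "norm ((\<phi> s - \<phi> r) / (s - r)) \<le> ?B s" if s: "s > 0" "s \<noteq> r" for s
    proof -
      have Us: "square_integrable (U s)" "square_integrable (U r)" using U s r by auto
      have mM: "cmod (complex_of_real (m \<xi>)) \<le> M" for \<xi> using m[of \<xi>] by simp
      have "square_integrable (\<lambda>\<xi>. (1 / of_real (s - r)) * (U s \<xi> - U r \<xi>) + of_real (m \<xi>) * U r \<xi>)"
        by (intro square_integrable_add square_integrable_cmult square_integrable_diff Us bounded_multiplier(1)[OF Us(2) _ mM]) measurable
      then have \<delta>: "square_integrable (?\<delta> s)" by simp
      \<comment> \<open>The derivative of the integrating factor is taken at \<open>s\<close>, not
        at \<open>r\<close>: this matches the factor exp (m s) in front of the quotient of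
        \<open>U\<close>, so the terms with \<open>m\<close> cancel exactly.\<close>
      let ?k = "\<lambda>\<xi>. (exp (m \<xi> * s) - exp (m \<xi> * r)) / (s - r) - m \<xi> * exp (m \<xi> * s)"
      have k: "cmod (complex_of_real (?k \<xi>)) \<le> exp (M * s) * M * (exp (M * \<bar>s - r\<bar>) - 1)" for \<xi>
      proof -
        let ?x = "m \<xi> * (r - s)"
        have "exp (m \<xi> * r) = exp (m \<xi> * s) * exp ?x" by (simp add: algebra_simps flip: exp_add)
        then have "?k \<xi> = - (exp (m \<xi> * s) * (exp ?x - 1 - ?x)) / (s - r)"
          using s by (simp add: field_simps)
        then have "\<bar>?k \<xi>\<bar> = exp (m \<xi> * s) * \<bar>exp ?x - 1 - ?x\<bar> / \<bar>s - r\<bar>"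
          by (simp add: abs_mult)
        also have "\<dots> \<le> exp (M * s) * (\<bar>?x\<bar> * (exp \<bar>?x\<bar> - 1)) / \<bar>s - r\<bar>"
          using s expm[of s \<xi>] exp_minus_one_minus_self_bound[of ?x]
          by (intro divide_right_mono mult_mono) auto
        also have "\<dots> \<le> exp (M * s) * ((M * \<bar>s - r\<bar>) * (exp (M * \<bar>s - r\<bar>) - 1)) / \<bar>s - r\<bar>"
        proof -
          have "\<bar>?x\<bar> \<le> M * \<bar>s - r\<bar>"
            using m[of \<xi>] by (simp add: abs_mult abs_minus_commute mult_right_mono)
          then show ?thesis by (intro divide_right_mono mult_left_mono mult_mono) (use M0 in auto)
        qed
        also have "\<dots> = exp (M * s) * M * (exp (M * \<bar>s - r\<bar>) - 1)"
          using s by simp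
        finally show ?thesis by (simp only: norm_of_real)
      qed
      have kU: "square_integrable (\<lambda>\<xi>. of_real (?k \<xi>) * U r \<xi>)"
         "l2norm (\<lambda>\<xi>. of_real (?k \<xi>) * U r \<xi>) \<le> (exp (M * s) * M * (exp (M * \<bar>s - r\<bar>) - 1)) * l2norm (U r)"
        by (rule bounded_multiplier[OF Us(2) _ k]; measurable)+
      have "(1 / of_real (s - r)) * (W s \<xi> - W r \<xi>) = of_real (exp (m \<xi> * s)) * ?\<delta> s \<xi> + of_real (?k \<xi>) * U r \<xi>" for \<xi>
      proof -
        have alg: "(1 / h) * (a * x - b * y) = a * ((x - y) / h + c * y) + ((a - b) / h - c * a) * y" for a b c h x y :: complex
          by (simp add: diff_divide_distrib algebra_simps)
        show ?thesis unfolding W_def of_real_diff[of "_ / _"] of_real_divide[of "_ - _"] of_real_mult[of "m \<xi>"] of_real_diff[of "exp _"]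
          by (rule alg)
      qed
      then have "l2norm (\<lambda>\<xi>. (1 / of_real (s - r)) * (W s \<xi> - W r \<xi>)) \<le> l2norm (\<lambda>\<xi>. of_real (exp (m \<xi> * s)) * ?\<delta> s \<xi>) + l2norm (\<lambda>\<xi>. of_real (?k \<xi>) * U r \<xi>)"
        using l2norm_triangle[OF mult(1)[OF _ \<delta>, of s] kU(1)] s by simp
      also have "\<dots> \<le> ?B s"
        using mult(2)[OF _ \<delta>, of s] kU(2) s by linarith
      finally have "l2norm (\<lambda>\<xi>. (1 / of_real (s - r)) * (W s \<xi> - W r \<xi>)) \<le> ?B s" .
      moreover have "l2norm (\<lambda>\<xi>. (1 / of_real (s - r)) * (W s \<xi> - W r \<xi>)) = l2norm (\<lambda>\<xi>. W s \<xi> - W r \<xi>) / \<bar>s - r\<bar>"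
        unfolding l2norm_cmult by (simp add: norm_divide del: of_real_diff)
      moreover have "norm ((\<phi> s - \<phi> r) / (s - r)) \<le> l2norm (\<lambda>\<xi>. W s \<xi> - W r \<xi>) / \<bar>s - r\<bar>"
        using \<phi>_diff[of s r] s r by (simp add: divide_right_mono)
      ultimately show ?thesis by linarith
    qed
    moreover have "\<forall>\<^sub>F s in at r. s > 0 \<and> s \<noteq> r"
      using eventually_at_in_open[of "{0<..}" r] r by (auto elim: eventually_mono)
    ultimately show "\<forall>\<^sub>F s in at r. norm ((\<phi> s - \<phi> r) / (s - r)) \<le> ?B s"
      by (auto elim: eventually_mono)
  qed
  \<comment> \<open>The equation is given for positive times only; continuity at 0 is what links the
    constant to the initial value.\<close>
  have c0: "(\<phi> \<longlongrightarrow> \<phi> 0) (at 0 within {0..})"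
  proof (rule LIM_zero_cancel, rule Lim_null_comparison)
    let ?B = "\<lambda>s. exp (M * s) * l2norm (\<lambda>\<xi>. U s \<xi> - U 0 \<xi>) + (exp (M * s) - 1) * l2norm (U 0)"
    have "(?B \<longlongrightarrow> exp (M * 0) * 0 + (exp (M * 0) - 1) * l2norm (U 0)) (at 0 within {0..})"
      by (intro tendsto_intros cont)
    then show "(?B \<longlongrightarrow> 0) (at 0 within {0..})" by simp
    have "norm (\<phi> s - \<phi> 0) \<le> ?B s" if s: "s \<ge> 0" for s
    proof -
      have U0: "square_integrable (U 0)" "square_integrable (\<lambda>\<xi>. U s \<xi> - U 0 \<xi>)"
        using U s by (auto intro: square_integrable_diff)
      have "cmod (complex_of_real (exp (m \<xi> * s) - 1)) \<le> exp (M * s) - 1" for \<xi>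
        using expm[OF s, of \<xi>] m[of \<xi>] s by (simp del: of_real_exp of_real_diff add: abs_of_nonneg)
      note e = bounded_multiplier[OF U0(1) _ this]
      have e1: "square_integrable (\<lambda>\<xi>. of_real (exp (m \<xi> * s) - 1) * U 0 \<xi>)"
         "l2norm (\<lambda>\<xi>. of_real (exp (m \<xi> * s) - 1) * U 0 \<xi>) \<le> (exp (M * s) - 1) * l2norm (U 0)"
        by (rule e; measurable)+
      have "W s \<xi> - W 0 \<xi> = of_real (exp (m \<xi> * s)) * (U s \<xi> - U 0 \<xi>) + of_real (exp (m \<xi> * s) - 1) * U 0 \<xi>" for \<xi>
        by (simp add: W_def algebra_simps)
      then have "l2norm (\<lambda>\<xi>. W s \<xi> - W 0 \<xi>) \<le> ?B s"
        using l2norm_triangle[OF mult(1)[OF s U0(2)] e1(1)] mult(2)[OF s U0(2)] e1(2) by simp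
      then show ?thesis using \<phi>_diff[OF s, of 0] by simp
    qed
    then show "\<forall>\<^sub>F s in at 0 within {0..}. norm (\<phi> s - \<phi> 0) \<le> ?B s"
      by (auto simp: eventually_at_filter)
  qed
  have "\<phi> t = \<phi> 0"
  proof (cases "t = 0")
    case False
    show ?thesis
    proof (rule DERIV_isconst_end[where f = \<phi> and a = 0 and b = t])
      show "0 < t" using t False by simp
      have "continuous (at s within {0..t}) \<phi>" if "s \<in> {0..t}" for s
      proof (cases "s = 0")
        case True
        then show ?thesis using tendsto_within_subset[OF c0, of "{0..t}"] by (simp add: continuous_within)
      next
        case False
        with that show ?thesis using DERIV_isCont[OF d\<phi>[of s]] continuous_at_imp_continuous_at_within by auto
      qed
      then show "continuous_on {0..t} \<phi>" by (simp add: continuous_on_eq_continuous_within)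
    qed (rule d\<phi>)
  qed simp
  also have "\<phi> 0 = 0" by (simp add: \<phi>_def l2norm_def)
  finally have "AE \<xi> in lborel. W t \<xi> - W 0 \<xi> = 0"
    using l2norm_eq_0_iff[OF square_integrable_diff[OF W W], of t 0] t by (simp add: \<phi>_def)
  then show ?thesis
  proof eventually_elim
    case (elim \<xi>)
    then have "of_real (exp (- (m \<xi> * t))) * (of_real (exp (m \<xi> * t)) * U t \<xi>) = of_real (exp (- (m \<xi> * t))) * U 0 \<xi>"
      by (simp add: W_def)
    moreover have "complex_of_real (exp (- (m \<xi> * t))) * of_real (exp (m \<xi> * t)) = 1"
      by (simp add: exp_minus)
    ultimately show ?case by (metis mult.assoc mult_1)
  qed
qed

text \<open>The formula is proved for every curve that satisfies the weak formulation, so it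
  contains uniqueness of solutions.\<close>

lemma linear_solution_fourier:
  fixes v0 :: "real^'n \<Rightarrow> complex" and v :: "real \<Rightarrow> real^'n \<Rightarrow> complex"
  assumes \<alpha>: "\<alpha> > 0" and \<nu>: "\<nu> > 0" and v0: "v0 \<in> H1" and sol: "linear_solution \<alpha> \<nu> v0 v" and t: "t \<ge> 0"
  shows "AE \<xi> in lborel. fourier_L2 (v t) \<xi> =
    of_real (exp (- (\<nu> * (norm \<xi>)\<^sup>2 / (1 + \<alpha>\<^sup>2 * (norm \<xi>)\<^sup>2) * t))) * fourier_L2 v0 \<xi>"
proof -
  define m where "m \<xi> = \<nu> * (norm \<xi>)\<^sup>2 / (1 + \<alpha>\<^sup>2 * (norm \<xi>)\<^sup>2)" for \<xi> :: "real^'n"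
  have den: "1 + \<alpha>\<^sup>2 * (norm \<xi>)\<^sup>2 > 0" for \<xi> :: "real^'n" by (simp add: add_pos_nonneg)
  have m0: "0 \<le> m \<xi>" for \<xi> using \<nu> den[of \<xi>] by (simp add: m_def)
  have mM: "m \<xi> \<le> \<nu> / \<alpha>\<^sup>2" for \<xi>
    using \<nu> \<alpha> den[of \<xi>] by (simp add: m_def field_simps)
  have m_meas: "m \<in> borel_measurable borel" unfolding m_def[abs_def] by measurable
  have H: "v t \<in> H1" if "t \<ge> 0" for t using sol that by (auto simp: linear_solution_def)
  have sq: "square_integrable (v t)" if "t \<ge> 0" for t using H1_weak_gradient[OF H[OF that]] by blast
  let ?K = "sqrt ((2 * pi) ^ CARD('n))"
  define U where "U t = fourier_L2 (v t)" for t
  have U: "square_integrable (U t)" if "t \<ge> 0" for t unfolding U_def by (rule fourier_L2_spec(1)[OF sq[OF that]])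
  \<comment> \<open>Plancherel for differences; linearity almost everywhere is all that
    \<open>l2norm\<close> sees.\<close>
  have Udiff: "l2norm (\<lambda>\<xi>. fourier_L2 f \<xi> - fourier_L2 g \<xi>) = ?K * l2norm (\<lambda>x. f x - g x)"
    if "square_integrable f" "square_integrable g" for f g :: "real^'n \<Rightarrow> complex"
  proof -
    note F = fourier_L2_spec(1)[OF that(1)] fourier_L2_spec(1)[OF that(2)]
    note D = square_integrable_diff[OF that]
    have "l2norm (\<lambda>\<xi>. fourier_L2 f \<xi> - fourier_L2 g \<xi>) = l2norm (fourier_L2 (\<lambda>x. f x - g x))"
    proof (rule l2norm_cong_AE)
      show "AE \<xi> in lborel. fourier_L2 f \<xi> - fourier_L2 g \<xi> = fourier_L2 (\<lambda>x. f x - g x) \<xi>"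
        using fourier_L2_lincomb[OF that, of 1 "-1"] by auto
    qed (use square_integrableD(1)[OF square_integrable_diff[OF F]] square_integrableD(1)[OF fourier_L2_spec(1)[OF D]] in auto)
    then show ?thesis by (simp add: l2norm_fourier_L2[OF D])
  qed
  have cont: "((\<lambda>s. l2norm (\<lambda>\<xi>. U s \<xi> - U 0 \<xi>)) \<longlongrightarrow> 0) (at 0 within {0..})"
  proof (rule Lim_null_comparison)
    have "((\<lambda>s. H1_norm \<alpha> (\<lambda>x. v s x - v 0 x)) \<longlongrightarrow> 0) (at 0 within {0..})"
      using sol by (auto simp: linear_solution_def)
    then show "((\<lambda>s. ?K * H1_norm \<alpha> (\<lambda>x. v s x - v 0 x)) \<longlongrightarrow> 0) (at 0 within {0..})"
      by (rule tendsto_mult_right_zero)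
    have "norm (l2norm (\<lambda>\<xi>. U s \<xi> - U 0 \<xi>)) \<le> ?K * H1_norm \<alpha> (\<lambda>x. v s x - v 0 x)" if "s \<ge> 0" for s
      unfolding U_def Udiff[OF sq[OF that] sq[OF order_refl]]
      using mult_left_mono[OF l2norm_le_H1_norm[of "\<lambda>x. v s x - v 0 x" \<alpha>], of ?K] by simp
    then show "\<forall>\<^sub>F s in at 0 within {0..}. norm (l2norm (\<lambda>\<xi>. U s \<xi> - U 0 \<xi>)) \<le> ?K * H1_norm \<alpha> (\<lambda>x. v s x - v 0 x)"
      by (auto simp: eventually_at_filter)
  qed
  have deriv: "((\<lambda>s. l2norm (\<lambda>\<xi>. (U s \<xi> - U t \<xi>) / of_real (s - t) + of_real (m \<xi>) * U t \<xi>)) \<longlongrightarrow> 0) (at t)"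
    if t: "t > 0" for t
  proof -
    obtain w where w: "has_H1_time_derivative \<alpha> v w t"
      and weak: "\<And>\<phi>. test_function \<phi> \<Longrightarrow>
           (LINT x|lborel. w x * \<phi> x)
           + complex_of_real (\<alpha>\<^sup>2) *
               (LINT x|lborel. (\<Sum>i\<in>UNIV. weak_gradient w x $ i * partial_deriv i \<phi> x))
           + complex_of_real \<nu> *
               (LINT x|lborel. (\<Sum>i\<in>UNIV. weak_gradient (v t) x $ i * partial_deriv i \<phi> x)) = 0"
      using sol t unfolding linear_solution_def by blast
    have wH: "w \<in> H1" using w by (simp add: has_H1_time_derivative_def)
    note W = H1_weak_gradient[OF wH] and V = H1_weak_gradient[OF H[OF less_imp_le[OF t]]]
    note Wi = square_integrable_component[OF W(2)] and Vi = square_integrable_component[OF V(2)]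
    \<comment> \<open>The flux \<alpha>^2 grad w + \<nu> grad v, for which the equation reads w =
      div q.\<close>
    let ?q = "\<lambda>i x. complex_of_real (\<alpha>\<^sup>2) * weak_gradient w x $ i + complex_of_real \<nu> * weak_gradient (v t) x $ i"
    have q: "square_integrable (?q i)" for i
      by (intro square_integrable_add square_integrable_cmult Wi Vi)
    have div: "AE \<xi> in lborel. fourier_L2 w \<xi> = (\<Sum>i\<in>UNIV. \<i> * of_real (\<xi> $ i) * fourier_L2 (?q i) \<xi>)"
    proof (rule fourier_L2_weak_divergence[OF W(1) q])
      fix R :: real and \<xi> :: "real^'n"
      assume R: "R > 0"
      let ?\<phi> = "wave_cutoff R \<xi>"
      note iW = integrable_mult_partial_wave_cutoff[OF Wi R] and iV = integrable_mult_partial_wave_cutoff[OF Vi R]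
      have "(\<Sum>i\<in>UNIV. (LINT x|lborel. ?q i x * partial_deriv i ?\<phi> x)) =
        complex_of_real (\<alpha>\<^sup>2) * (LINT x|lborel. (\<Sum>i\<in>UNIV. weak_gradient w x $ i * partial_deriv i ?\<phi> x))
        + complex_of_real \<nu> * (LINT x|lborel. (\<Sum>i\<in>UNIV. weak_gradient (v t) x $ i * partial_deriv i ?\<phi> x))"
        using iW iV
        by (simp add: Bochner_Integration.integral_sum sum_distrib_left distrib_right mult.assoc sum.distrib del: of_real_power)
      then show "(LINT x|lborel. w x * ?\<phi> x) + (\<Sum>i\<in>UNIV. (LINT x|lborel. ?q i x * partial_deriv i ?\<phi> x)) = 0"
        using weak[OF wave_cutoff_test_function[OF R, of \<xi>]] by (simp add: add.assoc del: of_real_power)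
    qed
    have "AE \<xi> in lborel. \<forall>i. fourier_L2 (?q i) \<xi> = complex_of_real (\<alpha>\<^sup>2) * (\<i> * of_real (\<xi> $ i) * fourier_L2 w \<xi>) + complex_of_real \<nu> * (\<i> * of_real (\<xi> $ i) * U t \<xi>)"
    proof (subst AE_all_countable, intro allI)
      fix i
      show "AE \<xi> in lborel. fourier_L2 (?q i) \<xi> = complex_of_real (\<alpha>\<^sup>2) * (\<i> * of_real (\<xi> $ i) * fourier_L2 w \<xi>) + complex_of_real \<nu> * (\<i> * of_real (\<xi> $ i) * U t \<xi>)"
        using fourier_L2_lincomb[OF Wi Vi, of "complex_of_real (\<alpha>\<^sup>2)" i "complex_of_real \<nu>" i]
          fourier_L2_weak_gradient[OF W, of i] fourier_L2_weak_gradient[OF V, of i]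
        by eventually_elim (simp add: U_def)
    qed
    with div have w_eq: "AE \<xi> in lborel. fourier_L2 w \<xi> = - of_real (m \<xi>) * U t \<xi>"
    proof eventually_elim
      case (elim \<xi>)
      let ?w = "fourier_L2 w \<xi>" and ?u = "U t \<xi>"
      have "?w = (\<Sum>i\<in>UNIV. \<i> * of_real (\<xi> $ i) * fourier_L2 (?q i) \<xi>)"
        by (rule elim(1))
      \<comment> \<open>Divergence and gradient each contribute a factor \<i> times the coordinate;
        summed, they give the symbol of the Laplacian.\<close>
      also have "\<dots> = (\<Sum>i\<in>UNIV. - of_real ((\<xi> $ i)\<^sup>2) * (of_real (\<alpha>\<^sup>2) * ?w + of_real \<nu> * ?u))"
      proof (intro sum.cong refl)
        fix i
        show "\<i> * of_real (\<xi> $ i) * fourier_L2 (?q i) \<xi> = - of_real ((\<xi> $ i)\<^sup>2) * (of_real (\<alpha>\<^sup>2) * ?w + of_real \<nu> * ?u)"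
          by (subst elim(2)[rule_format]) (simp add: power2_eq_square algebra_simps)
      qed
      also have "\<dots> = - of_real ((norm \<xi>)\<^sup>2) * (of_real (\<alpha>\<^sup>2) * ?w + of_real \<nu> * ?u)"
        unfolding norm_vec_real_power2 of_real_sum sum_negf[symmetric] sum_distrib_right ..
      finally have "of_real (1 + \<alpha>\<^sup>2 * (norm \<xi>)\<^sup>2) * ?w = - of_real (\<nu> * (norm \<xi>)\<^sup>2) * ?u"
        by (simp add: algebra_simps)
      then have "of_real (1 + \<alpha>\<^sup>2 * (norm \<xi>)\<^sup>2) * ?w = of_real (1 + \<alpha>\<^sup>2 * (norm \<xi>)\<^sup>2) * (- of_real (m \<xi>) * ?u)"
      proof -
        have "\<nu> * (norm \<xi>)\<^sup>2 = (1 + \<alpha>\<^sup>2 * (norm \<xi>)\<^sup>2) * m \<xi>" using den[of \<xi>] by (simp add: m_def)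
        then show ?thesis
          using \<open>of_real (1 + \<alpha>\<^sup>2 * (norm \<xi>)\<^sup>2) * ?w = - of_real (\<nu> * (norm \<xi>)\<^sup>2) * ?u\<close>
          by (simp only: of_real_mult mult_minus_left mult_minus_right mult.assoc)
      qed
      moreover have "complex_of_real (1 + \<alpha>\<^sup>2 * (norm \<xi>)\<^sup>2) \<noteq> 0" using den[of \<xi>] by (simp only: of_real_eq_0_iff)
      ultimately show ?case by (metis mult_left_cancel)
    qed
    have lim: "((\<lambda>s. H1_norm \<alpha> (\<lambda>x. (v s x - v t x) / complex_of_real (s - t) - w x)) \<longlongrightarrow> 0) (at t)"
      using w by (simp add: has_H1_time_derivative_def)
    show ?thesis
    proof (rule Lim_null_comparison)
      show "((\<lambda>s. ?K * H1_norm \<alpha> (\<lambda>x. (v s x - v t x) / complex_of_real (s - t) - w x)) \<longlongrightarrow> 0) (at t)"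
        by (rule tendsto_mult_right_zero[OF lim])
      have "l2norm (\<lambda>\<xi>. (U s \<xi> - U t \<xi>) / of_real (s - t) + of_real (m \<xi>) * U t \<xi>) \<le> ?K * H1_norm \<alpha> (\<lambda>x. (v s x - v t x) / complex_of_real (s - t) - w x)"
        if s: "s > 0" for s
      proof -
        define c where "c = 1 / complex_of_real (s - t)"
        have c: "y / complex_of_real (s - t) = c * y" for y by (simp add: c_def)
        have Vs: "square_integrable (v s)" "square_integrable (v t)" using sq s t by auto
        let ?d = "\<lambda>x. c * v s x + (- c) * v t x"
        have d: "square_integrable ?d" by (intro square_integrable_add square_integrable_cmult Vs)
        have dw: "square_integrable (\<lambda>x. ?d x - w x)" by (intro square_integrable_diff d W(1))
        have "square_integrable (\<lambda>\<xi>. c * (U s \<xi> - U t \<xi>) + of_real (m \<xi>) * U t \<xi>)"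
          using U s t m0 mM m_meas
          by (intro square_integrable_add square_integrable_cmult square_integrable_diff bounded_multiplier(1)[where M = "\<nu> / \<alpha>\<^sup>2"]) auto
        note meas = square_integrableD(1)[OF this] 
        have "l2norm (\<lambda>\<xi>. c * (U s \<xi> - U t \<xi>) + of_real (m \<xi>) * U t \<xi>) = l2norm (\<lambda>\<xi>. fourier_L2 ?d \<xi> - fourier_L2 w \<xi>)"
        proof (rule l2norm_cong_AE[OF meas])
          show "(\<lambda>\<xi>. fourier_L2 ?d \<xi> - fourier_L2 w \<xi>) \<in> borel_measurable borel"
            by (rule square_integrableD(1)[OF square_integrable_diff[OF fourier_L2_spec(1)[OF d] fourier_L2_spec(1)[OF W(1)]]])
          show "AE \<xi> in lborel. c * (U s \<xi> - U t \<xi>) + of_real (m \<xi>) * U t \<xi> = fourier_L2 ?d \<xi> - fourier_L2 w \<xi>"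
            using fourier_L2_lincomb[OF Vs, of c "- c"] w_eq
            by eventually_elim (simp add: U_def algebra_simps)
        qed
        also have "\<dots> = ?K * l2norm (\<lambda>x. ?d x - w x)" by (rule Udiff[OF d W(1)])
        also have "\<dots> \<le> ?K * H1_norm \<alpha> (\<lambda>x. ?d x - w x)"
          by (intro mult_left_mono l2norm_le_H1_norm) simp
        finally show ?thesis unfolding c by (simp add: algebra_simps)
      qed
      moreover have "\<forall>\<^sub>F s in at t. s > 0"
        using eventually_at_in_open'[of "{0<..}" t] t by (auto elim: eventually_mono)
      ultimately show "\<forall>\<^sub>F s in at t. norm (l2norm (\<lambda>\<xi>. (U s \<xi> - U t \<xi>) / of_real (s - t) + of_real (m \<xi>) * U t \<xi>)) \<le> ?K * H1_norm \<alpha> (\<lambda>x. (v s x - v t x) / complex_of_real (s - t) - w x)"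
        by (auto elim: eventually_mono)
    qed
  qed
  have V0: "square_integrable v0" using v0 by (simp add: H1_def)
  have "AE x in lborel. v 0 x - v0 x = 0" using sol by (auto simp: linear_solution_def)
  then have "l2norm (\<lambda>x. v 0 x - v0 x) = 0"
    using l2norm_eq_0_iff[OF square_integrable_diff[OF sq[OF order_refl] V0]] by simp
  then have "l2norm (\<lambda>\<xi>. U 0 \<xi> - fourier_L2 v0 \<xi>) = 0"
    unfolding U_def Udiff[OF sq[OF order_refl] V0] by simp
  then have "AE \<xi> in lborel. U 0 \<xi> - fourier_L2 v0 \<xi> = 0"
    using l2norm_eq_0_iff[OF square_integrable_diff[OF U[OF order_refl] fourier_L2_spec(1)[OF V0]]] by simp
  moreover have "AE \<xi> in lborel. U t \<xi> = of_real (exp (- (m \<xi> * t))) * U 0 \<xi>"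
    by (rule L2_linear_ode[OF U m_meas m0 mM cont deriv t])
  ultimately show ?thesis by eventually_elim (simp add: U_def m_def)
qed

section \<open>Decay of the energy\<close>

text \<open>The inequality ln y \<le> y - 1 at y = b x / s yields the constant e^(-s) (s / b)^s, the
  maximum of x^s e^(-b x).\<close>

lemma powr_le_exp:
  fixes b s :: real
  assumes "b > 0" "s > 0"
  shows "\<exists>K>0. \<forall>x>0. x powr s \<le> K * exp (b * x)"
proof (intro exI conjI allI impI)
  show "exp (- s - s * ln (b / s)) > 0" by simp
  fix x :: real assume x: "x > 0"
  have "ln (b / s * x) \<le> b / s * x - 1" using assms x by (intro ln_le_minus_one) auto
  moreover have "ln (b / s * x) = ln (b / s) + ln x" using assms x by (subst ln_mult) auto
  ultimately have "ln x \<le> b / s * x - 1 - ln (b / s)" by linarith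
  then have "s * ln x \<le> s * (b / s * x - 1 - ln (b / s))" using assms by (intro mult_left_mono) auto
  also have "\<dots> = (- s - s * ln (b / s)) + b * x" using assms by (simp add: algebra_simps)
  finally show "x powr s \<le> exp (- s - s * ln (b / s)) * exp (b * x)"
    using x by (simp add: powr_def flip: exp_add)
qed

text \<open>\<open>F\<close> stands for the spectral density of the initial datum, including the
  Plancherel constant, and the last assumption for the finiteness of its H^1 norm. What remains is a
  statement about one nonnegative function.\<close>

locale spectral_energy =
  fixes \<alpha> \<nu> :: real and F :: "'a::euclidean_space \<Rightarrow> real"
  assumes \<alpha>: "\<alpha> > 0" and \<nu>: "\<nu> > 0" and F_nonneg: "\<And>\<xi>. 0 \<le> F \<xi>"
    and F_meas [measurable]: "F \<in> borel_measurable borel"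
    and F_int: "integrable lborel (\<lambda>\<xi>. (1 + \<alpha>\<^sup>2 * (norm \<xi>)\<^sup>2) * F \<xi>)"
begin

definition rate :: "'a \<Rightarrow> real" where
  "rate \<xi> = \<nu> * (norm \<xi>)\<^sup>2 / (1 + \<alpha>\<^sup>2 * (norm \<xi>)\<^sup>2)"

definition energy :: "real \<Rightarrow> real" where
  "energy t = (LINT \<xi>|lborel. (1 + \<alpha>\<^sup>2 * (norm \<xi>)\<^sup>2) * (exp (- (rate \<xi> * t)))\<^sup>2 * F \<xi>)"

definition low_mass :: "real \<Rightarrow> real" where
  "low_mass \<rho> = (LINT \<xi>|lborel. indicator (ball 0 \<rho>) \<xi> * F \<xi>)"

lemma den_pos: "0 < 1 + \<alpha>\<^sup>2 * (norm \<xi>)\<^sup>2" "1 \<le> 1 + \<alpha>\<^sup>2 * (norm \<xi>)\<^sup>2" for \<xi> :: 'a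
  by (simp_all add: add_pos_nonneg)

lemma rate_nonneg: "0 \<le> rate \<xi>"
  using \<nu> den_pos[of \<xi>] by (simp add: rate_def)

lemma rate_measurable [measurable]: "rate \<in> borel_measurable borel"
  unfolding rate_def[abs_def] by measurable

lemma ball_measurable [measurable]: "ball (0::'a) \<rho> \<in> sets borel"
  by simp

lemma F_integrable: "integrable lborel F"
proof (rule Bochner_Integration.integrable_bound[OF F_int])
  have "F \<xi> \<le> (1 + \<alpha>\<^sup>2 * (norm \<xi>)\<^sup>2) * F \<xi>" for \<xi>
    using mult_right_mono[OF den_pos(2)[of \<xi>] F_nonneg[of \<xi>]] by simp
  then show "AE \<xi> in lborel. norm (F \<xi>) \<le> norm ((1 + \<alpha>\<^sup>2 * (norm \<xi>)\<^sup>2) * F \<xi>)"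
    using F_nonneg den_pos(1) by (simp add: abs_mult abs_of_nonneg abs_of_pos)
qed measurable

lemma low_integrable: "integrable lborel (\<lambda>\<xi>. indicator (ball 0 \<rho>) \<xi> * F \<xi>)"
  by (rule Bochner_Integration.integrable_bound[OF F_integrable]) (auto simp: indicator_def)

lemma energy_integrable:
  assumes "t \<ge> 0"
  shows "integrable lborel (\<lambda>\<xi>. (1 + \<alpha>\<^sup>2 * (norm \<xi>)\<^sup>2) * (exp (- (rate \<xi> * t)))\<^sup>2 * F \<xi>)"
proof (rule Bochner_Integration.integrable_bound[OF F_int])
  have "(1 + \<alpha>\<^sup>2 * (norm \<xi>)\<^sup>2) * (exp (- (rate \<xi> * t)))\<^sup>2 * F \<xi> \<le> (1 + \<alpha>\<^sup>2 * (norm \<xi>)\<^sup>2) * 1 * F \<xi>" for \<xi>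
    using rate_nonneg[of \<xi>] assms F_nonneg[of \<xi>] den_pos[of \<xi>]
    by (intro mult_right_mono mult_left_mono) (auto simp: power_le_one)
  then show "AE \<xi> in lborel. norm ((1 + \<alpha>\<^sup>2 * (norm \<xi>)\<^sup>2) * (exp (- (rate \<xi> * t)))\<^sup>2 * F \<xi>) \<le> norm ((1 + \<alpha>\<^sup>2 * (norm \<xi>)\<^sup>2) * F \<xi>)"
    using F_nonneg den_pos(1) by (simp add: abs_mult abs_of_pos abs_of_nonneg)
qed measurable

text \<open>On a ball of radius comparable to (1 + t)^(-1/2) the product of rate and time stays
  bounded, so the exponential costs only a constant. The decay is that of the mass of the
  ball.\<close>

lemma energy_lower_bound:
  assumes "a > 0" "\<rho>0 > 0" and low: "\<And>\<rho>. 0 < \<rho> \<Longrightarrow> \<rho> < \<rho>0 \<Longrightarrow> a * \<rho> powr (2 * s) \<le> low_mass \<rho>"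
  shows "\<exists>C>0. \<forall>t>0. C * (1 + t) powr (- s) \<le> energy t"
proof (intro exI conjI allI impI)
  \<comment> \<open>Half of \<open>\<rho>0\<close> keeps the radius strictly inside the range of
    \<open>low\<close> at all times, including small ones.\<close>
  define \<delta> where "\<delta> = \<rho>0 / 2"
  have \<delta>: "\<delta> > 0" using assms by (simp add: \<delta>_def)
  let ?C = "exp (- (2 * \<nu> * \<delta>\<^sup>2)) * (a * \<delta> powr (2 * s))"
  show "?C > 0" using assms \<delta> by simp
  fix t :: real assume t: "t > 0"
  define \<rho> where "\<rho> = \<delta> * (1 + t) powr (- (1/2))"
  have \<rho>: "0 < \<rho>" "\<rho> < \<rho>0"
  proof -
    show "0 < \<rho>" using \<delta> t by (simp add: \<rho>_def)
    have "(1 + t) powr (- (1/2)) \<le> 1" using t by (simp add: powr_le_one_le powr_minus_divide ge_one_powr_ge_zero)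
    then have "\<rho> \<le> \<delta>" using \<delta> by (simp add: \<rho>_def mult_left_le)
    then show "\<rho> < \<rho>0" using assms by (simp add: \<delta>_def)
  qed
  have \<rho>2: "\<rho>\<^sup>2 * t \<le> \<delta>\<^sup>2"
  proof -
    have "((1 + t) powr (- (1/2)))\<^sup>2 = 1 / (1 + t)"
    proof -
      have "((1 + t) powr (- (1/2)))\<^sup>2 = (1 + t) powr (- 1)"
        by (simp add: power2_eq_square flip: powr_add)
      then show ?thesis using t by (simp add: powr_minus_divide)
    qed
    then have "\<rho>\<^sup>2 * t = \<delta>\<^sup>2 * (t / (1 + t))" by (simp add: \<rho>_def power_mult_distrib)
    also have "\<dots> \<le> \<delta>\<^sup>2 * 1" using t by (intro mult_left_mono) auto
    finally show ?thesis by simp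
  qed
  have "\<rho> powr (2 * s) = \<delta> powr (2 * s) * (1 + t) powr (- s)"
    using \<delta> t by (simp add: \<rho>_def powr_mult powr_powr)
  then have "?C * (1 + t) powr (- s) = exp (- (2 * \<nu> * \<delta>\<^sup>2)) * (a * \<rho> powr (2 * s))"
    by simp
  also have "\<dots> \<le> exp (- (2 * \<nu> * \<delta>\<^sup>2)) * low_mass \<rho>"
    using low[OF \<rho>] by simp
  also have "\<dots> = (LINT \<xi>|lborel. exp (- (2 * \<nu> * \<delta>\<^sup>2)) * (indicator (ball 0 \<rho>) \<xi> * F \<xi>))"
    by (simp add: low_mass_def)
  also have "\<dots> \<le> energy t"
    unfolding energy_def
  proof (rule integral_mono)
    fix \<xi> :: 'a
    show "exp (- (2 * \<nu> * \<delta>\<^sup>2)) * (indicator (ball 0 \<rho>) \<xi> * F \<xi>) \<le> (1 + \<alpha>\<^sup>2 * (norm \<xi>)\<^sup>2) * (exp (- (rate \<xi> * t)))\<^sup>2 * F \<xi>"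
    proof (cases "\<xi> \<in> ball 0 \<rho>")
      case True
      have "rate \<xi> \<le> \<nu> * (norm \<xi>)\<^sup>2 / 1"
        unfolding rate_def using \<nu> by (intro divide_left_mono mult_pos_pos den_pos) auto
      also have "\<dots> \<le> \<nu> * \<rho>\<^sup>2" using True \<nu> by (simp add: power_mono)
      finally have "rate \<xi> * t \<le> \<nu> * \<rho>\<^sup>2 * t" using t by simp
      also have "\<dots> \<le> \<nu> * \<delta>\<^sup>2" using \<rho>2 \<nu> by (simp add: mult.assoc)
      finally have "exp (- (2 * \<nu> * \<delta>\<^sup>2)) \<le> (exp (- (rate \<xi> * t)))\<^sup>2"
        by (simp add: power2_eq_square mult_ac flip: exp_add)
      also have "\<dots> \<le> (1 + \<alpha>\<^sup>2 * (norm \<xi>)\<^sup>2) * (exp (- (rate \<xi> * t)))\<^sup>2"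
        using mult_right_mono[OF den_pos(2)[of \<xi>], of "(exp (- (rate \<xi> * t)))\<^sup>2"] by simp
      finally show ?thesis using True F_nonneg[of \<xi>] by (simp add: mult_right_mono)
    next
      case False
      then show ?thesis using F_nonneg[of \<xi>] den_pos[of \<xi>] by simp
    qed
  qed (use low_integrable energy_integrable t in auto)
  finally show "?C * (1 + t) powr (- s) \<le> energy t" .
qed

text \<open>
  The integral is split into the shells \<open>j \<le> norm \<xi> * sqrt T < j + 1\<close>.
\<close>

lemma gaussian_moment_bound:
  assumes s: "s > 0" and a: "a \<ge> 0" and low: "\<And>\<rho>. 0 < \<rho> \<Longrightarrow> low_mass \<rho> \<le> a * \<rho> powr (2 * s)"
  shows "\<exists>C>0. \<forall>T>0. (LINT \<xi>|lborel. exp (- (\<nu> * (norm \<xi>)\<^sup>2 * T)) * F \<xi>) \<le> C * T powr (- s)"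
proof -
  \<comment> \<open>The first factor bounds the exponential on shell \<open>j\<close>; the second is
    the growth of the mass bound for the ball of radius (j + 1) / sqrt T.\<close>
  define c where "c j = exp (- (\<nu> * (real j)\<^sup>2)) * (real j + 1) powr (2 * s)" for j
  \<comment> \<open>As j \<le> j^2, the Gaussian is at most exp (- \<nu> j). Half of that rate
    absorbs the power of j + 1, the other half leaves a geometric series.\<close>
  obtain K where K: "K > 0" "\<And>x. x > 0 \<Longrightarrow> x powr (2 * s) \<le> K * exp (\<nu> / 2 * x)"
    using powr_le_exp[of "\<nu> / 2" "2 * s"] \<nu> s by auto
  have c_sum: "summable c"
  proof (rule summable_comparison_test'[where N = 0])
    show "summable (\<lambda>j. K * exp (\<nu> / 2) * exp (- (\<nu> / 2)) ^ j)"
      using \<nu> by (intro summable_mult summable_geometric) simp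
    fix j :: nat
    have "j \<le> j * j" by (cases j) auto
    then have "real j \<le> (real j)\<^sup>2" by (simp add: power2_eq_square flip: of_nat_mult)
    then have "exp (- (\<nu> * (real j)\<^sup>2)) \<le> exp (- (\<nu> * real j))" using \<nu> by simp
    then have "c j \<le> exp (- (\<nu> * real j)) * (K * exp (\<nu> / 2 * (real j + 1)))"
      unfolding c_def using K(2)[of "real j + 1"] by (intro mult_mono) auto
    also have "\<dots> = K * exp (\<nu> / 2) * exp (- (\<nu> / 2)) ^ j"
    proof -
      have "- (\<nu> * real j) + \<nu> / 2 * (real j + 1) = \<nu> / 2 + real j * (- (\<nu> / 2))" by (simp add: field_simps)
      then have "exp (- (\<nu> * real j)) * exp (\<nu> / 2 * (real j + 1)) = exp (\<nu> / 2) * exp (- (\<nu> / 2)) ^ j"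
        by (metis exp_add exp_of_nat_mult)
      then show ?thesis by (simp add: mult.left_commute mult.assoc)
    qed
    finally show "norm (c j) \<le> K * exp (\<nu> / 2) * exp (- (\<nu> / 2)) ^ j" by (simp add: c_def)
  qed
  have c_nonneg: "0 \<le> c j" for j by (simp add: c_def)
  show ?thesis
  proof (intro exI conjI allI impI)
    \<comment> \<open>The summand 1 keeps the constant positive when \<open>a\<close> is 0.\<close>
    show "a * suminf c + 1 > 0" using a suminf_nonneg[OF c_sum c_nonneg] by (simp add: add_nonneg_pos)
    fix T :: real assume T: "T > 0"
    let ?\<rho> = "\<lambda>j. (real j + 1) / sqrt T"
    \<comment> \<open>Each shell is enlarged to the ball that contains it, because
      \<open>low\<close> controls balls.\<close>
    let ?g = "\<lambda>j \<xi>. exp (- (\<nu> * (real j)\<^sup>2)) * (indicator (ball 0 (?\<rho> j)) \<xi> * F \<xi>)"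
    have int: "integrable lborel (\<lambda>\<xi>. exp (- (\<nu> * (norm \<xi>)\<^sup>2 * T)) * F \<xi>)"
    proof (rule Bochner_Integration.integrable_bound[OF F_integrable])
      show "AE \<xi> in lborel. norm (exp (- (\<nu> * (norm \<xi>)\<^sup>2 * T)) * F \<xi>) \<le> norm (F \<xi>)"
        using \<nu> T F_nonneg by (intro AE_I2) (simp add: abs_mult mult_left_le_one_le)
    qed measurable
    have "ennreal (LINT \<xi>|lborel. exp (- (\<nu> * (norm \<xi>)\<^sup>2 * T)) * F \<xi>) = (\<integral>\<^sup>+ \<xi>. ennreal (exp (- (\<nu> * (norm \<xi>)\<^sup>2 * T)) * F \<xi>) \<partial>lborel)"
      by (rule nn_integral_eq_integral[symmetric, OF int]) (use F_nonneg in auto)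
    also have "\<dots> \<le> (\<integral>\<^sup>+ \<xi>. (\<Sum>j. ennreal (?g j \<xi>)) \<partial>lborel)"
    proof (rule nn_integral_mono)
      fix \<xi> :: 'a
      define j where "j = nat \<lfloor>norm \<xi> * sqrt T\<rfloor>"
      have j: "real j \<le> norm \<xi> * sqrt T" "norm \<xi> * sqrt T < real j + 1"
        using T by (auto simp: j_def of_nat_nat)
      have "(real j)\<^sup>2 \<le> (norm \<xi> * sqrt T)\<^sup>2" using j(1) by (intro power_mono) auto
      then have "(real j)\<^sup>2 \<le> (norm \<xi>)\<^sup>2 * T" using T by (simp add: power_mult_distrib)
      then have "exp (- (\<nu> * (norm \<xi>)\<^sup>2 * T)) \<le> exp (- (\<nu> * (real j)\<^sup>2))" using \<nu> by (simp add: mult.assoc)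
      moreover have "\<xi> \<in> ball 0 (?\<rho> j)" using j(2) T by (simp add: pos_less_divide_eq)
      ultimately have "exp (- (\<nu> * (norm \<xi>)\<^sup>2 * T)) * F \<xi> \<le> ?g j \<xi>"
        using F_nonneg[of \<xi>] by (simp add: mult_right_mono)
      then have "ennreal (exp (- (\<nu> * (norm \<xi>)\<^sup>2 * T)) * F \<xi>) \<le> ennreal (?g j \<xi>)" by (rule ennreal_leI)
      also have "\<dots> \<le> (\<Sum>j. ennreal (?g j \<xi>))"
        using sum_le_suminf[OF summableI, of "{j}" "\<lambda>j. ennreal (?g j \<xi>)"]
        by (simp only: sum.insert finite.intros sum.empty empty_iff not_False_eq_True add_0_right zero_le)
      finally show "ennreal (exp (- (\<nu> * (norm \<xi>)\<^sup>2 * T)) * F \<xi>) \<le> (\<Sum>j. ennreal (?g j \<xi>))" .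
    qed
    also have "\<dots> = (\<Sum>j. \<integral>\<^sup>+ \<xi>. ennreal (?g j \<xi>) \<partial>lborel)"
      by (rule nn_integral_suminf) measurable
    also have "\<dots> \<le> (\<Sum>j. ennreal (a * T powr (- s) * c j))"
    proof (intro suminf_le summableI)
      fix j
      have "(\<integral>\<^sup>+ \<xi>. ennreal (?g j \<xi>) \<partial>lborel) = ennreal (LINT \<xi>|lborel. ?g j \<xi>)"
        by (rule nn_integral_eq_integral) (use low_integrable F_nonneg in auto)
      also have "(LINT \<xi>|lborel. ?g j \<xi>) = exp (- (\<nu> * (real j)\<^sup>2)) * low_mass (?\<rho> j)"
        by (simp add: low_mass_def)
      also have "\<dots> \<le> exp (- (\<nu> * (real j)\<^sup>2)) * (a * (?\<rho> j) powr (2 * s))"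
        using T by (intro mult_left_mono low) auto
      also have "(?\<rho> j) powr (2 * s) = (real j + 1) powr (2 * s) * T powr (- s)"
        using T by (simp add: powr_divide powr_half_sqrt[symmetric] powr_powr powr_minus_divide)
      also have "exp (- (\<nu> * (real j)\<^sup>2)) * (a * ((real j + 1) powr (2 * s) * T powr (- s))) = a * T powr (- s) * c j"
        by (simp add: c_def)
      finally show "(\<integral>\<^sup>+ \<xi>. ennreal (?g j \<xi>) \<partial>lborel) \<le> ennreal (a * T powr (- s) * c j)"
        by (simp add: ennreal_leI)
    qed
    also have "\<dots> = ennreal (\<Sum>j. a * T powr (- s) * c j)"
      by (rule suminf_ennreal2) (use a c_nonneg c_sum in \<open>auto intro: summable_mult\<close>)
    also have "(\<Sum>j. a * T powr (- s) * c j) = a * T powr (- s) * suminf c"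
      by (rule suminf_mult[OF c_sum])
    finally have "(LINT \<xi>|lborel. exp (- (\<nu> * (norm \<xi>)\<^sup>2 * T)) * F \<xi>) \<le> a * T powr (- s) * suminf c"
      using a suminf_nonneg[OF c_sum c_nonneg] by (simp add: ennreal_le_iff)
    also have "\<dots> \<le> (a * suminf c + 1) * T powr (- s)" by (simp add: algebra_simps)
    finally show "(LINT \<xi>|lborel. exp (- (\<nu> * (norm \<xi>)\<^sup>2 * T)) * F \<xi>) \<le> (a * suminf c + 1) * T powr (- s)" .
  qed
qed

text \<open>The threshold \<alpha> |\<xi>| = 1 is where the two terms of the denominator agree.
  Below it the weight is at most 2, and replacing t by 1 + t costs at most exp (\<nu> / \<alpha>^2).
  Above it twice the rate is at least \<nu> / \<alpha>^2, and the unbounded weight stays attached to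
  \<open>F\<close>.\<close>

lemma energy_pointwise_upper:
  assumes t: "t \<ge> 0"
  shows "(1 + \<alpha>\<^sup>2 * (norm \<xi>)\<^sup>2) * (exp (- (rate \<xi> * t)))\<^sup>2 * F \<xi> \<le>
    2 * exp (\<nu> / \<alpha>\<^sup>2) * (exp (- (\<nu> * (norm \<xi>)\<^sup>2 * (1 + t))) * F \<xi>)
    + exp (- (\<nu> / \<alpha>\<^sup>2 * t)) * ((1 + \<alpha>\<^sup>2 * (norm \<xi>)\<^sup>2) * F \<xi>)"
proof -
  have sq: "(exp (- (rate \<xi> * t)))\<^sup>2 = exp (- (2 * rate \<xi> * t))"
    by (simp add: power2_eq_square flip: exp_add)
  show ?thesis
  proof (cases "\<alpha>\<^sup>2 * (norm \<xi>)\<^sup>2 \<le> 1")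
    case True
    have "\<nu> * (norm \<xi>)\<^sup>2 / 2 \<le> rate \<xi>"
      unfolding rate_def using \<nu> den_pos(1)[of \<xi>] True by (intro divide_left_mono mult_pos_pos) auto
    then have "\<nu> * (norm \<xi>)\<^sup>2 * t \<le> 2 * rate \<xi> * t" using t by (intro mult_right_mono) auto
    moreover have "(norm \<xi>)\<^sup>2 \<le> 1 / \<alpha>\<^sup>2" using True \<alpha> by (simp add: field_simps)
    then have "\<nu> * (norm \<xi>)\<^sup>2 \<le> \<nu> / \<alpha>\<^sup>2" using \<nu> mult_left_mono[of "(norm \<xi>)\<^sup>2" "1 / \<alpha>\<^sup>2" \<nu>] by simp
    ultimately have "exp (- (2 * rate \<xi> * t)) \<le> exp (\<nu> / \<alpha>\<^sup>2) * exp (- (\<nu> * (norm \<xi>)\<^sup>2 * (1 + t)))"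
      by (simp add: algebra_simps flip: exp_add)
    then have "(1 + \<alpha>\<^sup>2 * (norm \<xi>)\<^sup>2) * exp (- (2 * rate \<xi> * t)) * F \<xi> \<le> 2 * (exp (\<nu> / \<alpha>\<^sup>2) * exp (- (\<nu> * (norm \<xi>)\<^sup>2 * (1 + t)))) * F \<xi>"
      using True F_nonneg[of \<xi>] den_pos[of \<xi>] by (intro mult_right_mono mult_mono) auto
    moreover have "0 \<le> exp (- (\<nu> / \<alpha>\<^sup>2 * t)) * ((1 + \<alpha>\<^sup>2 * (norm \<xi>)\<^sup>2) * F \<xi>)"
      using F_nonneg[of \<xi>] den_pos[of \<xi>] by simp
    ultimately show ?thesis unfolding sq by (simp add: mult.assoc)
  next
    case False
    have "\<nu> / \<alpha>\<^sup>2 \<le> 2 * rate \<xi>"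
    proof -
      have "1 + \<alpha>\<^sup>2 * (norm \<xi>)\<^sup>2 \<le> 2 * (\<alpha>\<^sup>2 * (norm \<xi>)\<^sup>2)" using False by simp
      then have "\<nu> * (1 + \<alpha>\<^sup>2 * (norm \<xi>)\<^sup>2) \<le> \<nu> * (2 * (\<alpha>\<^sup>2 * (norm \<xi>)\<^sup>2))" using \<nu> by (intro mult_left_mono) auto
      then have "\<nu> * (1 + \<alpha>\<^sup>2 * (norm \<xi>)\<^sup>2) / \<alpha>\<^sup>2 \<le> \<nu> * (2 * (\<alpha>\<^sup>2 * (norm \<xi>)\<^sup>2)) / \<alpha>\<^sup>2" by (rule divide_right_mono) simp
      then have "\<nu> / \<alpha>\<^sup>2 * (1 + \<alpha>\<^sup>2 * (norm \<xi>)\<^sup>2) \<le> 2 * (\<nu> * (norm \<xi>)\<^sup>2)" using \<alpha> by simp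
      then have "\<nu> / \<alpha>\<^sup>2 \<le> 2 * (\<nu> * (norm \<xi>)\<^sup>2) / (1 + \<alpha>\<^sup>2 * (norm \<xi>)\<^sup>2)"
        by (simp only: pos_le_divide_eq[OF den_pos(1)])
      then show ?thesis by (simp add: rate_def)
    qed
    then have "exp (- (2 * rate \<xi> * t)) \<le> exp (- (\<nu> / \<alpha>\<^sup>2 * t))"
      using t by (simp add: mult_right_mono del: times_divide_eq_left)
    then have "exp (- (2 * rate \<xi> * t)) * ((1 + \<alpha>\<^sup>2 * (norm \<xi>)\<^sup>2) * F \<xi>) \<le> exp (- (\<nu> / \<alpha>\<^sup>2 * t)) * ((1 + \<alpha>\<^sup>2 * (norm \<xi>)\<^sup>2) * F \<xi>)"
      using F_nonneg[of \<xi>] den_pos[of \<xi>] by (intro mult_right_mono) auto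
    moreover have "0 \<le> 2 * exp (\<nu> / \<alpha>\<^sup>2) * (exp (- (\<nu> * (norm \<xi>)\<^sup>2 * (1 + t))) * F \<xi>)"
      using F_nonneg[of \<xi>] by simp
    ultimately show ?thesis unfolding sq by (simp add: mult_ac)
  qed
qed

lemma energy_upper_bound:
  assumes s: "s > 0" and a: "a \<ge> 0" and \<rho>0: "\<rho>0 > 0"
    and low: "\<And>\<rho>. 0 < \<rho> \<Longrightarrow> \<rho> < \<rho>0 \<Longrightarrow> low_mass \<rho> \<le> a * \<rho> powr (2 * s)"
  shows "\<exists>C>0. \<forall>t>0. energy t \<le> C * (1 + t) powr (- s)"
proof -
  let ?I = "LINT \<xi>|lborel. F \<xi>" and ?H = "LINT \<xi>|lborel. (1 + \<alpha>\<^sup>2 * (norm \<xi>)\<^sup>2) * F \<xi>"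
  have I: "0 \<le> ?I" using F_nonneg by simp
  have H: "0 \<le> ?H" using F_nonneg den_pos(1) by (intro Bochner_Integration.integral_nonneg) (auto simp: less_imp_le)
  \<comment> \<open>The added term extends the mass bound from small radii to all: beyond
    \<open>\<rho>0\<close> the total mass suffices, because \<rho>^(2 s) increases with \<rho> for
    positive s.\<close>
  define a' where "a' = a + ?I / \<rho>0 powr (2 * s)"
  have a': "a' \<ge> 0" using a I by (simp add: a'_def)
  have "low_mass \<rho> \<le> a' * \<rho> powr (2 * s)" if "\<rho> > 0" for \<rho>
  proof (cases "\<rho> < \<rho>0")
    case True
    have "low_mass \<rho> \<le> a * \<rho> powr (2 * s)" using low that True .
    also have "\<dots> \<le> a' * \<rho> powr (2 * s)" using I by (intro mult_right_mono) (auto simp: a'_def)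
    finally show ?thesis .
  next
    case False
    have "low_mass \<rho> \<le> ?I"
      unfolding low_mass_def using F_nonneg
      by (intro integral_mono low_integrable F_integrable) (auto simp: indicator_def)
    also have "\<dots> = ?I / \<rho>0 powr (2 * s) * \<rho>0 powr (2 * s)" using \<rho>0 by simp
    also have "\<dots> \<le> a' * \<rho> powr (2 * s)"
      using a I False \<rho>0 s by (intro mult_mono powr_mono2) (auto simp: a'_def)
    finally show ?thesis .
  qed
  from gaussian_moment_bound[OF s a' this] obtain C where C: "C > 0"
    "\<And>T. T > 0 \<Longrightarrow> (LINT \<xi>|lborel. exp (- (\<nu> * (norm \<xi>)\<^sup>2 * T)) * F \<xi>) \<le> C * T powr (- s)" by auto
  define b where "b = \<nu> / \<alpha>\<^sup>2"
  have b: "b > 0" using \<nu> \<alpha> by (simp add: b_def)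
  \<comment> \<open>Used to absorb the exponentially decaying high-frequency part into the algebraic
    rate.\<close>
  obtain K where K: "K > 0" "\<And>x. x > 0 \<Longrightarrow> x powr s \<le> K * exp (b * x)"
    using powr_le_exp[OF b s] by auto
  show ?thesis
  proof (intro exI conjI allI impI)
    show "2 * exp b * C + K * exp b * ?H > 0"
      using C K H by (intro add_pos_nonneg) auto
    fix t :: real assume t: "t > 0"
    have e: "exp (- (b * t)) \<le> K * exp b * (1 + t) powr (- s)"
    proof -
      have "(1 + t) powr s * (exp (- (b * t)) * (1 + t) powr (- s)) \<le> (K * exp (b * (1 + t))) * (exp (- (b * t)) * (1 + t) powr (- s))"
        using K(2)[of "1 + t"] t by (intro mult_right_mono) auto
      also have "\<dots> = K * (exp (b * (1 + t)) * exp (- (b * t))) * (1 + t) powr (- s)" by simp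
      also have "exp (b * (1 + t)) * exp (- (b * t)) = exp b" by (simp add: algebra_simps flip: exp_add)
      finally show ?thesis using t by (simp add: powr_minus field_simps)
    qed
    have int: "integrable lborel (\<lambda>\<xi>. exp (- (\<nu> * (norm \<xi>)\<^sup>2 * (1 + t))) * F \<xi>)"
    proof (rule Bochner_Integration.integrable_bound[OF F_integrable])
      show "AE \<xi> in lborel. norm (exp (- (\<nu> * (norm \<xi>)\<^sup>2 * (1 + t))) * F \<xi>) \<le> norm (F \<xi>)"
        using \<nu> t F_nonneg by (intro AE_I2) (simp add: abs_mult mult_left_le_one_le)
    qed measurable
    have "energy t \<le> (LINT \<xi>|lborel. 2 * exp b * (exp (- (\<nu> * (norm \<xi>)\<^sup>2 * (1 + t))) * F \<xi>)
      + exp (- (b * t)) * ((1 + \<alpha>\<^sup>2 * (norm \<xi>)\<^sup>2) * F \<xi>))"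
      unfolding energy_def b_def
      by (intro integral_mono energy_integrable energy_pointwise_upper Bochner_Integration.integrable_add integrable_mult_right int F_int)
         (use t in auto)
    also have "\<dots> = 2 * exp b * (LINT \<xi>|lborel. exp (- (\<nu> * (norm \<xi>)\<^sup>2 * (1 + t))) * F \<xi>) + exp (- (b * t)) * ?H"
      by (subst Bochner_Integration.integral_add) (use int F_int in simp_all)
    also have "\<dots> \<le> 2 * exp b * (C * (1 + t) powr (- s)) + K * exp b * (1 + t) powr (- s) * ?H"
      using C(2)[of "1 + t"] t e H by (intro add_mono mult_left_mono mult_right_mono) auto
    also have "\<dots> = (2 * exp b * C + K * exp b * ?H) * (1 + t) powr (- s)" by (simp add: algebra_simps)
    finally show "energy t \<le> (2 * exp b * C + K * exp b * ?H) * (1 + t) powr (- s)" .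
  qed
qed

end

section \<open>From the decay character to the decay of solutions\<close>

lemma solution_energy:
  fixes v0 :: "real^'n \<Rightarrow> complex" and v :: "real \<Rightarrow> real^'n \<Rightarrow> complex"
  assumes \<alpha>: "\<alpha> > 0" and \<nu>: "\<nu> > 0" and v0: "v0 \<in> H1" and sol: "linear_solution \<alpha> \<nu> v0 v"
  shows "spectral_energy \<alpha> \<nu> (\<lambda>\<xi>. (cmod (fourier_L2 v0 \<xi>))\<^sup>2 / (2 * pi) ^ CARD('n))" (is ?A)
    and "t \<ge> 0 \<Longrightarrow> (H1_norm \<alpha> (v t))\<^sup>2 =
      spectral_energy.energy \<alpha> \<nu> (\<lambda>\<xi>. (cmod (fourier_L2 v0 \<xi>))\<^sup>2 / (2 * pi) ^ CARD('n)) t" (is "_ \<Longrightarrow> ?B")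
proof -
  let ?c = "(2 * pi) ^ CARD('n)"
  have V0: "square_integrable v0" using v0 by (simp add: H1_def)
  note [measurable] = square_integrableD(1)[OF fourier_L2_spec(1)[OF V0]]
  show A: ?A
    by unfold_locales (use \<alpha> \<nu> H1_norm_fourier(1)[OF v0, of \<alpha>] in auto)
  interpret spectral_energy \<alpha> \<nu> "\<lambda>\<xi>. (cmod (fourier_L2 v0 \<xi>))\<^sup>2 / ?c" by (rule A)
  show ?B if t: "t \<ge> 0"
  proof -
    have H: "v t \<in> H1" using sol t by (auto simp: linear_solution_def)
    note [measurable] = square_integrableD(1)[OF fourier_L2_spec(1)[OF H1_weak_gradient(1)[OF H]]]
    have "(H1_norm \<alpha> (v t))\<^sup>2 = (LINT \<xi>|lborel. (1 + \<alpha>\<^sup>2 * (norm \<xi>)\<^sup>2) * (cmod (fourier_L2 (v t) \<xi>))\<^sup>2 / ?c)"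
      unfolding H1_norm_fourier(2)[OF H] by simp
    also have "\<dots> = energy t"
      unfolding energy_def
    proof (rule integral_cong_AE)
      show "AE \<xi> in lborel. (1 + \<alpha>\<^sup>2 * (norm \<xi>)\<^sup>2) * (cmod (fourier_L2 (v t) \<xi>))\<^sup>2 / ?c =
        (1 + \<alpha>\<^sup>2 * (norm \<xi>)\<^sup>2) * (exp (- (rate \<xi> * t)))\<^sup>2 * ((cmod (fourier_L2 v0 \<xi>))\<^sup>2 / ?c)"
        using linear_solution_fourier[OF \<alpha> \<nu> v0 sol t]
        by eventually_elim (simp add: norm_mult power_mult_distrib rate_def del: of_real_exp)
    qed measurable
    finally show ?thesis .
  qed
qed

lemma powr_scaled_le_iff:
  fixes x a r :: real
  assumes "x > 0"
  shows "a \<le> x powr (- r) * y \<longleftrightarrow> a * x powr r \<le> y" "x powr (- r) * y \<le> a \<longleftrightarrow> y \<le> a * x powr r"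
  using assms by (simp_all add: powr_minus_divide field_simps)

theorem theorem2p8:
  fixes \<alpha> \<nu> :: real
    and v0 :: "real^'n \<Rightarrow> complex"
    and v :: "real \<Rightarrow> real^'n \<Rightarrow> complex"
    and rs :: ereal
  assumes "\<alpha> > 0" and "\<nu> > \<alpha>\<^sup>2"
    and "v0 \<in> H1"
    and "has_decay_character v0 rs"
    and "linear_solution \<alpha> \<nu> v0 v"
  shows "(\<forall>r. rs = ereal r \<and> - real CARD('n) / 2 < r \<longrightarrow>
            (\<exists>C1>0. \<exists>C2>0. \<exists>C3>0. \<forall>t>0.
               C1 * (1 + t) powr (- (real CARD('n) / 2 + r)) \<le> (H1_norm \<alpha> (v t))\<^sup>2 \<and>
               (H1_norm \<alpha> (v t))\<^sup>2 \<le> C2 * (C3 + t) powr (- (real CARD('n) / 2 + r))))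
       \<and> (rs = ereal (- real CARD('n) / 2) \<longrightarrow>
            (\<forall>\<epsilon>>0. \<exists>C>0. \<forall>t>0. (H1_norm \<alpha> (v t))\<^sup>2 \<ge> C * (1 + t) powr (- \<epsilon>)))
       \<and> (rs = \<infinity> \<longrightarrow>
            (\<forall>m>0. \<exists>C>0. \<forall>t>0. (H1_norm \<alpha> (v t))\<^sup>2 \<le> C * (1 + t) powr (- m)))"
proof -
  let ?n = "real CARD('n)"
  define c where "c = (2 * pi) ^ CARD('n)"
  define F where "F \<xi> = (cmod (fourier_L2 v0 \<xi>))\<^sup>2 / c" for \<xi>
  have \<nu>: "\<nu> > 0" using assms(2) zero_le_power2[of \<alpha>] by linarith
  interpret spectral_energy \<alpha> \<nu> F
    unfolding F_def[abs_def] c_def by (rule solution_energy(1)[OF assms(1) \<nu> assms(3,5)])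
  have E: "(H1_norm \<alpha> (v t))\<^sup>2 = energy t" if "t > 0" for t
    unfolding F_def[abs_def] c_def using solution_energy(2)[OF assms(1) \<nu> assms(3,5), of t] that by simp
  have c: "c > 0" by (simp add: c_def)
  define \<Phi> where "\<Phi> \<rho> = (LINT \<xi>:ball 0 \<rho>|lborel. (cmod (fourier_L2 v0 \<xi>))\<^sup>2)" for \<rho>
  have low: "low_mass \<rho> = \<Phi> \<rho> / c" for \<rho>
    by (simp add: low_mass_def \<Phi>_def set_lebesgue_integral_def F_def)
  \<comment> \<open>The shift r = s - n/2 turns the exponent of the indicator into - 2 s, and s is
    exactly the decay rate; r > - n/2 becomes s > 0.\<close>
  have ind: "has_decay_indicator v0 (s - ?n / 2) P \<longleftrightarrow> ((\<lambda>\<rho>. ereal (\<rho> powr (- (2 * s)) * \<Phi> \<rho>)) \<longlongrightarrow> P) (at_right 0)" for s P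
    by (simp add: has_decay_indicator_def \<Phi>_def algebra_simps)
  \<comment> \<open>Any positive limit, finite or infinite, bounds the mass from below near 0. One
    argument thus serves both a finite character and the character - n/2.\<close>
  have lower: "\<exists>C>0. \<forall>t>0. C * (1 + t) powr (- s) \<le> (H1_norm \<alpha> (v t))\<^sup>2"
    if "has_decay_indicator v0 (s - ?n / 2) P" "P > 0" for s P
  proof -
    obtain a where a: "0 < ereal a" "ereal a < P" using ereal_dense2[OF \<open>P > 0\<close>] by blast
    from order_tendstoD(1)[OF that(1)[unfolded ind] a(2)] obtain \<rho>0
      where \<rho>0: "\<rho>0 > 0" "\<And>\<rho>. 0 < \<rho> \<Longrightarrow> \<rho> < \<rho>0 \<Longrightarrow> a < \<rho> powr (- (2 * s)) * \<Phi> \<rho>"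
      by (auto simp: eventually_at_right_field)
    have "a / c * \<rho> powr (2 * s) \<le> low_mass \<rho>" if "0 < \<rho>" "\<rho> < \<rho>0" for \<rho>
      using divide_right_mono[of "a * \<rho> powr (2 * s)" "\<Phi> \<rho>" c] less_imp_le[OF \<rho>0(2)[OF that]] powr_scaled_le_iff(1)[OF that(1)] c
      by (simp add: low)
    from energy_lower_bound[OF _ \<rho>0(1) this] a(1) c obtain C where "C > 0" "\<forall>t>0. C * (1 + t) powr (- s) \<le> energy t"
      by auto
    then show ?thesis using E by auto
  qed
  \<comment> \<open>Dually, any finite limit, zero included, bounds the mass from above; this serves
    a finite and an infinite character.\<close>
  have upper: "\<exists>C>0. \<forall>t>0. (H1_norm \<alpha> (v t))\<^sup>2 \<le> C * (1 + t) powr (- s)"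
    if "has_decay_indicator v0 (s - ?n / 2) P" "0 \<le> P" "P < \<infinity>" "s > 0" for s P
  proof -
    obtain a where a: "P < ereal a" using ereal_dense2[OF \<open>P < \<infinity>\<close>] by blast
    from order_tendstoD(2)[OF that(1)[unfolded ind] a] obtain \<rho>0
      where \<rho>0: "\<rho>0 > 0" "\<And>\<rho>. 0 < \<rho> \<Longrightarrow> \<rho> < \<rho>0 \<Longrightarrow> \<rho> powr (- (2 * s)) * \<Phi> \<rho> < a"
      by (auto simp: eventually_at_right_field)
    have a0: "a \<ge> 0" using le_less_trans[OF that(2) a] by simp
    have "low_mass \<rho> \<le> a / c * \<rho> powr (2 * s)" if "0 < \<rho>" "\<rho> < \<rho>0" for \<rho>
      using divide_right_mono[of "\<Phi> \<rho>" "a * \<rho> powr (2 * s)" c] less_imp_le[OF \<rho>0(2)[OF that]] powr_scaled_le_iff(2)[OF that(1)] c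
      by (simp add: low)
    from energy_upper_bound[OF that(4) _ \<rho>0(1) this] a0 c obtain C where "C > 0" "\<forall>t>0. energy t \<le> C * (1 + t) powr (- s)"
      by auto
    then show ?thesis using E by auto
  qed
  note dc = assms(4)[unfolded has_decay_character_def]
  show ?thesis
  proof (intro conjI allI impI)
    fix r assume r: "rs = ereal r \<and> - ?n / 2 < r"
    then obtain P where P: "0 < P" "P < \<infinity>" "has_decay_indicator v0 ((?n / 2 + r) - ?n / 2) P"
      using dc by auto
    from lower[OF P(3,1)] upper[OF P(3) _ P(2)] P(1) r
    obtain C1 C2 where "C1 > 0" "C2 > 0"
      "\<forall>t>0. C1 * (1 + t) powr (- (?n / 2 + r)) \<le> (H1_norm \<alpha> (v t))\<^sup>2"
      "\<forall>t>0. (H1_norm \<alpha> (v t))\<^sup>2 \<le> C2 * (1 + t) powr (- (?n / 2 + r))"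
      by (auto simp: less_imp_le)
    then show "\<exists>C1>0. \<exists>C2>0. \<exists>C3>0. \<forall>t>0.
               C1 * (1 + t) powr (- (?n / 2 + r)) \<le> (H1_norm \<alpha> (v t))\<^sup>2 \<and>
               (H1_norm \<alpha> (v t))\<^sup>2 \<le> C2 * (C3 + t) powr (- (?n / 2 + r))"
      by (intro exI[of _ C1] conjI exI[of _ C2] exI[of _ "1::real"]) auto
  next
    fix \<epsilon> :: real assume rs: "rs = ereal (- ?n / 2)" and "\<epsilon> > 0"
    \<comment> \<open>A finite exponent in the first alternative would exceed - n/2, so
      \<open>rs\<close> selects the second. The indicator is then infinite just above - n/2, at
      distance \<epsilon>.\<close>
    then have "has_decay_indicator v0 (\<epsilon> - ?n / 2) \<infinity>"
      using dc by auto
    from lower[OF this] show "\<exists>C>0. \<forall>t>0. (H1_norm \<alpha> (v t))\<^sup>2 \<ge> C * (1 + t) powr (- \<epsilon>)"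
      by simp
  next
    fix m :: real assume rs: "rs = \<infinity>" and m: "m > 0"
    then have "has_decay_indicator v0 (m - ?n / 2) 0"
      using dc by auto
    from upper[OF this _ _ m] show "\<exists>C>0. \<forall>t>0. (H1_norm \<alpha> (v t))\<^sup>2 \<le> C * (1 + t) powr (- m)"
      by simp
  qed
qed

end
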